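(* For any partition $\mu$, $B(\mu)=T\ltimes G_{\mu,y}$, where $G_{\mu,y}$ is the subgroup of $G_y$ generated by the transformations $\{(x+\lambda y^{s-1},y)\;:\;s\in S_\mu,\ \lambda\in\mathbb{C}\}$.
   Context: $G$ is the group of all $\mathbb{C}$-algebra automorphisms $\sigma=(\sigma(x),\sigma(y))$ of $\mathbb{C}\langle x,y\rangle$ with $\sigma([x,y])=[x,y]$. Subgroups: $B$ consists of all $(ax+q(y),a^{-1}y+h)$ with $a\in\mathbb{C}^*$, $h\in\mathbb{C}$, $q\in\mathbb{C}[y]$; $T=\{(ax,a^{-1}y):a\in\mathbb{C}^*\}$; $G_y=\{(x+q(y),y):q\in\mathbb{C}[y]\}$. For $n\ge 1$, $\mathcal{C}_n$ is the quotient, by simultaneous conjugation by $\mathrm{PGL}_n(\mathbb{C})$, of the set of pairs $(X,Y)$ of complex $n\times n$ matrices with $\mathrm{rank}([X,Y]+I_n)=1$. $G$ acts on $\mathcal{C}_n$ by $\sigma\cdot(X,Y)=(\sigma^{-1}(X),\sigma^{-1}(Y))$, where $\tau(X),\tau(Y)$ are obtained by substituting $x=X$, $y=Y$ into $\tau(x),\tau(y)$. The $T$-fixed points of $\mathcal{C}_n$ are in bijection $\mu\mapsto(X_\mu,Y_\mu)$ with the partitions of $n$ (Wilson). For a one-hook partition $\mu=(1,\dots,1,n-r+1)$ with $r-1$ ones, $Y_\mu=J(n)$ is the nilpotent Jordan block with ones on the first superdiagonal, and $X_\mu$ has nonzero entries only on the first subdiagonal, where they are $(1,2,\dots,r-1;\,-(n-r),\dots,-2,-1)$.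 In general the Young diagram of $\mu$ (parts as rows) is decomposed into nested hooks with $i$-th hook of size $h_i$ equal to the diagram of $(1,\dots,1,h_i-r_i+1)$ ($r_i-1$ ones); then $Y_\mu=\bigoplus_i J(h_i)$, and $X_\mu$ is a block matrix with diagonal blocks $X_{ii}$ the one-hook matrices just described and off-diagonal blocks $X_{ij}$ with nonzero entries only on the $(r_j-r_i-1)$-th diagonal (positive numbers counting above the main diagonal), these data determining a unique point of $\mathcal{C}_n$. For a partition $\mu=(n_1\le n_2\le\cdots\le n_k)$ of $n$: $B(\mu)=\mathrm{Stab}_B(X_\mu,Y_\mu)$; $r_i=i+n_k-n_{k-i}$ for $i\ge 0$, with the convention $n_j=0$ for $j\le 0$ (here $r_i$ are new numbers, unrelated to the hook data), so $r_0=0$; $R_\mu=\{r_0,r_1,r_2,\dots\}$; and $S_\mu=\{k\in\{1,2,3,\dots\}:k+R_\mu\subset R_\mu\}$. *)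

theory Defs
  imports
    "HOL-Library.Poly_Mapping"
    "HOL-Computational_Algebra.Polynomial"
    "HOL-Algebra.Generated_Groups"
    "HOL-Algebra.Group_Action"
    "Jordan_Normal_Form.Jordan_Normal_Form"
    "Jordan_Normal_Form.DL_Rank"
begin

section \<open>The free associative algebra in two generators\<close>

datatype generator = GenX | GenY

text \<open>
  The wrapper type carries the free monoid structure (written additively). The convolution product
  of \<^theory>\<open>HOL-Library.Poly_Mapping\<close> on finitely supported functions
  then is the noncommutative multiplication of the free algebra.
\<close>

datatype word = Word (letters: "generator list")

instantiation word :: monoid_add
begin

definition zero_word :: word where
  "0 = Word []"

definition plus_word :: "word \<Rightarrow> word \<Rightarrow> word" where
  "u + v = Word (letters u @ letters v)"

instance
  by standard (simp_all add: zero_word_def plus_word_def)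

end

type_synonym free_alg = "word \<Rightarrow>\<^sub>0 complex"

definition const :: "complex \<Rightarrow> free_alg" where
  "const c = Poly_Mapping.single 0 c"

definition var_x :: free_alg where
  "var_x = Poly_Mapping.single (Word [GenX]) 1"

definition var_y :: free_alg where
  "var_y = Poly_Mapping.single (Word [GenY]) 1"

definition poly_y :: "complex poly \<Rightarrow> free_alg" where
  "poly_y q = (\<Sum>i\<le>degree q. const (coeff q i) * var_y ^ i)"

definition commutator :: "'a::ring \<Rightarrow> 'a \<Rightarrow> 'a" where
  "commutator p q = p * q - q * p"


section \<open>The automorphism group and its subgroups\<close>

definition alg_automorphism :: "(free_alg \<Rightarrow> free_alg) \<Rightarrow> bool" where
  "alg_automorphism \<sigma> \<longleftrightarrow>
     bij \<sigma> \<and> \<sigma> 1 = 1 \<and>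
     (\<forall>p q. \<sigma> (p + q) = \<sigma> p + \<sigma> q) \<and>
     (\<forall>p q. \<sigma> (p * q) = \<sigma> p * \<sigma> q) \<and>
     (\<forall>c p. \<sigma> (const c * p) = const c * \<sigma> p)"

definition cm_group :: "(free_alg \<Rightarrow> free_alg) monoid" where
  "cm_group =
     \<lparr>carrier = {\<sigma>. alg_automorphism \<sigma> \<and>
                  \<sigma> (commutator var_x var_y) = commutator var_x var_y},
      monoid.mult = (\<circ>), one = id\<rparr>"

definition subgroup_B :: "(free_alg \<Rightarrow> free_alg) set" where
  "subgroup_B = {\<sigma> \<in> carrier cm_group. \<exists>a h q. a \<noteq> 0 \<and>
     \<sigma> var_x = const a * var_x + poly_y q \<and>
     \<sigma> var_y = const (inverse a) * var_y + const h}"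

definition subgroup_T :: "(free_alg \<Rightarrow> free_alg) set" where
  "subgroup_T = {\<sigma> \<in> carrier cm_group. \<exists>a. a \<noteq> 0 \<and>
     \<sigma> var_x = const a * var_x \<and>
     \<sigma> var_y = const (inverse a) * var_y}"

definition subgroup_Gy :: "(free_alg \<Rightarrow> free_alg) set" where
  "subgroup_Gy = {\<sigma> \<in> carrier cm_group. \<exists>q.
     \<sigma> var_x = var_x + poly_y q \<and> \<sigma> var_y = var_y}"

text \<open>
  \<open>internal_semidirect G K H N\<close>: the subgroup \<open>K\<close> of \<open>G\<close> is the internal
  semidirect product of its subgroup \<open>H\<close> and its normal subgroup \<open>N\<close>.
\<close>

definition internal_semidirect ::
  "('a, 'b) monoid_scheme \<Rightarrow> 'a set \<Rightarrow> 'a set \<Rightarrow> 'a set \<Rightarrow> bool" where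
  "internal_semidirect G K H N \<longleftrightarrow>
     subgroup K G \<and>
     subgroup H (G\<lparr>carrier := K\<rparr>) \<and>
     N \<lhd> (G\<lparr>carrier := K\<rparr>) \<and>
     H \<inter> N = {\<one>\<^bsub>G\<^esub>} \<and>
     H <#>\<^bsub>G\<^esub> N = K"


section \<open>Calogero--Moser spaces\<close>

definition cm_pairs :: "nat \<Rightarrow> (complex mat \<times> complex mat) set" where
  "cm_pairs n = {(X, Y). X \<in> carrier_mat n n \<and> Y \<in> carrier_mat n n \<and>
     vec_space.rank n (X * Y - Y * X + 1\<^sub>m n) = 1}"

text \<open>
  Scalar matrices conjugate trivially, so the orbits of the projective linear group are those of the
  general linear group.
\<close>

definition cm_conj :: "nat \<Rightarrow> ((complex mat \<times> complex mat) \<times> (complex mat \<times> complex mat)) set" where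
  "cm_conj n = {((X, Y), (X', Y')). (X, Y) \<in> cm_pairs n \<and> (X', Y') \<in> cm_pairs n \<and>
     (\<exists>P Q. similar_mat_wit X X' P Q \<and> similar_mat_wit Y Y' P Q)}"

definition cm_space :: "nat \<Rightarrow> (complex mat \<times> complex mat) set set" where
  "cm_space n = cm_pairs n // cm_conj n"

definition eval_word :: "nat \<Rightarrow> complex mat \<Rightarrow> complex mat \<Rightarrow> word \<Rightarrow> complex mat" where
  "eval_word n X Y w =
     foldr (\<lambda>g M. (case g of GenX \<Rightarrow> X | GenY \<Rightarrow> Y) * M) (letters w) (1\<^sub>m n)"

definition substitute :: "nat \<Rightarrow> complex mat \<Rightarrow> complex mat \<Rightarrow> free_alg \<Rightarrow> complex mat" where
  "substitute n X Y p = mat n n (\<lambda>ij.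
     \<Sum>w\<in>Poly_Mapping.keys p. Poly_Mapping.lookup p w * (eval_word n X Y w $$ ij))"

definition act_pair ::
  "nat \<Rightarrow> (free_alg \<Rightarrow> free_alg) \<Rightarrow> complex mat \<times> complex mat \<Rightarrow> complex mat \<times> complex mat" where
  "act_pair n \<sigma> = (\<lambda>(X, Y).
     (substitute n X Y ((inv\<^bsub>cm_group\<^esub> \<sigma>) var_x),
      substitute n X Y ((inv\<^bsub>cm_group\<^esub> \<sigma>) var_y)))"

definition cm_action ::
  "nat \<Rightarrow> (free_alg \<Rightarrow> free_alg) \<Rightarrow> (complex mat \<times> complex mat) set \<Rightarrow> (complex mat \<times> complex mat) set" where
  "cm_action n \<sigma> p = (\<Union>XY\<in>p. cm_conj n `` {act_pair n \<sigma> XY})"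


section \<open>Partitions and hooks\<close>

text \<open>A partition is the weakly increasing list of its (positive) parts.\<close>

definition is_partition :: "nat list \<Rightarrow> nat \<Rightarrow> bool" where
  "is_partition \<mu> n \<longleftrightarrow> sorted \<mu> \<and> 0 \<notin> set \<mu> \<and> sum_list \<mu> = n"

text \<open>Cells are (row, column), both counted from zero, with the longest row first.\<close>

definition young_diagram :: "nat list \<Rightarrow> (nat \<times> nat) set" where
  "young_diagram \<mu> = {(a, b). a < length \<mu> \<and> b < rev \<mu> ! a}"

text \<open>The nested hooks are counted from zero, outermost first.\<close>

definition hook :: "nat list \<Rightarrow> nat \<Rightarrow> (nat \<times> nat) set" where
  "hook \<mu> i = {(a, b) \<in> young_diagram \<mu>. min a b = i}"

definition num_hooks :: "nat list \<Rightarrow> nat" where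
  "num_hooks \<mu> = card {i. hook \<mu> i \<noteq> {}}"

definition hook_size :: "nat list \<Rightarrow> nat \<Rightarrow> nat" where
  "hook_size \<mu> i = card (hook \<mu> i)"

definition hook_rows :: "nat list \<Rightarrow> nat \<Rightarrow> nat" where
  "hook_rows \<mu> i = card (fst ` hook \<mu> i)"

definition hook_offset :: "nat list \<Rightarrow> nat \<Rightarrow> nat" where
  "hook_offset \<mu> i = (\<Sum>l<i. hook_size \<mu> l)"


section \<open>The torus-fixed points\<close>

text \<open>
  The first subdiagonal is \<open>1, 2, \<dots>, r - 1, -(h - r), \<dots>, -2, -1\<close>;
  matrix indices start at zero, so its entries are at \<open>(b + 1, b)\<close>.
\<close>

definition hook_matrix :: "nat \<Rightarrow> nat \<Rightarrow> complex mat" where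
  "hook_matrix h r = mat h h (\<lambda>(a, b).
     if a = b + 1 then (if a < r then of_nat a else - of_nat (h - a)) else 0)"

definition hook_block :: "nat list \<Rightarrow> complex mat \<Rightarrow> nat \<Rightarrow> nat \<Rightarrow> complex mat" where
  "hook_block \<mu> X i j = mat (hook_size \<mu> i) (hook_size \<mu> j)
     (\<lambda>(a, b). X $$ (hook_offset \<mu> i + a, hook_offset \<mu> j + b))"

definition fixed_Y :: "nat list \<Rightarrow> complex mat" where
  "fixed_Y \<mu> = jordan_matrix (map (\<lambda>i. (hook_size \<mu> i, 0)) [0..<num_hooks \<mu>])"

definition fixed_X_shape :: "nat list \<Rightarrow> complex mat \<Rightarrow> bool" where
  "fixed_X_shape \<mu> X \<longleftrightarrow>
     X \<in> carrier_mat (sum_list \<mu>) (sum_list \<mu>) \<and>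
     (\<forall>i<num_hooks \<mu>. hook_block \<mu> X i i = hook_matrix (hook_size \<mu> i) (hook_rows \<mu> i)) \<and>
     (\<forall>i<num_hooks \<mu>. \<forall>j<num_hooks \<mu>. i \<noteq> j \<longrightarrow>
        (\<forall>a<hook_size \<mu> i. \<forall>b<hook_size \<mu> j. hook_block \<mu> X i j $$ (a, b) \<noteq> 0 \<longrightarrow>
           int b - int a = int (hook_rows \<mu> j) - int (hook_rows \<mu> i) - 1))"

text \<open>
  The shape of \<open>X\<close> leaves the off-diagonal entries open; together with the rank condition
  it determines the pair up to conjugation: the rank condition forces the off-diagonal blocks of
  \<open>[X, Y] + 1\<close> to be \<open>v\<^sub>i * w\<^sub>j\<close> times the matrix unit at
  \<open>(r\<^sub>i, r\<^sub>j)\<close>, with \<open>v\<^sub>i * w\<^sub>i\<close> the size of the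
  \<open>i\<close>-th hook. This fixes each off-diagonal block of \<open>X\<close>, and the choice of
  \<open>v\<close> and \<open>w\<close> is absorbed by conjugation with block scalar matrices.
\<close>

definition fixed_point :: "nat list \<Rightarrow> (complex mat \<times> complex mat) set" where
  "fixed_point \<mu> = (THE p. p \<in> cm_space (sum_list \<mu>) \<and>
     (\<exists>X. fixed_X_shape \<mu> X \<and> (X, fixed_Y \<mu>) \<in> p))"

definition stab_B :: "nat list \<Rightarrow> (free_alg \<Rightarrow> free_alg) set" where
  "stab_B \<mu> = stabilizer (cm_group\<lparr>carrier := subgroup_B\<rparr>)
     (cm_action (sum_list \<mu>)) (fixed_point \<mu>)"


section \<open>The set of exponents\<close>

definition part :: "nat list \<Rightarrow> int \<Rightarrow> nat" where
  "part \<mu> j = (if 1 \<le> j \<and> j \<le> int (length \<mu>) then \<mu> ! nat (j - 1) else 0)"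

text \<open>The natural-number subtraction is exact on partitions, as the last part is the largest.\<close>

definition r_seq :: "nat list \<Rightarrow> nat \<Rightarrow> nat" where
  "r_seq \<mu> i = i + (part \<mu> (int (length \<mu>)) - part \<mu> (int (length \<mu>) - int i))"

definition R_set :: "nat list \<Rightarrow> nat set" where
  "R_set \<mu> = range (r_seq \<mu>)"

definition S_set :: "nat list \<Rightarrow> nat set" where
  "S_set \<mu> = {k. k \<ge> 1 \<and> (\<lambda>m. k + m) ` R_set \<mu> \<subseteq> R_set \<mu>}"

definition G_mu_y :: "nat list \<Rightarrow> (free_alg \<Rightarrow> free_alg) set" where
  "G_mu_y \<mu> = generate cm_group
     {\<sigma> \<in> subgroup_Gy. \<exists>s\<in>S_set \<mu>. \<exists>c.
        \<sigma> var_x = var_x + const c * var_y ^ (s - 1) \<and> \<sigma> var_y = var_y}"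

end

theory Submission
  imports Defs "HOL-Library.Function_Algebras"
begin

text \<open>
  An element \<open>(a x + q(y), a\<^sup>-\<^sup>1 y + h)\<close> of \<open>B\<close> fixes the class of
  \<open>(X, Y) = (X\<^sub>\<mu>, Y\<^sub>\<mu>)\<close> iff a pair \<open>(b X + r(Y), b\<^sup>-\<^sup>1 Y + g)\<close>, read off
  from its inverse, is simultaneously conjugate to \<open>(X, Y)\<close>. Since \<open>Y\<close> is nilpotent,
  \<open>g\<close> has to vanish. The matrices are graded by content, \<open>Y\<close> having degree 1 and \<open>X\<close>
  degree -1, so conjugation by a diagonal matrix removes \<open>b\<close>; this is why all of \<open>T\<close> lies in the
  stabilizer. What remains is the question for which polynomials \<open>r\<close> some invertible \<open>P\<close> commuting
  with \<open>Y\<close> satisfies \<open>P X = (X + r(Y)) P\<close>.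

  Such polynomials form an additive group. If \<open>r\<close> has lowest term \<open>c y\<^sup>m\<close>, then Schur's lemma for
  the pair \<open>(X, Y)\<close> makes the component of degree zero of \<open>P\<close> a nonzero scalar, and the component of
  degree \<open>m + 1\<close> is, up to a factor, a matrix \<open>Q\<close> with \<open>Q Y = Y Q\<close> and
  \<open>Q X - X Q = Y\<^sup>m\<close>. Conversely the exponential of a multiple of such a \<open>Q\<close> translates \<open>X\<close> by
  a multiple of \<open>Y\<^sup>m\<close>. So \<open>r\<close> is admitted iff each of its monomials is
  (\<open>translates_iff_admissible\<close>), and only the existence of \<open>Q\<close> is left.

  Index the basis by hooks \<open>i\<close> and contents \<open>c\<close>. On nonnegative contents \<open>X\<close> is
  \<open>c - L\<^sup>+\<close>, on negative ones \<open>c + 1 + L\<^sup>-\<close>, where \<open>L\<^sup>+\<close> is upper triangular with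
  the arm lengths as eigenvalues, \<open>L\<^sup>-\<close> is lower triangular with the leg lengths as eigenvalues, and
  \<open>L\<^sup>+ + L\<^sup>- + 1\<close> has rank one. A \<open>Q\<close> of degree \<open>k = m + 1\<close> amounts to one matrix
  \<open>q\<close> on the hooks solving the Sylvester equation \<open>L\<^sup>- q + q L\<^sup>+ = (k - 1) q - 1\<close>, with
  boundary conditions. Between eigenvectors of \<open>L\<^sup>-\<close> and \<open>L\<^sup>+\<close> the identity becomes the Cauchy
  matrix \<open>1 / (leg\<^sub>i + arm\<^sub>j + 1)\<close> and the equation becomes diagonal. It is solvable iff
  \<open>k\<close> is no \<open>leg\<^sub>i + arm\<^sub>j + 1\<close>, and the boundary conditions hold iff subtracting \<open>k\<close>
  from an arm (a leg) that is at least \<open>k\<close> gives an arm (a leg) again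
  (\<open>raiser_admissible\<close>, \<open>admissible_raiser\<close>).

  Up to a shift, \<open>R\<^sub>\<mu>\<close> consists of the numbers \<open>-arm\<^sub>i - 1\<close> and of the nonnegative integers
  other than the \<open>leg\<^sub>j\<close>. In this form the three conditions say precisely
  \<open>k + R\<^sub>\<mu> \<subseteq> R\<^sub>\<mu>\<close> (\<open>S_set_iff\<close>).
\<close>

section \<open>Arms, legs and the exponent set of a partition\<close>

definition row_length :: "nat list \<Rightarrow> nat \<Rightarrow> nat" where
  "row_length \<mu> a = (if a < length \<mu> then rev \<mu> ! a else 0)"

definition col_length :: "nat list \<Rightarrow> nat \<Rightarrow> nat" where
  "col_length \<mu> b = card {a. b < row_length \<mu> a}"

text \<open>
  The hook \<open>i\<close> has its corner at the diagonal cell \<open>(i, i)\<close>. Arms and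
  legs exclude the corner, so these are the Frobenius coordinates of the partition.
\<close>

definition arm :: "nat list \<Rightarrow> nat \<Rightarrow> nat" where "arm \<mu> i = row_length \<mu> i - i - 1"
definition leg :: "nat list \<Rightarrow> nat \<Rightarrow> nat" where "leg \<mu> i = col_length \<mu> i - i - 1"

lemma downset_card:
  fixes P :: "nat \<Rightarrow> bool"
  assumes "\<And>a b. a \<le> b \<Longrightarrow> P b \<Longrightarrow> P a" "finite {a. P a}"
  shows "P a \<longleftrightarrow> a < card {a. P a}"
proof -
  have "\<exists>b. \<not> P b" using assms(2) infinite_UNIV_nat by (metis Collect_cong UNIV_def)
  define N where "N = (LEAST b. \<not> P b)"
  have "\<not> P N" unfolding N_def using \<open>\<exists>b. \<not> P b\<close> by (rule LeastI_ex)
  moreover have "P b" if "b < N" for b using not_less_Least that unfolding N_def by blast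
  ultimately have "{a. P a} = {..<N}" using assms(1) by (auto simp: not_less[symmetric])
  then show ?thesis by auto
qed

context
  fixes \<mu> :: "nat list" and n :: nat
  assumes part: "is_partition \<mu> n"
begin

lemma row_antimono: "a \<le> b \<Longrightarrow> row_length \<mu> b \<le> row_length \<mu> a"
proof (cases "b < length \<mu>")
  case True
  assume "a \<le> b"
  moreover have "sorted \<mu>" using part by (simp add: is_partition_def)
  ultimately show ?thesis using True
    by (auto simp: row_length_def rev_nth intro!: sorted_nth_mono)
qed (simp add: row_length_def)

lemma row_finite: "finite {a. b < row_length \<mu> a}"
  by (rule finite_subset[of _ "{..<length \<mu>}"]) (auto simp: row_length_def split: if_splits)

text \<open>
  Conjugation of partitions: both sides say that the cell \<open>(a, b)\<close> lies in the
  diagram.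
\<close>

lemma less_row_iff: "b < row_length \<mu> a \<longleftrightarrow> a < col_length \<mu> b"
  unfolding col_length_def by (rule downset_card[OF _ row_finite]) (use row_antimono in fastforce)

lemma col_antimono: "a \<le> b \<Longrightarrow> col_length \<mu> b \<le> col_length \<mu> a"
  unfolding col_length_def by (rule card_mono[OF row_finite]) auto

lemma diagram: "young_diagram \<mu> = {(a, b). b < row_length \<mu> a}"
  by (auto simp: young_diagram_def row_length_def split: if_splits)

lemma hook_nonempty: "hook \<mu> i \<noteq> {} \<longleftrightarrow> i < row_length \<mu> i"
proof
  assume "hook \<mu> i \<noteq> {}"
  then obtain a b where ab: "b < row_length \<mu> a" "min a b = i" by (auto simp: hook_def diagram)
  then have "i \<le> a" "i \<le> b" by auto
  then show "i < row_length \<mu> i" using ab row_antimono[of i a] by linarith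
next
  assume "i < row_length \<mu> i"
  then have "(i, i) \<in> hook \<mu> i" by (auto simp: hook_def diagram)
  then show "hook \<mu> i \<noteq> {}" by blast
qed

lemma less_num_hooks: "i < num_hooks \<mu> \<longleftrightarrow> i < row_length \<mu> i"
proof -
  have "{i. i < row_length \<mu> i} \<subseteq> {a. 0 < row_length \<mu> a}" by auto
  then have "finite {i. i < row_length \<mu> i}" by (rule finite_subset[OF _ row_finite])
  moreover have "a < row_length \<mu> a" if "a \<le> b" "b < row_length \<mu> b" for a b using row_antimono[of a b] that by linarith
  ultimately have "i < row_length \<mu> i \<longleftrightarrow> i < card {i. i < row_length \<mu> i}" by (intro downset_card)
  then show ?thesis by (simp add: num_hooks_def hook_nonempty)
qed

lemma arm_eq: "i < num_hooks \<mu> \<Longrightarrow> int (arm \<mu> i) = int (row_length \<mu> i) - int i - 1"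
  unfolding less_num_hooks by (simp add: arm_def)

lemma leg_eq: "i < num_hooks \<mu> \<Longrightarrow> int (leg \<mu> i) = int (col_length \<mu> i) - int i - 1"
  unfolding less_num_hooks less_row_iff by (simp add: leg_def)

lemma arm_decreasing: "i < j \<Longrightarrow> j < num_hooks \<mu> \<Longrightarrow> arm \<mu> j < arm \<mu> i"
  using arm_eq[of i] arm_eq[of j] row_antimono[of i j] by auto

lemma leg_decreasing: "i < j \<Longrightarrow> j < num_hooks \<mu> \<Longrightarrow> leg \<mu> j < leg \<mu> i"
  using leg_eq[of i] leg_eq[of j] col_antimono[of i j] by auto

text \<open>
  The hook consists of its corner with the arm, and of the leg below the corner.
\<close>

lemma hook_split:
  "hook \<mu> i = (\<lambda>b. (i, b)) ` {i..<row_length \<mu> i} \<union> (\<lambda>a. (a, i)) ` {Suc i..<col_length \<mu> i}"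
  by (auto simp: hook_def diagram less_row_iff[symmetric] min_def split: if_splits)

lemma hook_size_eq: "i < num_hooks \<mu> \<Longrightarrow> hook_size \<mu> i = leg \<mu> i + arm \<mu> i + 1"
proof -
  assume i: "i < num_hooks \<mu>"
  have "hook_size \<mu> i = card ((\<lambda>b. (i, b)) ` {i..<row_length \<mu> i}) + card ((\<lambda>a. (a, i)) ` {Suc i..<col_length \<mu> i})"
    unfolding hook_size_def hook_split by (rule card_Un_disjoint) auto
  also have "\<dots> = (row_length \<mu> i - i) + (col_length \<mu> i - Suc i)"
    by (subst (1 2) card_image) (auto simp: inj_on_def)
  finally show ?thesis using i unfolding less_num_hooks by (simp add: arm_def leg_def)
qed

lemma hook_rows_eq: "i < num_hooks \<mu> \<Longrightarrow> hook_rows \<mu> i = leg \<mu> i + 1"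
proof -
  assume i: "i < num_hooks \<mu>"
  then have r: "i < row_length \<mu> i" "i < col_length \<mu> i" using less_num_hooks less_row_iff by auto
  have "fst ` hook \<mu> i = {i..<col_length \<mu> i}"
    unfolding hook_split image_Un image_image using r by force
  then show ?thesis using r by (simp add: hook_rows_def leg_def)
qed

lemma card_diagram: "finite (young_diagram \<mu>)" "card (young_diagram \<mu>) = n"
proof -
  have e: "young_diagram \<mu> = (SIGMA a:{..<length \<mu>}. {..<rev \<mu> ! a})"
    by (auto simp: young_diagram_def)
  then show "finite (young_diagram \<mu>)" by simp
  have "card (young_diagram \<mu>) = (\<Sum>a<length \<mu>. rev \<mu> ! a)" by (simp add: e)
  also have "\<dots> = sum_list (rev \<mu>)" by (simp add: sum_list_sum_nth atLeast0LessThan)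
  finally show "card (young_diagram \<mu>) = n" using part by (simp add: is_partition_def)
qed

lemma sum_hook_size: "(\<Sum>i<num_hooks \<mu>. hook_size \<mu> i) = n"
proof -
  have sub: "hook \<mu> i \<subseteq> young_diagram \<mu>" for i by (auto simp: hook_def)
  have "young_diagram \<mu> = (\<Union>i\<in>{..<num_hooks \<mu>}. hook \<mu> i)"
  proof
    show "young_diagram \<mu> \<subseteq> (\<Union>i\<in>{..<num_hooks \<mu>}. hook \<mu> i)"
    proof
      fix x assume x: "x \<in> young_diagram \<mu>"
      then have h: "x \<in> hook \<mu> (min (fst x) (snd x))" by (auto simp: hook_def)
      then have "min (fst x) (snd x) < num_hooks \<mu>" unfolding less_num_hooks hook_nonempty[symmetric] by blast
      with h show "x \<in> (\<Union>i\<in>{..<num_hooks \<mu>}. hook \<mu> i)" by blast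
    qed
  qed (use sub in blast)
  moreover have "card (\<Union>i\<in>{..<num_hooks \<mu>}. hook \<mu> i) = (\<Sum>i<num_hooks \<mu>. card (hook \<mu> i))"
  proof (rule card_UN_disjoint)
    show "\<forall>i\<in>{..<num_hooks \<mu>}. finite (hook \<mu> i)" using finite_subset[OF sub card_diagram(1)] by blast
  qed (auto simp: hook_def)
  ultimately show ?thesis using card_diagram(2) by (simp add: hook_size_def)
qed

lemma num_hooks_pos: "n \<ge> 1 \<Longrightarrow> num_hooks \<mu> > 0"
  using sum_hook_size by (cases "num_hooks \<mu> = 0") auto

text \<open>
  Up to the shift by the largest part, \<open>R\<^sub>\<mu>\<close> is the set of the numbers
  \<open>i - \<mu>\<^sub>i\<close> for the rows in decreasing order, continued by empty rows.
\<close>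

lemma r_seq_eq: "int (r_seq \<mu> i) = int (row_length \<mu> 0) + (int i - int (row_length \<mu> i))"
proof -
  have p: "part \<mu> (int (length \<mu>) - int j) = row_length \<mu> j" for j
  proof (cases "j < length \<mu>")
    case True
    then have "nat (int (length \<mu>) - int j - 1) = length \<mu> - Suc j" by simp
    then show ?thesis using True by (simp add: part_def row_length_def rev_nth)
  qed (simp add: part_def row_length_def)
  have "r_seq \<mu> i = i + (row_length \<mu> 0 - row_length \<mu> i)" using p[of 0] p[of i] by (simp add: r_seq_def)
  then show ?thesis using row_antimono[of 0 i] by simp
qed

text \<open>
  The boundary of the diagram is a path. Its steps at the ends of the rows and those at the ends
  of the columns carry different labels.
\<close>

lemma beta_not_conjugate: "int i - int (row_length \<mu> i) \<noteq> int (col_length \<mu> j) - int j - 1"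
  using less_row_iff[of j i] by (cases "j < row_length \<mu> i") auto

text \<open>
  Every label that is not the step of a row is that of a column; a nonnegative one belongs to a
  column that crosses the diagonal, so it is a leg length. The step in question is found at the
  first row whose label reaches \<open>z\<close>.
\<close>

lemma beta_or_conjugate:
  assumes "0 \<le> z" "\<And>j. j < num_hooks \<mu> \<Longrightarrow> z \<noteq> int (leg \<mu> j)"
  shows "\<exists>i. z = int i - int (row_length \<mu> i)"
proof -
  define P where "P i \<longleftrightarrow> z \<le> int i - int (row_length \<mu> i)" for i
  have "row_length \<mu> (length \<mu> + nat z) = 0" by (simp add: row_length_def)
  then have "P (length \<mu> + nat z)" using assms by (simp add: P_def)
  then have Pi: "P (LEAST i. P i)" by (rule LeastI)
  define i where "i = (LEAST i. P i)"
  have i: "z \<le> int i - int (row_length \<mu> i)" using Pi by (simp add: P_def i_def)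
  show ?thesis
  proof (cases "z = int i - int (row_length \<mu> i)")
    case False
    then have gt: "z < int i - int (row_length \<mu> i)" using i by simp
    then obtain i' where i': "i = Suc i'" using assms(1) by (cases i) auto
    then have "\<not> P i'" using not_less_Least[of i' P] by (simp add: i_def)
    then have lt: "int i' - int (row_length \<mu> i') < z" by (simp add: P_def)
    \<comment> \<open>The column whose lower end lies between the rows \<open>i'\<close> and \<open>i\<close>.\<close>
    define j where "j = nat (int i' - z)"
    have j: "int j = int i' - z" using gt i' by (auto simp: j_def)
    have "j < row_length \<mu> i'" using lt j by linarith
    moreover have "\<not> j < row_length \<mu> i" using gt j i' by linarith
    ultimately have c: "col_length \<mu> j = i" using less_row_iff[of j i] less_row_iff[of j i'] i' by simp
    have "j < col_length \<mu> j" using j assms(1) c i' by linarith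
    then have D: "j < num_hooks \<mu>" by (simp add: less_num_hooks less_row_iff)
    have "z = int (leg \<mu> j)" using leg_eq[OF D] c j i' by simp
    then show ?thesis using assms(2)[OF D] by simp
  qed blast
qed

text \<open>
  The Frobenius description of the labels: those of the rows through the diagonal are negative and
  given by the arms, and the nonnegative labels that are left out are the legs.
\<close>

lemma beta_set:
  "(\<exists>i. z = int i - int (row_length \<mu> i)) \<longleftrightarrow>
   (if z < 0 then \<exists>i<num_hooks \<mu>. z = - int (arm \<mu> i) - 1 else \<forall>j<num_hooks \<mu>. z \<noteq> int (leg \<mu> j))"
proof (cases "z < 0")
  case True
  have "(\<exists>i. z = int i - int (row_length \<mu> i)) \<longleftrightarrow> (\<exists>i<num_hooks \<mu>. z = int i - int (row_length \<mu> i))"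
  proof -
    have "i < num_hooks \<mu>" if "z = int i - int (row_length \<mu> i)" for i
      using True that unfolding less_num_hooks by simp
    then show ?thesis by blast
  qed
  also have "\<dots> \<longleftrightarrow> (\<exists>i<num_hooks \<mu>. z = - int (arm \<mu> i) - 1)"
  proof -
    have "int i - int (row_length \<mu> i) = - int (arm \<mu> i) - 1" if "i < num_hooks \<mu>" for i
      using arm_eq[OF that] by simp
    then show ?thesis by metis
  qed
  finally show ?thesis using True by simp
next
  case False
  have "z \<noteq> int (leg \<mu> j)" if "z = int i - int (row_length \<mu> i)" "j < num_hooks \<mu>" for i j
    using leg_eq[OF that(2)] beta_not_conjugate[of i j] that(1) by simp
  then show ?thesis using False beta_or_conjugate[of z] by auto
qed

text \<open>
  A shift by \<open>k\<close> can leave the set of row labels in three ways: from one nonnegative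
  label onto a leg, from one negative label to a negative number that is not the label of an arm,
  and from an arm across zero onto a leg. The three conditions exclude these.
\<close>

lemma S_set_iff:
  assumes k: "k \<ge> 1"
  shows "k \<in> S_set \<mu> \<longleftrightarrow>
     (\<forall>j<num_hooks \<mu>. k \<le> leg \<mu> j \<longrightarrow> (\<exists>l<num_hooks \<mu>. leg \<mu> l = leg \<mu> j - k)) \<and>
     (\<forall>j<num_hooks \<mu>. k \<le> arm \<mu> j \<longrightarrow> (\<exists>l<num_hooks \<mu>. arm \<mu> l = arm \<mu> j - k)) \<and>
     (\<forall>i<num_hooks \<mu>. \<forall>j<num_hooks \<mu>. k \<noteq> leg \<mu> i + arm \<mu> j + 1)" (is "_ \<longleftrightarrow> ?L \<and> ?A \<and> ?H")
proof -
  define B where "B z \<longleftrightarrow> (\<exists>i. z = int i - int (row_length \<mu> i))" for z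
  have Bneg: "B z \<longleftrightarrow> (\<exists>i<num_hooks \<mu>. z = - int (arm \<mu> i) - 1)" if "z < 0" for z
    using beta_set[of z] that by (simp add: B_def)
  have Bpos: "B z \<longleftrightarrow> (\<forall>j<num_hooks \<mu>. z \<noteq> int (leg \<mu> j))" if "z \<ge> 0" for z
    using beta_set[of z] that by (simp add: B_def)
  have R: "m \<in> R_set \<mu> \<longleftrightarrow> B (int m - int (row_length \<mu> 0))" for m
  proof -
    have "m = r_seq \<mu> i \<longleftrightarrow> int m - int (row_length \<mu> 0) = int i - int (row_length \<mu> i)" for i
      using r_seq_eq[of i] by linarith
    then show ?thesis by (auto simp: R_set_def B_def)
  qed
  have Bge: "- int (row_length \<mu> 0) \<le> z" if "B z" for z
  proof -
    from that obtain i where "z = int i - int (row_length \<mu> i)" by (auto simp: B_def)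
    then show ?thesis using row_antimono[of 0 i] by simp
  qed
  have "k \<in> S_set \<mu> \<longleftrightarrow> (\<forall>m. m \<in> R_set \<mu> \<longrightarrow> k + m \<in> R_set \<mu>)"
    using k by (auto simp: S_set_def)
  also have "\<dots> \<longleftrightarrow> (\<forall>z. B z \<longrightarrow> B (z + int k))"
  proof (intro iffI allI impI)
    fix z assume h: "\<forall>m. m \<in> R_set \<mu> \<longrightarrow> k + m \<in> R_set \<mu>" and z: "B z"
    have "0 \<le> z + int (row_length \<mu> 0)" using Bge[OF z] by linarith
    then have e: "int (nat (z + int (row_length \<mu> 0))) = z + int (row_length \<mu> 0)" by simp
    have "nat (z + int (row_length \<mu> 0)) \<in> R_set \<mu>" unfolding R e using z by simp
    then have "k + nat (z + int (row_length \<mu> 0)) \<in> R_set \<mu>" using h by blast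
    then show "B (z + int k)" unfolding R of_nat_add e by (simp add: algebra_simps)
  next
    fix m assume h: "\<forall>z. B z \<longrightarrow> B (z + int k)" and "m \<in> R_set \<mu>"
    then have "B (int m - int (row_length \<mu> 0) + int k)" by (simp add: R)
    then show "k + m \<in> R_set \<mu>" by (simp add: R algebra_simps)
  qed
  also have "\<dots> \<longleftrightarrow> ?L \<and> ?A \<and> ?H"
  proof
    assume h: "\<forall>z. B z \<longrightarrow> B (z + int k)"
    have ?L
    proof (intro allI impI)
      fix j assume j: "j < num_hooks \<mu>" "k \<le> leg \<mu> j"
      have "\<not> B (int (leg \<mu> j))" using j Bpos by auto
      then have "\<not> B (int (leg \<mu> j) - int k)" using h[rule_format, of "int (leg \<mu> j) - int k"] by auto
      then obtain l where "l < num_hooks \<mu>" "int (leg \<mu> j) - int k = int (leg \<mu> l)" using Bpos j by auto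
      then show "\<exists>l<num_hooks \<mu>. leg \<mu> l = leg \<mu> j - k" by (intro exI[of _ l]) auto
    qed
    moreover have ?A
    proof (intro allI impI)
      fix j assume j: "j < num_hooks \<mu>" "k \<le> arm \<mu> j"
      have "B (- int (arm \<mu> j) - 1)" using j Bneg by auto
      then have "B (- int (arm \<mu> j) - 1 + int k)" using h by blast
      then obtain l where "l < num_hooks \<mu>" "- int (arm \<mu> j) - 1 + int k = - int (arm \<mu> l) - 1" using Bneg j by auto
      then show "\<exists>l<num_hooks \<mu>. arm \<mu> l = arm \<mu> j - k" by (intro exI[of _ l]) auto
    qed
    moreover have ?H
    proof (intro allI impI notI)
      fix i j assume ij: "i < num_hooks \<mu>" "j < num_hooks \<mu>" and e: "k = leg \<mu> i + arm \<mu> j + 1"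
      have "B (- int (arm \<mu> j) - 1)" using ij Bneg by auto
      then have "B (- int (arm \<mu> j) - 1 + int k)" using h by blast
      then have "B (int (leg \<mu> i))" by (simp add: e)
      then show False using Bpos ij by auto
    qed
    ultimately show "?L \<and> ?A \<and> ?H" by blast
  next
    assume LAH: "?L \<and> ?A \<and> ?H"
    show "\<forall>z. B z \<longrightarrow> B (z + int k)"
    proof (intro allI impI)
      fix z assume z: "B z"
      show "B (z + int k)"
      proof (cases "z < 0")
        case False
        have "z + int k \<noteq> int (leg \<mu> j)" if j: "j < num_hooks \<mu>" for j
        proof
          assume e: "z + int k = int (leg \<mu> j)"
          then obtain l where "l < num_hooks \<mu>" "leg \<mu> l = leg \<mu> j - k" using LAH j False by auto
          then have "l < num_hooks \<mu>" "z = int (leg \<mu> l)" using e False by auto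
          then show False using z Bpos False by auto
        qed
        then show ?thesis using Bpos False by auto
      next
        case True
        then obtain i where i: "i < num_hooks \<mu>" "z = - int (arm \<mu> i) - 1" using z Bneg by auto
        show ?thesis
        proof (cases "z + int k < 0")
          case True
          then have "k \<le> arm \<mu> i" using i by auto
          then obtain l where "l < num_hooks \<mu>" "arm \<mu> l = arm \<mu> i - k" using LAH i by blast
          then show ?thesis using Bneg[OF True] i \<open>k \<le> arm \<mu> i\<close> by (auto intro!: exI[of _ l])
        next
          case False
          have "z + int k \<noteq> int (leg \<mu> j)" if "j < num_hooks \<mu>" for j
          proof
            assume "z + int k = int (leg \<mu> j)"
            then have "k = leg \<mu> j + arm \<mu> i + 1" using i by linarith
            then show False using LAH i that by blast
          qed
          then show ?thesis using Bpos False by auto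
        qed
      qed
    qed
  qed
  finally show ?thesis .
qed

end

section \<open>Triangular automorphisms of the free algebra\<close>

lemma const_mult_single: "const c * Poly_Mapping.single w a = Poly_Mapping.single w (c * a)"
  by (simp add: const_def mult_single)

lemma single_mult_const: "Poly_Mapping.single w a * const c = Poly_Mapping.single w (a * c)"
  by (simp add: const_def mult_single)

text \<open>
  Every element is a finite sum of scalar multiples of words.
\<close>

lemma free_alg_induct [case_names single add]:
  fixes p :: free_alg
  assumes single: "\<And>w c. P (Poly_Mapping.single w c)" and add: "\<And>p q. P p \<Longrightarrow> P q \<Longrightarrow> P (p + q)"
  shows "P p"
proof (induction p rule: update_induct)
  case const
  show ?case using single[of 0 0] by simp
next
  case (update f a b)
  have "Poly_Mapping.update a b f = f + Poly_Mapping.single a b"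
    using update by (intro poly_mapping_eqI) (auto simp: lookup_update lookup_add lookup_single when_def not_in_keys_iff_lookup_eq_zero)
  then show ?case using add[OF update(3) single] by simp
qed

lemma const_central: "const c * p = p * const c"
  by (induction p rule: free_alg_induct)
    (simp_all add: const_mult_single single_mult_const mult.commute distrib_left distrib_right)

lemma const_simps:
  "const (a + b) = const a + const b" "const 0 = 0" "const 1 = 1"
  "const (- a) = - const a"
  by (simp_all add: const_def single_add mult_single single_uminus)

lemma const_mult: "const a * const b = const (a * b)"
  by (simp add: const_def mult_single)

lemma const_mult_left: "const a * (const b * p) = const (a * b) * p"
  by (simp only: const_mult mult.assoc[symmetric])

lemma const_shift: "p * (const c * q) = const c * (p * q)"
  by (metis const_central mult.assoc)

lemma const_mult_const_mult: "const a * p * (const b * q) = const (a * b) * (p * q)"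
  by (simp only: mult.assoc const_shift[of p] const_mult_left)

lemma letters_zero: "letters 0 = []"
  by (simp add: zero_word_def)

fun word_value :: "free_alg \<Rightarrow> free_alg \<Rightarrow> generator list \<Rightarrow> free_alg" where
  "word_value f g [] = 1"
| "word_value f g (l # ls) = (case l of GenX \<Rightarrow> f | GenY \<Rightarrow> g) * word_value f g ls"

lemma word_value_append: "word_value f g (u @ v) = word_value f g u * word_value f g v"
  by (induction u) (simp_all add: mult.assoc)

text \<open>
  The endomorphism that sends the generators to \<open>f\<close> and \<open>g\<close>.
\<close>

definition free_subst :: "free_alg \<Rightarrow> free_alg \<Rightarrow> free_alg \<Rightarrow> free_alg" where
  "free_subst f g p = (\<Sum>w\<in>Poly_Mapping.keys p. const (Poly_Mapping.lookup p w) * word_value f g (letters w))"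

lemma free_subst_superset:
  assumes "finite A" "Poly_Mapping.keys p \<subseteq> A"
  shows "free_subst f g p = (\<Sum>w\<in>A. const (Poly_Mapping.lookup p w) * word_value f g (letters w))"
  unfolding free_subst_def using assms
  by (intro sum.mono_neutral_left) (auto simp: in_keys_iff const_simps)

lemma free_subst_add: "free_subst f g (p + q) = free_subst f g p + free_subst f g q"
proof -
  let ?A = "Poly_Mapping.keys p \<union> Poly_Mapping.keys q"
  have "finite ?A" "Poly_Mapping.keys (p + q) \<subseteq> ?A" by (auto simp: Poly_Mapping.keys_add)
  then show ?thesis
    by (simp add: free_subst_superset[of ?A] lookup_add const_simps distrib_right sum.distrib)
qed

lemma free_subst_single: "free_subst f g (Poly_Mapping.single w c) = const c * word_value f g (letters w)"
  by (cases "c = 0") (simp_all add: free_subst_def const_simps)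

lemma free_subst_mult: "free_subst f g (p * q) = free_subst f g p * free_subst f g q"
proof (induction p rule: free_alg_induct)
  case (single w c)
  show ?case
  proof (induction q rule: free_alg_induct)
    case (single u d)
    show ?case
      by (simp only: mult_single free_subst_single plus_word_def word.sel word_value_append const_mult_const_mult)
  qed (simp add: distrib_left free_subst_add)
qed (simp add: distrib_right free_subst_add)

lemma free_subst_one: "free_subst f g 1 = 1"
  using free_subst_single[of f g 0 1] by (simp add: letters_zero const_simps)

lemma free_subst_const: "free_subst f g (const c) = const c"
  using free_subst_single[of f g 0 c] by (simp add: letters_zero const_def)

lemma free_subst_vars: "free_subst f g var_x = f" "free_subst f g var_y = g"
  by (simp_all add: var_x_def var_y_def free_subst_single const_simps)

definition alg_endo :: "(free_alg \<Rightarrow> free_alg) \<Rightarrow> bool" where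
  "alg_endo \<sigma> \<longleftrightarrow> \<sigma> 1 = 1 \<and> (\<forall>p q. \<sigma> (p + q) = \<sigma> p + \<sigma> q) \<and> (\<forall>p q. \<sigma> (p * q) = \<sigma> p * \<sigma> q) \<and>
     (\<forall>c p. \<sigma> (const c * p) = const c * \<sigma> p)"

lemma alg_endoD:
  assumes "alg_endo \<sigma>"
  shows "\<sigma> 1 = 1" "\<sigma> (p + q) = \<sigma> p + \<sigma> q" "\<sigma> (p * q) = \<sigma> p * \<sigma> q" "\<sigma> (const c * p) = const c * \<sigma> p"
    "\<sigma> (const c) = const c" "\<sigma> 0 = 0" "\<sigma> (p ^ n) = \<sigma> p ^ n" "\<sigma> (- p) = - \<sigma> p" "\<sigma> (p - q) = \<sigma> p - \<sigma> q"
proof -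
  show 1: "\<sigma> 1 = 1" and a: "\<And>p q. \<sigma> (p + q) = \<sigma> p + \<sigma> q" and m: "\<And>p q. \<sigma> (p * q) = \<sigma> p * \<sigma> q"
    and c: "\<And>c p. \<sigma> (const c * p) = const c * \<sigma> p" using assms by (auto simp: alg_endo_def)
  show "\<sigma> (const c) = const c" using c[of c 1] 1 by simp
  show z: "\<sigma> 0 = 0" using a[of 0 0] by simp
  show "\<sigma> (p ^ n) = \<sigma> p ^ n" by (induction n) (simp_all add: 1 m)
  show n: "\<sigma> (- p) = - \<sigma> p" for p using a[of p "- p"] z by (simp add: eq_neg_iff_add_eq_0 add.commute)
  show "\<sigma> (p - q) = \<sigma> p - \<sigma> q" using a[of p "- q"] n by simp
qed

lemma alg_endo_free_subst: "alg_endo (free_subst f g)"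
  by (simp add: alg_endo_def free_subst_one free_subst_add free_subst_mult free_subst_const)

text \<open>
  An endomorphism is determined by the images of the generators.
\<close>

lemma alg_endo_eqI:
  assumes "alg_endo \<sigma>" "alg_endo \<tau>" "\<sigma> var_x = \<tau> var_x" "\<sigma> var_y = \<tau> var_y"
  shows "\<sigma> = \<tau>"
proof
  fix p
  have w: "\<sigma> (Poly_Mapping.single (Word ls) 1) = \<tau> (Poly_Mapping.single (Word ls) 1)" for ls
  proof (induction ls)
    case Nil
    have "Poly_Mapping.single (Word []) 1 = (1 :: free_alg)" by (simp add: zero_word_def[symmetric])
    then show ?case using alg_endoD(1) assms by metis
  next
    case (Cons l ls)
    have "Poly_Mapping.single (Word (l # ls)) (1::complex)
        = (case l of GenX \<Rightarrow> var_x | GenY \<Rightarrow> var_y) * Poly_Mapping.single (Word ls) 1"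
      by (cases l) (simp_all add: var_x_def var_y_def mult_single plus_word_def)
    then show ?case using Cons assms(3,4) alg_endoD(3)[OF assms(1)] alg_endoD(3)[OF assms(2)] by (cases l) simp_all
  qed
  show "\<sigma> p = \<tau> p"
  proof (induction p rule: free_alg_induct)
    case (single w c)
    have "Poly_Mapping.single w c = const c * Poly_Mapping.single (Word (letters w)) 1"
      by (simp add: const_mult_single)
    then show ?case using w[of "letters w"] alg_endoD(4)[OF assms(1)] alg_endoD(4)[OF assms(2)] by simp
  qed (simp add: alg_endoD(2)[OF assms(1)] alg_endoD(2)[OF assms(2)])
qed

lemma alg_endo_comp: "alg_endo \<sigma> \<Longrightarrow> alg_endo \<tau> \<Longrightarrow> alg_endo (\<sigma> \<circ> \<tau>)"
  unfolding alg_endo_def comp_apply by metis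

lemma alg_endo_id: "alg_endo id" by (simp add: alg_endo_def)

lemma alg_automorphism_iff: "alg_automorphism \<sigma> \<longleftrightarrow> bij \<sigma> \<and> alg_endo \<sigma>"
  by (auto simp: alg_automorphism_def alg_endo_def)

lemma poly_y_alt: "degree q \<le> N \<Longrightarrow> poly_y q = (\<Sum>i\<le>N. const (coeff q i) * var_y ^ i)"
  unfolding poly_y_def by (rule sum.mono_neutral_left) (auto simp: coeff_eq_0 const_simps)

lemma poly_y_add: "poly_y (p + q) = poly_y p + poly_y q"
proof -
  define N where "N = max (degree p) (degree q)"
  have "degree (p + q) \<le> N" "degree p \<le> N" "degree q \<le> N" by (auto simp: N_def degree_add_le_max)
  then show ?thesis by (simp add: poly_y_alt const_simps distrib_right sum.distrib)
qed

lemma poly_y_pCons: "poly_y (pCons c q) = const c + var_y * poly_y q"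
proof -
  have "poly_y (pCons c q) = (\<Sum>i\<le>Suc (degree q). const (coeff (pCons c q) i) * var_y ^ i)"
    by (rule poly_y_alt) (rule degree_pCons_le)
  also have "\<dots> = const c + (\<Sum>i\<le>degree q. const (coeff q i) * var_y ^ Suc i)"
    by (simp add: sum.atMost_Suc_shift del: sum.atMost_Suc)
  also have "(\<Sum>i\<le>degree q. const (coeff q i) * var_y ^ Suc i) = var_y * poly_y q"
    by (simp add: poly_y_def sum_distrib_left const_shift)
  finally show ?thesis .
qed

lemma poly_y_zero: "poly_y 0 = 0" by (simp add: poly_y_def const_simps)

lemma poly_y_const: "poly_y [:c:] = const c" by (simp add: poly_y_pCons poly_y_zero)

lemma poly_y_linear: "poly_y [:h, b:] = const b * var_y + const h"
  by (simp add: poly_y_pCons poly_y_zero const_central add.commute)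

lemma poly_y_smult: "poly_y (Polynomial.smult c q) = const c * poly_y q"
  by (induction q) (simp_all add: poly_y_zero poly_y_pCons distrib_left const_shift[of var_y] const_mult const_simps)

lemma poly_y_mult: "poly_y (p * q) = poly_y p * poly_y q"
  by (induction p) (simp_all add: poly_y_zero poly_y_pCons poly_y_add poly_y_smult distrib_right const_simps mult.assoc)

lemma poly_y_monom: "poly_y (monom c m) = const c * var_y ^ m"
proof (induction m)
  case 0 then show ?case by (simp add: monom_0 poly_y_const)
next
  case (Suc m) then show ?case by (simp add: monom_Suc poly_y_pCons const_simps const_shift[of var_y])
qed

text \<open>
  Polynomials in \<open>y\<close> form a commutative subalgebra, in which substitution is
  composition of polynomials.
\<close>

lemma alg_endo_poly_y:
  assumes "alg_endo \<sigma>" "\<sigma> var_y = poly_y r" shows "\<sigma> (poly_y q) = poly_y (pcompose q r)"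
  by (induction q)
    (simp_all add: poly_y_zero poly_y_pCons pcompose_pCons poly_y_add poly_y_mult poly_y_const assms alg_endoD[OF assms(1)])

lemma cm_group_simps:
  "carrier cm_group = {\<sigma>. alg_automorphism \<sigma> \<and> \<sigma> (commutator var_x var_y) = commutator var_x var_y}"
  "\<sigma> \<otimes>\<^bsub>cm_group\<^esub> \<tau> = \<sigma> \<circ> \<tau>" "\<one>\<^bsub>cm_group\<^esub> = id"
  by (simp_all add: cm_group_def)

lemma cm_group_group: "group cm_group"
proof (rule groupI)
  fix \<sigma> \<tau> assume "\<sigma> \<in> carrier cm_group" "\<tau> \<in> carrier cm_group"
  then show "\<sigma> \<otimes>\<^bsub>cm_group\<^esub> \<tau> \<in> carrier cm_group"
    by (auto simp: cm_group_simps alg_automorphism_iff alg_endo_comp intro: bij_comp)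
next
  fix \<sigma> assume s: "\<sigma> \<in> carrier cm_group"
  then have b: "bij \<sigma>" and e: "alg_endo \<sigma>" and c: "\<sigma> (commutator var_x var_y) = commutator var_x var_y"
    by (auto simp: cm_group_simps alg_automorphism_iff)
  define \<tau> where "\<tau> = inv_into UNIV \<sigma>"
  have ts: "\<tau> (\<sigma> p) = p" and st: "\<sigma> (\<tau> p) = p" for p
    using b by (simp_all add: \<tau>_def bij_is_inj bij_is_surj surj_f_inv_f)
  have inj: "\<sigma> p = \<sigma> q \<Longrightarrow> p = q" for p q using ts by metis
  have "alg_endo \<tau>"
    unfolding alg_endo_def
    by (intro conjI allI; rule inj; simp only: st alg_endoD[OF e])
  moreover have "bij \<tau>" unfolding \<tau>_def by (rule bij_imp_bij_inv[OF b])
  moreover have "\<tau> (commutator var_x var_y) = commutator var_x var_y" using c ts by metis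
  ultimately have "\<tau> \<in> carrier cm_group" by (auto simp: cm_group_simps alg_automorphism_iff)
  moreover have "\<tau> \<otimes>\<^bsub>cm_group\<^esub> \<sigma> = \<one>\<^bsub>cm_group\<^esub>" using ts by (auto simp: cm_group_simps)
  ultimately show "\<exists>\<tau>\<in>carrier cm_group. \<tau> \<otimes>\<^bsub>cm_group\<^esub> \<sigma> = \<one>\<^bsub>cm_group\<^esub>" by blast
qed (auto simp: cm_group_simps alg_automorphism_iff alg_endo_id o_assoc)

lemma carrierD: "\<sigma> \<in> carrier cm_group \<Longrightarrow> alg_endo \<sigma>"
  by (simp add: cm_group_simps alg_automorphism_iff)

definition triangular :: "complex \<Rightarrow> complex poly \<Rightarrow> complex \<Rightarrow> free_alg \<Rightarrow> free_alg" where
  "triangular a q h = free_subst (const a * var_x + poly_y q) (const (inverse a) * var_y + const h)"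

lemma triangular_vars:
  "triangular a q h var_x = const a * var_x + poly_y q"
  "triangular a q h var_y = const (inverse a) * var_y + const h"
  by (simp_all add: triangular_def free_subst_vars)

lemma alg_endo_triangular: "alg_endo (triangular a q h)"
  unfolding triangular_def by (rule alg_endo_free_subst)

lemma triangular_comp:
  "triangular a q h \<circ> triangular b r g
    = triangular (a * b) (Polynomial.smult b q + pcompose r [:h, inverse a:]) (inverse b * h + g)"
proof (rule alg_endo_eqI)
  note s = alg_endoD[OF alg_endo_triangular[of a q h]]
  have y: "triangular a q h var_y = poly_y [:h, inverse a:]"
    by (simp add: triangular_vars poly_y_linear)
  show "(triangular a q h \<circ> triangular b r g) var_x
    = triangular (a * b) (Polynomial.smult b q + pcompose r [:h, inverse a:]) (inverse b * h + g) var_x"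
    by (simp add: triangular_vars s alg_endo_poly_y[OF alg_endo_triangular y] poly_y_add poly_y_smult
        distrib_left const_mult_left mult.commute add.assoc)
  show "(triangular a q h \<circ> triangular b r g) var_y
    = triangular (a * b) (Polynomial.smult b q + pcompose r [:h, inverse a:]) (inverse b * h + g) var_y"
    by (simp add: triangular_vars s const_simps distrib_left const_mult const_mult_left mult.commute add.assoc)
qed (simp_all add: alg_endo_comp alg_endo_triangular)

lemma triangular_id: "triangular 1 0 0 = id"
  by (rule alg_endo_eqI)
    (simp_all add: alg_endo_triangular alg_endo_id triangular_vars const_simps poly_y_zero)

lemma var_y_poly_y: "poly_y q * var_y = var_y * poly_y q"
proof -
  have y: "poly_y [:0, 1:] = var_y" by (simp add: poly_y_linear const_simps)
  have "poly_y q * poly_y [:0, 1:] = poly_y [:0, 1:] * poly_y q"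
    by (simp only: poly_y_mult[symmetric] mult.commute)
  then show ?thesis by (simp only: y)
qed

lemma triangular_inverse:
  assumes "a \<noteq> 0"
  shows "triangular a q h \<circ> triangular (inverse a) (- Polynomial.smult (inverse a) (pcompose q [:- a * h, a:])) (- a * h) = id"
    "triangular (inverse a) (- Polynomial.smult (inverse a) (pcompose q [:- a * h, a:])) (- a * h) \<circ> triangular a q h = id"
proof -
  have "pcompose (pcompose q [:- a * h, a:]) [:h, inverse a:] = q"
    using assms by (simp add: pcompose_assoc[symmetric] pcompose_pCons)
  then show "triangular a q h \<circ> triangular (inverse a) (- Polynomial.smult (inverse a) (pcompose q [:- a * h, a:])) (- a * h) = id"
    using assms by (simp add: triangular_comp pcompose_smult pcompose_uminus triangular_id flip: mult.assoc)
  show "triangular (inverse a) (- Polynomial.smult (inverse a) (pcompose q [:- a * h, a:])) (- a * h) \<circ> triangular a q h = id"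
  proof -
    have e: "inverse a * (a * h) = h" using assms by simp
    show ?thesis using assms by (simp add: triangular_comp triangular_id e)
  qed
qed

text \<open>
  The commutator is preserved because \<open>q(y)\<close> commutes with \<open>y\<close> and the
  two scalars cancel.
\<close>

lemma triangular_in_carrier: "a \<noteq> 0 \<Longrightarrow> triangular a q h \<in> carrier cm_group"
proof -
  assume a: "a \<noteq> 0"
  note s = alg_endoD[OF alg_endo_triangular[of a q h]]
  have "bij (triangular a q h)" using triangular_inverse[OF a] o_bij by blast
  moreover have "triangular a q h (commutator var_x var_y) = commutator var_x var_y"
  proof -
    have 1: "const a * var_x * (const (inverse a) * var_y) = var_x * var_y"
      using a by (simp add: const_mult_const_mult const_simps(3))
    have 2: "const (inverse a) * var_y * (const a * var_x) = var_y * var_x"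
      using a by (simp add: const_mult_const_mult const_simps(3))
    have 3: "poly_y q * (const (inverse a) * var_y) = const (inverse a) * var_y * poly_y q"
      by (simp only: const_shift[of "poly_y q"] mult.assoc var_y_poly_y)
    show ?thesis
      by (simp add: commutator_def s triangular_vars distrib_left distrib_right 1 2 3 const_central[of h])
  qed
  ultimately show ?thesis by (simp add: cm_group_simps alg_automorphism_iff alg_endo_triangular)
qed

lemma eq_triangularI:
  assumes "\<sigma> \<in> carrier cm_group" "\<sigma> var_x = const a * var_x + poly_y q"
    "\<sigma> var_y = const (inverse a) * var_y + const h"
  shows "\<sigma> = triangular a q h"
  by (rule alg_endo_eqI) (use assms in \<open>simp_all add: carrierD alg_endo_triangular triangular_vars\<close>)

lemma subgroup_B_eq: "subgroup_B = {triangular a q h | a q h. a \<noteq> 0}"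
proof (intro equalityI subsetI)
  fix \<sigma> assume "\<sigma> \<in> subgroup_B"
  then obtain a h q where "\<sigma> \<in> carrier cm_group" "a \<noteq> 0" "\<sigma> var_x = const a * var_x + poly_y q"
    "\<sigma> var_y = const (inverse a) * var_y + const h" unfolding subgroup_B_def by blast
  then have "\<sigma> = triangular a q h" "a \<noteq> 0" by (simp_all add: eq_triangularI)
  then show "\<sigma> \<in> {triangular a q h | a q h. a \<noteq> 0}" by blast
next
  fix \<sigma> assume "\<sigma> \<in> {triangular a q h | a q h. a \<noteq> 0}"
  then obtain a q h where "\<sigma> = triangular a q h" "a \<noteq> 0" by blast
  then show "\<sigma> \<in> subgroup_B"
    unfolding subgroup_B_def using triangular_in_carrier[of a q h] triangular_vars[of a q h] by blast
qed

lemma subgroup_T_eq: "subgroup_T = {triangular a 0 0 | a. a \<noteq> 0}"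
proof (intro equalityI subsetI)
  fix \<sigma> assume "\<sigma> \<in> subgroup_T"
  then obtain a where "\<sigma> \<in> carrier cm_group" "a \<noteq> 0" "\<sigma> var_x = const a * var_x"
    "\<sigma> var_y = const (inverse a) * var_y" unfolding subgroup_T_def by blast
  then have "\<sigma> = triangular a 0 0" "a \<noteq> 0"
    by (simp_all add: eq_triangularI poly_y_zero const_simps)
  then show "\<sigma> \<in> {triangular a 0 0 | a. a \<noteq> 0}" by blast
next
  fix \<sigma> assume "\<sigma> \<in> {triangular a 0 0 | a. a \<noteq> 0}"
  then obtain a where a: "\<sigma> = triangular a 0 0" "a \<noteq> 0" by blast
  then have "\<sigma> var_x = const a * var_x" "\<sigma> var_y = const (inverse a) * var_y"
    by (simp_all add: triangular_vars poly_y_zero const_simps)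
  then show "\<sigma> \<in> subgroup_T"
    unfolding subgroup_T_def using triangular_in_carrier[of a 0 0] a by blast
qed

lemma subgroup_Gy_triangular:
  assumes "\<sigma> \<in> carrier cm_group" "\<sigma> var_x = var_x + poly_y q" "\<sigma> var_y = var_y"
  shows "\<sigma> = triangular 1 q 0"
  using assms by (intro eq_triangularI) (simp_all add: const_simps)

lemma triangular_in_Gy: "triangular 1 q 0 \<in> subgroup_Gy"
  unfolding subgroup_Gy_def
proof (intro CollectI conjI exI)
  show "triangular 1 q 0 \<in> carrier cm_group" by (rule triangular_in_carrier) simp
qed (simp_all add: triangular_vars const_simps)

lemma inv_triangular:
  assumes "a \<noteq> 0"
  shows "inv\<^bsub>cm_group\<^esub> (triangular a q h)
    = triangular (inverse a) (- Polynomial.smult (inverse a) (pcompose q [:- a * h, a:])) (- a * h)"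
  by (rule group.inv_equality[OF cm_group_group])
    (use assms triangular_inverse triangular_in_carrier in \<open>simp_all add: cm_group_simps(2,3)\<close>)

text \<open>
  The automorphisms \<open>(x + q(y), y)\<close> compose by adding the polynomials, so the
  generated group is reached by writing \<open>q\<close> as the sum of its monomials.
\<close>

lemma generated_subgroup_eq:
  fixes S :: "nat set"
  shows "generate cm_group {\<sigma> \<in> subgroup_Gy. \<exists>s\<in>S. \<exists>c. \<sigma> var_x = var_x + const c * var_y ^ (s - 1) \<and> \<sigma> var_y = var_y}
    = {triangular 1 q 0 | q. \<forall>m. coeff q m \<noteq> 0 \<longrightarrow> (\<exists>s\<in>S. m = s - 1)}" (is "generate _ ?gens = ?N")
proof -
  have gens: "?gens = {triangular 1 (monom c (s - 1)) 0 | c s. s \<in> S}"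
  proof (intro equalityI subsetI)
    fix \<sigma> assume "\<sigma> \<in> ?gens"
    then obtain s c where "\<sigma> \<in> subgroup_Gy" "s \<in> S" "\<sigma> var_x = var_x + poly_y (monom c (s - 1))" "\<sigma> var_y = var_y"
      unfolding poly_y_monom by blast
    then have "\<sigma> = triangular 1 (monom c (s - 1)) 0" "s \<in> S"
      using subgroup_Gy_triangular by (auto simp: subgroup_Gy_def)
    then show "\<sigma> \<in> {triangular 1 (monom c (s - 1)) 0 | c s. s \<in> S}" by blast
  next
    fix \<sigma> assume "\<sigma> \<in> {triangular 1 (monom c (s - 1)) 0 | c s. s \<in> S}"
    then obtain c s where s: "\<sigma> = triangular 1 (monom c (s - 1)) 0" "s \<in> S" by blast
    then have "\<sigma> \<in> subgroup_Gy" "\<sigma> var_x = var_x + const c * var_y ^ (s - 1)" "\<sigma> var_y = var_y"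
      by (simp_all add: triangular_in_Gy triangular_vars const_simps poly_y_monom)
    then show "\<sigma> \<in> ?gens" using s(2) by blast
  qed
  have comp: "triangular 1 q 0 \<circ> triangular 1 r 0 = triangular 1 (q + r) 0" for q r
    by (simp add: triangular_comp)
  have inv: "inv\<^bsub>cm_group\<^esub> (triangular 1 q 0) = triangular 1 (- q) 0" for q
    by (simp add: inv_triangular)
  show ?thesis
  proof
    show "generate cm_group ?gens \<subseteq> ?N"
    proof
      fix \<sigma> assume "\<sigma> \<in> generate cm_group ?gens"
      then show "\<sigma> \<in> ?N"
      proof (induction rule: generate.induct)
        case one
        show ?case unfolding cm_group_simps(3) by (intro CollectI exI[of _ 0]) (simp add: triangular_id)
      next
        case (incl h)
        then show ?case unfolding gens by (force simp: coeff_monom split: if_splits)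
      next
        case (inv h)
        then obtain c s where h: "h = triangular 1 (monom c (s - 1)) 0" "s \<in> S" unfolding gens by blast
        show ?case unfolding h(1) \<open>\<And>q. inv\<^bsub>cm_group\<^esub> (triangular 1 q 0) = triangular 1 (- q) 0\<close>
          by (intro CollectI exI[of _ "- monom c (s - 1)"]) (use h(2) in \<open>auto simp: coeff_monom split: if_splits\<close>)
      next
        case (eng h1 h2)
        then obtain q r where "h1 = triangular 1 q 0" "h2 = triangular 1 r 0"
          "\<forall>m. coeff q m \<noteq> 0 \<longrightarrow> (\<exists>s\<in>S. m = s - 1)" "\<forall>m. coeff r m \<noteq> 0 \<longrightarrow> (\<exists>s\<in>S. m = s - 1)" by blast
        then show ?case unfolding cm_group_simps(2)
          by (intro CollectI exI[of _ "q + r"]) (auto simp: comp, metis add_0)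
      qed
    qed
    show "?N \<subseteq> generate cm_group ?gens"
    proof clarify
      fix q :: "complex poly" assume q: "\<forall>m. coeff q m \<noteq> 0 \<longrightarrow> (\<exists>s\<in>S. m = s - 1)"
      have "triangular 1 (\<Sum>i<N. monom (coeff q i) i) 0 \<in> generate cm_group ?gens" for N
      proof (induction N)
        case 0
        have "triangular 1 (\<Sum>i<0. monom (coeff q i) i) 0 = \<one>\<^bsub>cm_group\<^esub>"
          by (simp add: triangular_id cm_group_simps(3))
        then show ?case by (simp only: generate.one)
      next
        case (Suc N)
        show ?case
        proof (cases "coeff q N = 0")
          case False
          then obtain s where "s \<in> S" "N = s - 1" using q by blast
          then have "triangular 1 (monom (coeff q N) N) 0 \<in> ?gens" unfolding gens by blast
          then have "triangular 1 (\<Sum>i<N. monom (coeff q i) i) 0 \<otimes>\<^bsub>cm_group\<^esub> triangular 1 (monom (coeff q N) N) 0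
             \<in> generate cm_group ?gens" using generate.eng[OF Suc generate.incl] by blast
          then show ?thesis by (simp add: cm_group_simps(2) comp)
        qed (use Suc in simp)
      qed
      from this[of "Suc (degree q)"] show "triangular 1 q 0 \<in> generate cm_group ?gens"
        by (simp only: lessThan_Suc_atMost poly_as_sum_of_monoms)
    qed
  qed
qed

lemma pcompose_scale_coeff: "coeff (pcompose q [:0, a:]) m = a ^ m * coeff q m" for a :: complex
proof (induction q arbitrary: m)
  case (pCons c q)
  then show ?case by (cases m) (simp_all add: pcompose_pCons coeff_pCons)
qed simp

text \<open>
  Rescaling \<open>y\<close> does not change which monomials occur in \<open>q\<close>. Hence a
  condition on the occurring monomials alone defines a subgroup of the triangular automorphisms,
  and the torus normalizes its unipotent part.
\<close>

lemma semidirect_triangular: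
  fixes S :: "nat \<Rightarrow> bool"
  defines "K \<equiv> {triangular a q 0 | a q. a \<noteq> 0 \<and> (\<forall>m. coeff q m \<noteq> 0 \<longrightarrow> S m)}"
    and "N \<equiv> {triangular 1 q 0 | q. \<forall>m. coeff q m \<noteq> 0 \<longrightarrow> S m}"
  shows "internal_semidirect cm_group K subgroup_T N"
proof -
  interpret G: group cm_group by (rule cm_group_group)
  have comp: "triangular a q 0 \<circ> triangular b r 0 = triangular (a * b) (Polynomial.smult b q + pcompose r [:0, inverse a:]) 0" for a q b r
    by (simp add: triangular_comp)
  have inv: "inv\<^bsub>cm_group\<^esub> (triangular a q 0) = triangular (inverse a) (- Polynomial.smult (inverse a) (pcompose q [:0, a:])) 0" if "a \<noteq> 0" for a q
    using inv_triangular[OF that, of q 0] by simp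
  have adm_comp: "\<forall>m. coeff (Polynomial.smult b q + pcompose r [:0, a:]) m \<noteq> 0 \<longrightarrow> S m"
    if "\<forall>m. coeff q m \<noteq> 0 \<longrightarrow> S m" "\<forall>m. coeff r m \<noteq> 0 \<longrightarrow> S m" for q r :: "complex poly" and a b
  proof (intro allI impI)
    fix m assume "coeff (Polynomial.smult b q + pcompose r [:0, a:]) m \<noteq> 0"
    then have "coeff q m \<noteq> 0 \<or> coeff r m \<noteq> 0" by (auto simp: pcompose_scale_coeff)
    then show "S m" using that by blast
  qed
  have KI: "triangular a q 0 \<in> K" if "a \<noteq> 0" "\<forall>m. coeff q m \<noteq> 0 \<longrightarrow> S m" for a q
    using that by (auto simp: K_def)
  have NI: "triangular 1 q 0 \<in> N" if "\<forall>m. coeff q m \<noteq> 0 \<longrightarrow> S m" for q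
    using that by (auto simp: N_def)
  have TI: "triangular a 0 0 \<in> subgroup_T" if "a \<noteq> 0" for a
    using that by (auto simp: subgroup_T_eq)
  have idK: "id \<in> K" using KI[of 1 0] by (simp add: triangular_id)
  have K: "subgroup K cm_group"
  proof (rule G.subgroupI)
    show "K \<subseteq> carrier cm_group" using triangular_in_carrier by (auto simp: K_def)
    show "K \<noteq> {}" using idK by blast
    show "inv\<^bsub>cm_group\<^esub> \<sigma> \<in> K" if \<sigma>: "\<sigma> \<in> K" for \<sigma>
    proof -
      obtain a q where a: "\<sigma> = triangular a q 0" "a \<noteq> 0" "\<forall>m. coeff q m \<noteq> 0 \<longrightarrow> S m" using \<sigma> unfolding K_def by auto
      show ?thesis unfolding a(1) inv[OF a(2)] by (rule KI) (use a in \<open>auto simp: pcompose_scale_coeff\<close>)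
    qed
    show "\<sigma> \<otimes>\<^bsub>cm_group\<^esub> \<tau> \<in> K" if st: "\<sigma> \<in> K" "\<tau> \<in> K" for \<sigma> \<tau>
    proof -
      obtain a q where a: "\<sigma> = triangular a q 0" "a \<noteq> 0" "\<forall>m. coeff q m \<noteq> 0 \<longrightarrow> S m" using st unfolding K_def by blast
      obtain b r where b: "\<tau> = triangular b r 0" "b \<noteq> 0" "\<forall>m. coeff r m \<noteq> 0 \<longrightarrow> S m" using st unfolding K_def by blast
      show ?thesis unfolding a(1) b(1) cm_group_simps(2) comp
        by (rule KI[OF _ adm_comp[OF a(3) b(3)]]) (simp add: a(2) b(2))
    qed
  qed
  let ?K = "cm_group\<lparr>carrier := K\<rparr>"
  interpret K: group ?K by (rule G.subgroup_imp_group[OF K])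
  have TK: "subgroup_T \<subseteq> K"
  proof
    fix \<sigma> assume "\<sigma> \<in> subgroup_T"
    then obtain a where "\<sigma> = triangular a 0 0" "a \<noteq> 0" unfolding subgroup_T_eq by blast
    then show "\<sigma> \<in> K" using KI[of a 0] by simp
  qed
  have NK: "N \<subseteq> K"
  proof
    fix \<sigma> assume "\<sigma> \<in> N"
    then obtain q where "\<sigma> = triangular 1 q 0" "\<forall>m. coeff q m \<noteq> 0 \<longrightarrow> S m" unfolding N_def by blast
    then show "\<sigma> \<in> K" using KI[of 1 q] by simp
  qed
  have invK: "inv\<^bsub>?K\<^esub> \<sigma> = inv\<^bsub>cm_group\<^esub> \<sigma>" if "\<sigma> \<in> K" for \<sigma>
    by (rule G.m_inv_consistent[OF K that])
  have T: "subgroup subgroup_T ?K"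
  proof (rule K.subgroupI)
    show "subgroup_T \<subseteq> carrier ?K" using TK by simp
    show "subgroup_T \<noteq> {}" using TI[OF one_neq_zero] by blast
    show "inv\<^bsub>?K\<^esub> \<sigma> \<in> subgroup_T" if \<sigma>: "\<sigma> \<in> subgroup_T" for \<sigma>
    proof -
      obtain a where a: "\<sigma> = triangular a 0 0" "a \<noteq> 0" using \<sigma> unfolding subgroup_T_eq by blast
      have "inv\<^bsub>?K\<^esub> \<sigma> = triangular (inverse a) 0 0"
      proof -
        have "\<sigma> \<in> K" using \<sigma> TK by blast
        then have "inv\<^bsub>?K\<^esub> \<sigma> = inv\<^bsub>cm_group\<^esub> (triangular a 0 0)" unfolding a(1) by (rule invK)
        also have "\<dots> = triangular (inverse a) 0 0" unfolding inv[OF a(2)] by simp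
        finally show ?thesis .
      qed
      then show ?thesis using TI[of "inverse a"] a(2) by simp
    qed
    show "\<sigma> \<otimes>\<^bsub>?K\<^esub> \<tau> \<in> subgroup_T" if st: "\<sigma> \<in> subgroup_T" "\<tau> \<in> subgroup_T" for \<sigma> \<tau>
    proof -
      obtain a b where a: "\<sigma> = triangular a 0 0" "a \<noteq> 0" "\<tau> = triangular b 0 0" "b \<noteq> 0"
        using st unfolding subgroup_T_eq by blast
      have "\<sigma> \<otimes>\<^bsub>?K\<^esub> \<tau> = triangular (a * b) 0 0" using comp[of a 0 b 0] by (simp add: a(1,3) cm_group_simps(2))
      then show ?thesis using TI[of "a * b"] a(2,4) by simp
    qed
  qed
  have N: "subgroup N ?K"
  proof (rule K.subgroupI)
    show "N \<subseteq> carrier ?K" using NK by simp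
    show "N \<noteq> {}"
    proof -
      have "triangular 1 0 0 \<in> N" by (rule NI) simp
      then show ?thesis by blast
    qed
    show "inv\<^bsub>?K\<^esub> \<sigma> \<in> N" if \<sigma>: "\<sigma> \<in> N" for \<sigma>
    proof -
      obtain q where q: "\<sigma> = triangular 1 q 0" "\<forall>m. coeff q m \<noteq> 0 \<longrightarrow> S m" using \<sigma> unfolding N_def by blast
      have "inv\<^bsub>?K\<^esub> \<sigma> = triangular 1 (- Polynomial.smult 1 (pcompose q [:0, 1:])) 0"
      proof -
        have "\<sigma> \<in> K" using \<sigma> NK by blast
        then have "inv\<^bsub>?K\<^esub> \<sigma> = inv\<^bsub>cm_group\<^esub> (triangular 1 q 0)" unfolding q(1) by (rule invK)
        also have "\<dots> = triangular 1 (- Polynomial.smult 1 (pcompose q [:0, 1:])) 0"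
          using inv[OF one_neq_zero, of q] unfolding inverse_1 .
        finally show ?thesis .
      qed
      then show ?thesis using NI[of "- Polynomial.smult 1 (pcompose q [:0, 1:])"] q(2) by (simp add: pcompose_scale_coeff)
    qed
    show "\<sigma> \<otimes>\<^bsub>?K\<^esub> \<tau> \<in> N" if st: "\<sigma> \<in> N" "\<tau> \<in> N" for \<sigma> \<tau>
    proof -
      obtain q r where q: "\<sigma> = triangular 1 q 0" "\<forall>m. coeff q m \<noteq> 0 \<longrightarrow> S m"
        "\<tau> = triangular 1 r 0" "\<forall>m. coeff r m \<noteq> 0 \<longrightarrow> S m" using st unfolding N_def by blast
      have "\<sigma> \<otimes>\<^bsub>?K\<^esub> \<tau> = triangular 1 (Polynomial.smult 1 q + pcompose r [:0, 1:]) 0"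
        using comp[of 1 q 1 r] by (simp add: q(1,3) cm_group_simps(2))
      then show ?thesis using NI[OF adm_comp[OF q(2,4), of 1 1]] by simp
    qed
  qed
  have normal: "N \<lhd> ?K"
    unfolding K.normal_inv_iff
  proof (intro conjI ballI N)
    fix \<sigma> \<nu> assume \<sigma>: "\<sigma> \<in> carrier ?K" and \<nu>: "\<nu> \<in> N"
    obtain a q where a: "\<sigma> = triangular a q 0" "a \<noteq> 0" "\<forall>m. coeff q m \<noteq> 0 \<longrightarrow> S m" using \<sigma> unfolding K_def by auto
    obtain r where r: "\<nu> = triangular 1 r 0" "\<forall>m. coeff r m \<noteq> 0 \<longrightarrow> S m" using \<nu> unfolding N_def by blast
    have "\<sigma> \<otimes>\<^bsub>?K\<^esub> \<nu> \<otimes>\<^bsub>?K\<^esub> inv\<^bsub>?K\<^esub> \<sigma>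
      = triangular a q 0 \<circ> triangular 1 r 0 \<circ> triangular (inverse a) (- Polynomial.smult (inverse a) (pcompose q [:0, a:])) 0"
    proof -
      have "inv\<^bsub>?K\<^esub> \<sigma> = triangular (inverse a) (- Polynomial.smult (inverse a) (pcompose q [:0, a:])) 0"
        using \<sigma> invK[of \<sigma>] inv[OF a(2), of q] unfolding a(1) by simp
      then show ?thesis by (simp add: cm_group_simps(2) a(1) r(1))
    qed
    also have "\<dots> = triangular 1 (Polynomial.smult (inverse a) (Polynomial.smult 1 q + pcompose r [:0, inverse a:])
        + pcompose (- Polynomial.smult (inverse a) (pcompose q [:0, a:])) [:0, inverse a:]) 0"
      using a(2) by (simp add: comp)
    also have "\<dots> \<in> N"
      by (intro NI adm_comp) (use a r in \<open>auto simp: pcompose_scale_coeff\<close>)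
    finally show "\<sigma> \<otimes>\<^bsub>?K\<^esub> \<nu> \<otimes>\<^bsub>?K\<^esub> inv\<^bsub>?K\<^esub> \<sigma> \<in> N" .
  qed
  have inter: "subgroup_T \<inter> N = {\<one>\<^bsub>cm_group\<^esub>}"
  proof
    show "{\<one>\<^bsub>cm_group\<^esub>} \<subseteq> subgroup_T \<inter> N"
      using TI[of 1] NI[of 0] by (simp add: cm_group_simps(3) triangular_id)
    show "subgroup_T \<inter> N \<subseteq> {\<one>\<^bsub>cm_group\<^esub>}"
    proof
      fix \<sigma> assume "\<sigma> \<in> subgroup_T \<inter> N"
      then obtain a q where a: "\<sigma> = triangular a 0 0" "\<sigma> = triangular 1 q 0" "a \<noteq> 0" unfolding subgroup_T_eq N_def by blast
      then have "triangular a 0 0 var_y = triangular 1 q 0 var_y" by simp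
      then have "const (inverse a) * var_y = var_y" by (simp add: triangular_vars const_simps)
      then have "Poly_Mapping.lookup (const (inverse a) * var_y) (Word [GenY]) = Poly_Mapping.lookup var_y (Word [GenY])"
        by simp
      then have "inverse a = 1" by (simp add: var_y_def const_mult_single)
      then show "\<sigma> \<in> {\<one>\<^bsub>cm_group\<^esub>}" using a(1) by (simp add: cm_group_simps(3) triangular_id)
    qed
  qed
  have "subgroup_T <#>\<^bsub>cm_group\<^esub> N = K"
  proof
    show "subgroup_T <#>\<^bsub>cm_group\<^esub> N \<subseteq> K"
      using subgroup.m_closed[OF K] TK NK unfolding set_mult_def by blast
    show "K \<subseteq> subgroup_T <#>\<^bsub>cm_group\<^esub> N"
    proof
      fix \<sigma> assume "\<sigma> \<in> K"
      then obtain a q where a: "\<sigma> = triangular a q 0" "a \<noteq> 0" "\<forall>m. coeff q m \<noteq> 0 \<longrightarrow> S m" unfolding K_def by blast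
      have "\<sigma> = triangular a 0 0 \<otimes>\<^bsub>cm_group\<^esub> triangular 1 (pcompose q [:0, a:]) 0"
        using a(2) by (simp add: cm_group_simps(2) comp a(1) pcompose_assoc[symmetric] pcompose_pCons)
      moreover have "triangular 1 (pcompose q [:0, a:]) 0 \<in> N" by (rule NI) (use a in \<open>auto simp: pcompose_scale_coeff\<close>)
      ultimately show "\<sigma> \<in> subgroup_T <#>\<^bsub>cm_group\<^esub> N" using TI[OF a(2)] by (auto simp: set_mult_def)
    qed
  qed
  then show ?thesis unfolding internal_semidirect_def using K T normal inter by blast
qed

section \<open>Hook-indexed matrices with arms and legs as eigenvalues\<close>

text \<open>
  Forward substitution; the version with \<open>N < D\<close> yields the vanishing of an initial
  segment of \<open>y\<close>, which is how the support conditions of the matrix \<open>q\<close>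
  are obtained.
\<close>

lemma triangular_zero:
  fixes U :: "nat \<Rightarrow> nat \<Rightarrow> complex"
  assumes tri: "\<And>i j. U i j \<noteq> 0 \<Longrightarrow> i \<le> j" and diag: "\<And>j. j < D \<Longrightarrow> U j j \<noteq> 0"
    and N: "N \<le> D" and eq: "\<And>j. j < N \<Longrightarrow> (\<Sum>l<D. y l * U l j) = 0"
  shows "l < N \<Longrightarrow> y l = 0"
proof (induction l rule: less_induct)
  case (less l)
  have "(\<Sum>m<D. y m * U m l) = (\<Sum>m<D. if m = l then y l * U l l else 0)"
    by (rule sum.cong[OF refl]) (use less tri in \<open>force simp: not_less_iff_gr_or_eq\<close>)
  also have "\<dots> = y l * U l l" using less.prems N by simp
  finally show ?case using eq[OF less.prems] diag[of l] less.prems N by simp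
qed

lemma triangular_solve:
  fixes U :: "nat \<Rightarrow> nat \<Rightarrow> complex"
  assumes tri: "\<And>i j. U i j \<noteq> 0 \<Longrightarrow> i \<le> j" and diag: "\<And>j. j < D \<Longrightarrow> U j j \<noteq> 0"
  shows "\<exists>y. \<forall>j<D. (\<Sum>l<D. y l * U l j) = T j"
proof -
  have "N \<le> D \<Longrightarrow> \<exists>y. \<forall>j<N. (\<Sum>l<N. y l * U l j) = T j" for N
  proof (induction N)
    case (Suc N)
    then obtain y where y: "\<forall>j<N. (\<Sum>l<N. y l * U l j) = T j" by auto
    define y' where "y' = y(N := (T N - (\<Sum>l<N. y l * U l N)) / U N N)"
    have e: "(\<Sum>l<N. y' l * U l j) = (\<Sum>l<N. y l * U l j)" for j
      by (rule sum.cong) (auto simp: y'_def)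
    have "(\<Sum>l<Suc N. y' l * U l j) = T j" if "j < Suc N" for j
    proof (cases "j = N")
      case True then show ?thesis using diag[of N] Suc.prems e[of N] by (simp add: y'_def)
    next
      case False
      then have "U N j = 0" using tri[of N j] that by linarith
      with False that show ?thesis using y e[of j] by simp
    qed
    then show ?case by blast
  qed simp
  then show ?thesis by blast
qed

lemma sum_sandwich:
  fixes f h :: "nat \<Rightarrow> complex"
  shows "(\<Sum>a<D. \<Sum>b<D. f a * (\<Sum>l<D. A a l * B l b) * h b)
       = (\<Sum>l<D. (\<Sum>a<D. f a * A a l) * (\<Sum>b<D. B l b * h b))"
proof -
  have "(\<Sum>a<D. \<Sum>b<D. f a * (\<Sum>l<D. A a l * B l b) * h b)
      = (\<Sum>a<D. \<Sum>b<D. \<Sum>l<D. f a * A a l * (B l b * h b))"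
    by (simp add: sum_distrib_left sum_distrib_right mult.assoc)
  also have "\<dots> = (\<Sum>a<D. \<Sum>l<D. \<Sum>b<D. f a * A a l * (B l b * h b))"
    by (intro sum.cong refl sum.swap)
  also have "\<dots> = (\<Sum>l<D. \<Sum>a<D. \<Sum>b<D. f a * A a l * (B l b * h b))"
    by (rule sum.swap)
  finally show ?thesis by (simp add: sum_product)
qed

text \<open>
  The data of a partition in Frobenius coordinates: \<open>p i\<close> and \<open>al i\<close> are
  leg and arm of the hook \<open>i\<close>, and \<open>v i * w i\<close> is its size. The factors
  \<open>v\<close>, \<open>w\<close> are kept general, since the rank condition determines them
  only up to rescaling, and since exchanging \<open>(p, v)\<close> with \<open>(al, w)\<close>
  then is a symmetry.
\<close>

locale frobenius =
  fixes D :: nat and p al :: "nat \<Rightarrow> nat" and v w :: "nat \<Rightarrow> complex"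
  assumes p_dec: "\<And>i j. i < j \<Longrightarrow> j < D \<Longrightarrow> p j < p i"
    and al_dec: "\<And>i j. i < j \<Longrightarrow> j < D \<Longrightarrow> al j < al i"
    and vw: "\<And>i. i < D \<Longrightarrow> v i * w i = of_nat (p i + al i + 1)"
begin

text \<open>
  Transposition of matrices, combined with the sign change of contents, exchanges arms and legs.
  Each statement about arms therefore comes with one about legs.
\<close>

lemma dual: "frobenius D al p w v"
  by unfold_locales (use p_dec al_dec vw in \<open>auto simp: mult.commute add.commute\<close>)

lemma p_mono: "i \<le> j \<Longrightarrow> j < D \<Longrightarrow> p j \<le> p i"
  using p_dec[of i j] by (cases "i = j") auto
lemma al_mono: "i \<le> j \<Longrightarrow> j < D \<Longrightarrow> al j \<le> al i"
  using al_dec[of i j] by (cases "i = j") auto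
lemma p_le_iff: "i < D \<Longrightarrow> j < D \<Longrightarrow> p j \<le> p i \<longleftrightarrow> i \<le> j"
  using p_dec[of j i] p_mono[of i j] by fastforce
lemma al_le_iff: "i < D \<Longrightarrow> j < D \<Longrightarrow> al j \<le> al i \<longleftrightarrow> i \<le> j"
  using al_dec[of j i] al_mono[of i j] by fastforce

lemma hook_length_nz: "of_nat (p i + al j + 1) \<noteq> (0::complex)"
  by (metis add_is_0 of_nat_eq_0_iff one_neq_zero)

lemma v_nz: "i < D \<Longrightarrow> v i \<noteq> 0"
  using vw[of i] hook_length_nz[of i i] by (metis mult_zero_left)
lemma w_nz: "i < D \<Longrightarrow> w i \<noteq> 0"
  using vw[of i] hook_length_nz[of i i] by (metis mult_zero_right)

text \<open>
  The block of the fixed \<open>X\<close> on a nonnegative content \<open>c\<close> is \<open>c -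
  Lp\<close>.
\<close>

definition Lp :: "nat \<Rightarrow> nat \<Rightarrow> complex" where
  "Lp i j = (if i = j then of_nat (al i) else if i < j then v i * w j else 0)"

text \<open>
  The block of the fixed \<open>X\<close> on a negative content \<open>c\<close> is \<open>c + 1 +
  Lm\<close>.
\<close>

definition Lm :: "nat \<Rightarrow> nat \<Rightarrow> complex" where
  "Lm i j = (if i = j then of_nat (p i) else if j < i then v i * w j else 0)"

lemma Lp_dual: "frobenius.Lp p w v i j = Lm j i"
  by (simp add: Lm_def frobenius.Lp_def[OF dual] mult.commute)
lemma Lm_dual: "frobenius.Lm al w v i j = Lp j i"
  by (simp add: Lp_def frobenius.Lm_def[OF dual] mult.commute)

lemma Lp_Lm: "i < D \<Longrightarrow> j < D \<Longrightarrow> Lp i j + Lm i j + (if i = j then 1 else 0) = v i * w j"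
  using vw[of i] by (auto simp: Lp_def Lm_def)

text \<open>
  The eigenvector for \<open>al j\<close> is explicit. For the tail sums \<open>s i\<close> of
  \<open>w l * u l\<close> over \<open>l \<ge> i\<close> the eigenvalue equation turns into a
  recursion of first order, solved by a product of nonzero factors. In particular the total sum is
  nonzero, so that it can be normalized to 1.
\<close>

lemma eigenvectors_Lp:
  "\<exists>U. (\<forall>i j. U i j \<noteq> 0 \<longrightarrow> i \<le> j) \<and> (\<forall>j<D. U j j \<noteq> 0)
     \<and> (\<forall>i<D. \<forall>j<D. (\<Sum>l<D. Lp i l * U l j) = of_nat (al j) * U i j)
     \<and> (\<forall>j<D. (\<Sum>l<D. w l * U l j) = 1)"
proof -
  define fac :: "nat \<Rightarrow> nat \<Rightarrow> complex"
    where "fac j l = of_nat (p l + al j + 1) / (of_nat (al j) - of_nat (al l))" for j l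
  \<comment> \<open>The tail sum from \<open>m\<close> on, up to the factor that makes the total 1.\<close>
  define s where "s j m = (if j < m then 0 else \<Prod>l\<in>{m..<j}. fac j l)" for j m
  define U where "U i j = (if j < D \<and> i \<le> j then (s j i - s j (Suc i)) / w i / s j 0 else 0)" for i j
  have dnz: "of_nat (al j) - of_nat (al l) \<noteq> (0::complex)" if "l < j" "j < D" for l j
    using al_dec[OF that] by simp
  have fnz: "fac j l \<noteq> 0" if "l < j" "j < D" for l j
    using dnz[OF that] hook_length_nz[of l j] unfolding fac_def by (metis divide_eq_0_iff)
  have snz: "s j m \<noteq> 0" if "m \<le> j" "j < D" for j m
    using that fnz unfolding s_def by auto
  have srec: "s j m = fac j m * s j (Suc m)" if "m < j" for j m
    using that unfolding s_def by (auto simp: prod.atLeast_Suc_lessThan)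
  have Uw: "w i * U i j = (s j i - s j (Suc i)) / s j 0" if "i < D" "j < D" for i j
    using that w_nz[of i] unfolding U_def by (auto simp: s_def)
  have tail: "(\<Sum>l\<in>{m..<D}. w l * U l j) = s j m / s j 0" if "j < D" "m \<le> D" for j m
  proof -
    have "(\<Sum>l\<in>{m..<D}. w l * U l j) = (\<Sum>l\<in>{m..<D}. (s j l - s j (Suc l)) / s j 0)"
      using Uw that by (intro sum.cong) auto
    also have "\<dots> = (\<Sum>l\<in>{m..<D}. s j l - s j (Suc l)) / s j 0"
      by (simp add: sum_divide_distrib)
    also have "(\<Sum>l\<in>{m..<D}. s j l - s j (Suc l)) = s j m - s j D"
      using sum_Suc_diff'[of m D "\<lambda>l. - s j l"] that by simp
    also have "s j D = 0" using that by (simp add: s_def)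
    finally show ?thesis by simp
  qed
  have eig: "(\<Sum>l<D. Lp i l * U l j) = of_nat (al j) * U i j" if ij: "i < D" "j < D" for i j
  proof -
    have "(\<Sum>l<D. Lp i l * U l j) = (\<Sum>l\<in>{i..<D}. Lp i l * U l j)"
      by (rule sum.mono_neutral_right) (auto simp: Lp_def)
    also have "\<dots> = of_nat (al i) * U i j + (\<Sum>l\<in>{Suc i..<D}. Lp i l * U l j)"
      using ij by (simp add: sum.atLeast_Suc_lessThan Lp_def)
    also have "(\<Sum>l\<in>{Suc i..<D}. Lp i l * U l j) = v i * (\<Sum>l\<in>{Suc i..<D}. w l * U l j)"
      by (simp add: sum_distrib_left Lp_def mult.assoc)
    also have "\<dots> = v i * (s j (Suc i) / s j 0)" using tail[of j "Suc i"] ij by simp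
    finally have 1: "(\<Sum>l<D. Lp i l * U l j) = of_nat (al i) * U i j + v i * (s j (Suc i) / s j 0)" .
    show ?thesis
    proof (cases "i < j")
      case False
      then have "s j (Suc i) = 0" by (simp add: s_def)
      moreover have "of_nat (al i) * U i j = of_nat (al j) * U i j"
        using False by (cases "i = j") (auto simp: U_def)
      ultimately show ?thesis using 1 by simp
    next
      case True
      have d: "of_nat (al j) - of_nat (al i) \<noteq> (0::complex)" using dnz[OF True ij(2)] .
      have "s j i - s j (Suc i) = (fac j i - 1) * s j (Suc i)"
        using srec[OF True] by (simp add: algebra_simps)
      also have "fac j i - 1 = of_nat (p i + al i + 1) / (of_nat (al j) - of_nat (al i))"
        using d by (simp add: fac_def field_simps)
      also have "\<dots> = v i * w i / (of_nat (al j) - of_nat (al i))" using vw[OF ij(1)] by simp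
      finally have "U i j = v i * s j (Suc i) / s j 0 / (of_nat (al j) - of_nat (al i))"
        using True ij w_nz[OF ij(1)] by (simp add: U_def)
      then have "(of_nat (al j) - of_nat (al i)) * U i j = v i * s j (Suc i) / s j 0"
        using d by simp
      then show ?thesis using 1 by (simp add: algebra_simps)
    qed
  qed
  show ?thesis
  proof (intro exI[of _ U] conjI allI impI)
    fix j assume j: "j < D"
    show "U j j \<noteq> 0" using j snz[of 0 j] w_nz[OF j] by (simp add: U_def s_def)
    show "(\<Sum>l<D. w l * U l j) = 1"
      using tail[OF j, of 0] snz[of 0 j] j by (simp add: atLeast0LessThan)
  qed (use eig in \<open>auto simp: U_def split: if_splits\<close>)
qed

text \<open>
  The hook \<open>i\<close> has exactly one cell of each content between \<open>-p i\<close> and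
  \<open>al i\<close>.
\<close>

definition valid :: "nat \<Rightarrow> int \<Rightarrow> bool" where
  "valid i c \<longleftrightarrow> i < D \<and> - int (p i) \<le> c \<and> c \<le> int (al i)"

definition xc :: "nat \<Rightarrow> nat \<Rightarrow> int \<Rightarrow> complex" where
  "xc i j c = (if 0 \<le> c then (if i = j then of_int c else 0) - Lp i j
               else (if i = j then of_int (c + 1) else 0) + Lm i j)"

lemma valid_dual: "frobenius.valid D al p i c \<longleftrightarrow> valid i (- c)"
  by (auto simp: valid_def frobenius.valid_def[OF dual])

lemma xc_dual: "frobenius.xc al p w v i j c = - xc j i (- c - 1)"
  by (auto simp: xc_def frobenius.xc_def[OF dual] Lp_dual Lm_dual)

text \<open>
  The function \<open>g c\<close> is the block, from content \<open>c\<close> to content \<open>c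
  - k\<close>, of a matrix \<open>Q\<close> of degree \<open>k\<close>. The last two conditions
  are \<open>Q Y = Y Q\<close> and \<open>Q X - X Q = Y\<^sup>k\<^sup>-\<^sup>1\<close>.
\<close>

definition commutes_raises :: "nat \<Rightarrow> (int \<Rightarrow> nat \<Rightarrow> nat \<Rightarrow> complex) \<Rightarrow> bool" where
  "commutes_raises k g \<longleftrightarrow>
     (\<forall>c i j. \<not> (valid i (c - int k) \<and> valid j c) \<longrightarrow> g c i j = 0) \<and>
     (\<forall>c i j. valid i (c - 1 - int k) \<longrightarrow> valid j c \<longrightarrow> g c i j = g (c - 1) i j) \<and>
     (\<forall>c i j. valid i (c - int k + 1) \<longrightarrow> valid j c \<longrightarrow>
        (\<Sum>l<D. g (c + 1) i l * xc l j c) - (\<Sum>l<D. xc i l (c - int k) * g c l j)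
          = (if i = j then 1 else 0))"

text \<open>
  The equations \<open>M Q = 0\<close> and \<open>Q M = 0\<close> for the rank one matrix \<open>M
  = X Y - Y X + 1\<close>.
\<close>

definition kills_framing :: "nat \<Rightarrow> (int \<Rightarrow> nat \<Rightarrow> nat \<Rightarrow> complex) \<Rightarrow> bool" where
  "kills_framing k g \<longleftrightarrow>
     (\<forall>j<D. k \<le> al j \<longrightarrow> (\<Sum>l<D. w l * g (int k) l j) = 0) \<and>
     (\<forall>i<D. k \<le> p i \<longrightarrow> (\<Sum>l<D. g 0 i l * v l) = 0)"

lemma commutes_raises_dual:
  assumes "commutes_raises k g"
  shows "frobenius.commutes_raises D al p w v k (\<lambda>c i j. g (int k - c) j i)"
proof -
  have gz: "g c i j = 0" if "\<not> (valid i (c - int k) \<and> valid j c)" for c i j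
    using assms that unfolding commutes_raises_def by blast
  have gy: "g c i j = g (c - 1) i j" if "valid i (c - 1 - int k)" "valid j c" for c i j
    using assms that unfolding commutes_raises_def by blast
  have gx: "(\<Sum>l<D. g (c + 1) i l * xc l j c) - (\<Sum>l<D. xc i l (c - int k) * g c l j)
          = (if i = j then 1 else 0)" if "valid i (c - int k + 1)" "valid j c" for c i j
    using assms that unfolding commutes_raises_def by blast
  show ?thesis
    unfolding frobenius.commutes_raises_def[OF dual] valid_dual xc_dual
  proof (intro conjI allI impI)
    fix c i j assume "\<not> (valid i (- (c - int k)) \<and> valid j (- c))"
    then show "g (int k - c) j i = 0" by (intro gz) (auto simp: algebra_simps)
  next
    fix c i j assume "valid i (- (c - 1 - int k))" "valid j (- c)"
    then have "valid j (int k - (c - 1) - 1 - int k)" "valid i (int k - (c - 1))"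
      by (simp_all add: algebra_simps)
    from gy[OF this] show "g (int k - c) j i = g (int k - (c - 1)) j i" by simp
  next
    fix c i j assume v: "valid i (- (c - int k + 1))" "valid j (- c)"
    let ?c = "int k - c - 1"
    have "valid j (?c - int k + 1)" "valid i ?c" using v by (simp_all add: algebra_simps)
    then have *: "(\<Sum>l<D. g (?c + 1) j l * xc l i ?c) - (\<Sum>l<D. xc j l (?c - int k) * g ?c l i)
       = (if j = i then 1 else 0)" by (rule gx)
    have e1: "?c + 1 = int k - c" and e2: "?c - int k = - c - 1" by auto
    from * have e: "(\<Sum>l<D. g (int k - c) j l * xc l i ?c) - (\<Sum>l<D. xc j l (- c - 1) * g ?c l i)
       = (if i = j then 1 else 0)" by (simp only: eq_commute[of i j] e1 e2)
    have "(\<Sum>l<D. g (int k - (c + 1)) l i * - xc j l (- c - 1))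
       - (\<Sum>l<D. - xc l i (- (c - int k) - 1) * g (int k - c) j l)
      = (\<Sum>l<D. g (int k - c) j l * xc l i ?c) - (\<Sum>l<D. xc j l (- c - 1) * g ?c l i)"
    proof -
      have "- (c - int k) - 1 = ?c" "int k - (c + 1) = ?c" by auto
      then show ?thesis by (simp only: sum_negf mult_minus_right mult_minus_left) (simp add: mult.commute)
    qed
    with e show "(\<Sum>l<D. g (int k - (c + 1)) l i * - xc j l (- c - 1))
       - (\<Sum>l<D. - xc l i (- (c - int k) - 1) * g (int k - c) j l) = (if i = j then 1 else 0)"
      by simp
  qed
qed

lemma kills_framing_dual:
  assumes "kills_framing k g"
  shows "frobenius.kills_framing D al p w v k (\<lambda>c i j. g (int k - c) j i)"
  using assms unfolding kills_framing_def frobenius.kills_framing_def[OF dual]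
  by (auto simp: mult.commute)

(*CUT*)
text \<open>
  Apply \<open>Q\<close> to the eigenvector \<open>u\<close> for \<open>al j\<close>, placed at
  content \<open>al j\<close>, where \<open>X\<close> kills it. The image \<open>y\<close>
  satisfies \<open>(Lp - (al j - k)) y = u\<close>. If \<open>al j - k\<close> is no eigenvalue,
  then \<open>y = u / k\<close>, and \<open>w y = 1 / k\<close> contradicts that \<open>w\<close>
  kills the image of \<open>Q\<close>.
\<close>

lemma arm_condition_necessary:
  assumes k: "k \<ge> 1" and g: "commutes_raises k g" and kf: "kills_framing k g"
    and j: "j < D" "k \<le> al j"
  shows "\<exists>l<D. al l = al j - k"
proof (rule ccontr)
  assume no: "\<not> (\<exists>l<D. al l = al j - k)"
  obtain U where tri: "\<And>i j. U i j \<noteq> 0 \<Longrightarrow> i \<le> j"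
    and eig: "\<And>i j. i < D \<Longrightarrow> j < D \<Longrightarrow> (\<Sum>l<D. Lp i l * U l j) = of_nat (al j) * U i j"
    and wU: "\<And>j. j < D \<Longrightarrow> (\<Sum>l<D. w l * U l j) = 1"
    using eigenvectors_Lp by blast
  have gz: "g c i j = 0" if "\<not> valid i (c - int k) \<or> \<not> valid j c" for c i j
    using g that unfolding commutes_raises_def by blast
  have gy: "g c i j = g (c - 1) i j" if "valid i (c - 1 - int k)" "valid j c" for c i j
    using g that unfolding commutes_raises_def by blast
  have gx: "(\<Sum>l<D. g (c + 1) i l * xc l j c) - (\<Sum>l<D. xc i l (c - int k) * g c l j)
          = (if i = j then 1 else 0)" if "valid i (c - int k + 1)" "valid j c" for c i j
    using g that unfolding commutes_raises_def by blast
  define c where "c = int (al j)"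
  have vc: "valid m c" if "m \<le> j" for m
    using al_mono[OF that j(1)] that j by (auto simp: valid_def c_def)
  have xU: "(\<Sum>m<D. xc l m c * U m j) = 0" if "l < D" for l
  proof -
    have "(\<Sum>m<D. xc l m c * U m j) = (\<Sum>m<D. (if l = m then of_int c * U m j else 0) - Lp l m * U m j)"
      by (rule sum.cong) (auto simp: xc_def c_def algebra_simps)
    also have "\<dots> = of_int c * U l j - of_nat (al j) * U l j"
      using that eig[OF that j(1)] by (simp add: sum_subtractf)
    finally show ?thesis by (simp add: c_def)
  qed
  define y where "y l = (\<Sum>m<D. g c l m * U m j)" for l
  have main: "(\<Sum>l<D. Lp i l * y l) = (of_nat (al j) - of_nat k) * y i + U i j" if i: "i < D" for i
  proof (cases "valid i (c - int k + 1)")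
    case True
    have "(\<Sum>m<D. ((\<Sum>l<D. g (c + 1) i l * xc l m c) - (\<Sum>l<D. xc i l (c - int k) * g c l m)) * U m j)
        = (\<Sum>m<D. (if i = m then 1 else 0) * U m j)"
      by (rule sum.cong[OF refl]) (use gx[OF True] vc tri in force)
    also have "\<dots> = U i j" using i by (simp add: if_distrib[where f="\<lambda>x. x * _"] cong: if_cong)
    finally have "U i j = (\<Sum>m<D. (\<Sum>l<D. g (c + 1) i l * xc l m c) * U m j)
        - (\<Sum>m<D. (\<Sum>l<D. xc i l (c - int k) * g c l m) * U m j)"
      by (simp add: left_diff_distrib sum_subtractf)
    also have "(\<Sum>m<D. (\<Sum>l<D. g (c + 1) i l * xc l m c) * U m j)
        = (\<Sum>l<D. g (c + 1) i l * (\<Sum>m<D. xc l m c * U m j))"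
      by (simp add: sum_distrib_left sum_distrib_right mult.assoc) (rule sum.swap)
    also have "\<dots> = 0" using xU by simp
    also have "(\<Sum>m<D. (\<Sum>l<D. xc i l (c - int k) * g c l m) * U m j) = (\<Sum>l<D. xc i l (c - int k) * y l)"
      unfolding y_def by (simp add: sum_distrib_left sum_distrib_right mult.assoc) (rule sum.swap)
    also have "\<dots> = (\<Sum>l<D. (if i = l then of_int (c - int k) * y l else 0) - Lp i l * y l)"
      using j by (intro sum.cong refl) (auto simp: xc_def c_def algebra_simps)
    also have "\<dots> = of_int (c - int k) * y i - (\<Sum>l<D. Lp i l * y l)"
      using i by (simp add: sum_subtractf)
    finally show ?thesis by (simp add: c_def algebra_simps)
  next
    case False
    then have "int (al i) < c - int k + 1" using i j by (auto simp: valid_def c_def)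
    moreover have "int (al i) \<noteq> c - int k"
    proof
      assume "int (al i) = c - int k"
      then have "al i = al j - k" using j by (auto simp: c_def)
      then show False using no i by blast
    qed
    ultimately have lt: "int (al i) < c - int k" by simp
    have yz: "y l = 0" if "i \<le> l" "l < D" for l
    proof -
      have "\<not> valid l (c - int k)" using al_mono[OF that] lt by (auto simp: valid_def)
      then show ?thesis unfolding y_def using gz by simp
    qed
    have "j < i" using al_le_iff[OF i j(1)] lt by (auto simp: c_def)
    then have "U i j = 0" using tri[of i j] by linarith
    moreover have "Lp i l * y l = 0" if "l < D" for l
      using yz[of l] that by (cases "i \<le> l") (auto simp: Lp_def)
    ultimately show ?thesis using yz[of i] i by (simp add: sum.neutral)
  qed
  define z where "z l = y l - U l j / of_nat k" for l
  have knz: "of_nat k \<noteq> (0::complex)" using k by simp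
  have zeig: "(\<Sum>l<D. Lp i l * z l) = (of_nat (al j) - of_nat k) * z i" if i: "i < D" for i
  proof -
    have "(\<Sum>l<D. Lp i l * z l) = (\<Sum>l<D. Lp i l * y l) - (\<Sum>l<D. Lp i l * U l j) / of_nat k"
      by (simp add: z_def right_diff_distrib sum_subtractf sum_divide_distrib)
    also have "\<dots> = (of_nat (al j) - of_nat k) * y i + U i j - of_nat (al j) * U i j / of_nat k"
      using main[OF i] eig[OF i j(1)] by simp
    also have "\<dots> = (of_nat (al j) - of_nat k) * z i" using knz by (simp add: z_def field_simps)
    finally show ?thesis .
  qed
  have z0: "z (D - Suc t) = 0" if "t < D" for t
    using that
  proof (induction t rule: less_induct)
    case (less t)
    let ?i = "D - Suc t"
    have i: "?i < D" using less.prems by simp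
    have later: "z l = 0" if "?i < l" "l < D" for l
      using less.IH[of "D - Suc l"] that less.prems by auto
    have "(\<Sum>l<D. Lp ?i l * z l) = (\<Sum>l<D. if l = ?i then of_nat (al ?i) * z ?i else 0)"
    proof (rule sum.cong[OF refl])
      fix l assume "l \<in> {..<D}"
      then show "Lp ?i l * z l = (if l = ?i then of_nat (al ?i) * z ?i else 0)"
        using later[of l] by (cases "?i < l") (auto simp: Lp_def)
    qed
    also have "\<dots> = of_nat (al ?i) * z ?i" using i by simp
    finally have "(\<Sum>l<D. Lp ?i l * z l) = of_nat (al ?i) * z ?i" .
    from this zeig[OF i] have "of_nat (al ?i) * z ?i = (of_nat (al j) - of_nat k) * z ?i"
      by (rule trans[OF sym])
    moreover have "of_nat (al ?i) \<noteq> (of_nat (al j) - of_nat k :: complex)"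
      using no i j by (metis of_nat_diff of_nat_eq_iff)
    ultimately show ?case by simp
  qed
  have zz: "z l = 0" if "l < D" for l using z0[of "D - Suc l"] that by simp
  have "(\<Sum>l<D. w l * y l) = (\<Sum>l<D. w l * U l j / of_nat k)"
    using zz by (intro sum.cong) (auto simp: z_def)
  also have "\<dots> = 1 / of_nat k" using wU[OF j(1)] by (simp flip: sum_divide_distrib)
  finally have 1: "(\<Sum>l<D. w l * y l) = 1 / of_nat k" .
  \<comment> \<open>By \<open>Q Y = Y Q\<close> the block of \<open>Q\<close> does not depend on the content above \<open>k\<close>.\<close>
  have shift: "g (int k + int t) l m = g (int k) l m" if "k + t \<le> al m" "m < D" "l < D" for t l m
    using that(1)
  proof (induction t)
    case (Suc t)
    have vm: "valid m (int k + int (Suc t))" using Suc that by (auto simp: valid_def)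
    have "g (int k + int (Suc t)) l m = g (int k + int t) l m"
    proof (cases "valid l (int t)")
      case True
      then show ?thesis using gy[of l "int k + int (Suc t)" m] vm by (simp add: algebra_simps)
    next
      case False
      then have "\<not> valid l (int (Suc t))" using that by (auto simp: valid_def)
      then show ?thesis using False gz[of l "int k + int (Suc t)" m] gz[of l "int k + int t" m] by simp
    qed
    then show ?case using Suc by simp
  qed simp
  have wg: "(\<Sum>l<D. w l * g c l m) * U m j = 0" if "m < D" for m
  proof (cases "U m j = 0")
    case False
    then have m: "al j \<le> al m" using tri al_mono j by blast
    have "(\<Sum>l<D. w l * g c l m) = (\<Sum>l<D. w l * g (int k) l m)"
      using shift[of "al j - k" m] m j that by (intro sum.cong refl) (auto simp: c_def)
    also have "\<dots> = 0" using kf m j that unfolding kills_framing_def by auto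
    finally show ?thesis by simp
  qed simp
  have "(\<Sum>l<D. w l * y l) = (\<Sum>m<D. (\<Sum>l<D. w l * g c l m) * U m j)"
    unfolding y_def by (simp add: sum_distrib_left sum_distrib_right mult.assoc) (rule sum.swap)
  also have "\<dots> = 0" by (rule sum.neutral) (use wg in blast)
  finally show False using 1 knz by simp
qed

lemma leg_condition_necessary:
  assumes "k \<ge> 1" "commutes_raises k g" "kills_framing k g" "j < D" "k \<le> p j"
  shows "\<exists>l<D. p l = p j - k"
  using frobenius.arm_condition_necessary[OF dual assms(1) commutes_raises_dual[OF assms(2)]
    kills_framing_dual[OF assms(3)] assms(4,5)] .

definition eigenvector_pair :: "(nat \<Rightarrow> nat \<Rightarrow> complex) \<Rightarrow> (nat \<Rightarrow> nat \<Rightarrow> complex) \<Rightarrow> bool" where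
  "eigenvector_pair U Ph \<longleftrightarrow>
    (\<forall>i j. U i j \<noteq> 0 \<longrightarrow> i \<le> j) \<and> (\<forall>j<D. U j j \<noteq> 0) \<and>
    (\<forall>i<D. \<forall>j<D. (\<Sum>l<D. Lp i l * U l j) = of_nat (al j) * U i j) \<and>
    (\<forall>j<D. (\<Sum>l<D. w l * U l j) = 1) \<and>
    (\<forall>i j. Ph i j \<noteq> 0 \<longrightarrow> j \<le> i) \<and> (\<forall>j<D. Ph j j \<noteq> 0) \<and>
    (\<forall>i<D. \<forall>j<D. (\<Sum>l<D. Ph i l * Lm l j) = of_nat (p i) * Ph i j) \<and>
    (\<forall>j<D. (\<Sum>l<D. Ph j l * v l) = 1) \<and>
    (\<forall>i<D. \<forall>j<D. (\<Sum>l<D. Ph i l * U l j) = 1 / of_nat (p i + al j + 1))"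

text \<open>
  In the matrix of \<open>v w = Lp + Lm + 1\<close> between a left eigenvector of
  \<open>Lm\<close> and a right eigenvector of \<open>Lp\<close>, the left side is 1 by
  normalization and the right side is \<open>p i + al j + 1\<close> times their pairing. So the
  pairings form a Cauchy matrix.
\<close>

lemma eigenvector_pair_exists: "\<exists>U Ph. eigenvector_pair U Ph"
proof -
  obtain U where U: "\<And>i j. U i j \<noteq> 0 \<Longrightarrow> i \<le> j" "\<And>j. j < D \<Longrightarrow> U j j \<noteq> 0"
    and eig: "\<And>i j. i < D \<Longrightarrow> j < D \<Longrightarrow> (\<Sum>l<D. Lp i l * U l j) = of_nat (al j) * U i j"
    and wU: "\<And>j. j < D \<Longrightarrow> (\<Sum>l<D. w l * U l j) = 1"
    using eigenvectors_Lp by blast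
  obtain V where V: "\<And>i j. V i j \<noteq> 0 \<Longrightarrow> i \<le> j" "\<And>j. j < D \<Longrightarrow> V j j \<noteq> (0::complex)"
    "\<And>i j. i < D \<Longrightarrow> j < D \<Longrightarrow> (\<Sum>l<D. Lm l i * V l j) = of_nat (p j) * V i j"
    "\<And>j. j < D \<Longrightarrow> (\<Sum>l<D. v l * V l j) = 1"
    using frobenius.eigenvectors_Lp[OF dual] unfolding Lp_dual by blast
  define Ph where "Ph i j = V j i" for i j
  have Pe: "(\<Sum>l<D. Ph i l * Lm l j) = of_nat (p i) * Ph i j" if "i < D" "j < D" for i j
    using V(3)[of j i] that by (simp add: Ph_def mult.commute)
  have Pv: "(\<Sum>l<D. Ph j l * v l) = 1" if "j < D" for j
    using V(4)[of j] that by (simp add: Ph_def mult.commute)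
  have "(\<Sum>l<D. Ph i l * U l j) = 1 / of_nat (p i + al j + 1)" if ij: "i < D" "j < D" for i j
  proof -
    let ?C = "\<Sum>l<D. Ph i l * U l j"
    have a: "(\<Sum>a<D. \<Sum>b<D. Ph i a * Lm a b * U b j) = of_nat (p i) * ?C"
    proof -
      have "(\<Sum>a<D. \<Sum>b<D. Ph i a * Lm a b * U b j) = (\<Sum>b<D. (\<Sum>a<D. Ph i a * Lm a b) * U b j)"
        by (simp add: sum_distrib_right) (rule sum.swap)
      also have "\<dots> = (\<Sum>b<D. of_nat (p i) * Ph i b * U b j)"
        using Pe ij by (intro sum.cong) auto
      finally show ?thesis by (simp add: sum_distrib_left mult.assoc)
    qed
    have b: "(\<Sum>a<D. \<Sum>b<D. Ph i a * Lp a b * U b j) = of_nat (al j) * ?C"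
    proof -
      have "(\<Sum>a<D. \<Sum>b<D. Ph i a * Lp a b * U b j) = (\<Sum>a<D. Ph i a * (\<Sum>b<D. Lp a b * U b j))"
        by (simp add: sum_distrib_left mult.assoc)
      also have "\<dots> = (\<Sum>a<D. of_nat (al j) * (Ph i a * U a j))"
        using eig ij by (intro sum.cong) auto
      finally show ?thesis by (simp add: sum_distrib_left)
    qed
    have c: "(\<Sum>a<D. \<Sum>b<D. Ph i a * (if a = b then 1 else 0) * U b j) = ?C"
      by (simp add: if_distrib[where f="\<lambda>x. x * _"] if_distrib[where f="\<lambda>x. _ * x"] cong: if_cong)
    have "1 = (\<Sum>a<D. Ph i a * v a) * (\<Sum>b<D. w b * U b j)" using Pv wU ij by simp
    also have "\<dots> = (\<Sum>a<D. \<Sum>b<D. Ph i a * (v a * w b) * U b j)"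
      by (simp add: sum_product mult.assoc)
    also have "\<dots> = (\<Sum>a<D. \<Sum>b<D. Ph i a * Lp a b * U b j + Ph i a * Lm a b * U b j
         + Ph i a * (if a = b then 1 else 0) * U b j)"
    proof (intro sum.cong refl)
      fix a b assume "a \<in> {..<D}" "b \<in> {..<D}"
      then have e: "v a * w b = Lp a b + Lm a b + (if a = b then 1 else 0)" using Lp_Lm by simp
      show "Ph i a * (v a * w b) * U b j = Ph i a * Lp a b * U b j + Ph i a * Lm a b * U b j
         + Ph i a * (if a = b then 1 else 0) * U b j"
        unfolding e by (simp only: algebra_simps)
    qed
    also have "\<dots> = of_nat (al j) * ?C + of_nat (p i) * ?C + ?C"
      by (simp only: sum.distrib a b c)
    finally have "of_nat (p i + al j + 1) * ?C = 1" by (simp add: algebra_simps)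
    then show ?thesis using hook_length_nz[of i j]
      by (metis nonzero_mult_div_cancel_left)
  qed
  then have "eigenvector_pair U Ph"
    unfolding eigenvector_pair_def using U eig wU V(1,2) Pe Pv by (simp add: Ph_def)
  then show ?thesis by blast
qed

text \<open>
  For \<open>k = p i + al j + 1\<close> the eigenvector for \<open>al j\<close> sits at a content
  where \<open>X\<close> kills it, and the left eigenvector for \<open>p i\<close> sits where it
  kills the image of \<open>X\<close>. Both terms of \<open>Q X - X Q\<close> vanish between them,
  but \<open>Y\<^sup>k\<^sup>-\<^sup>1\<close> gives a nonzero Cauchy entry.
\<close>

lemma hook_condition_necessary:
  assumes g: "commutes_raises k g" and ij: "i < D" "j < D"
  shows "k \<noteq> p i + al j + 1"
proof
  assume k: "k = p i + al j + 1"
  obtain U Ph where UP: "eigenvector_pair U Ph" using eigenvector_pair_exists by blast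
  note UP = UP[unfolded eigenvector_pair_def]
  have tri: "i \<le> j" if "U i j \<noteq> 0" for i j using UP that by blast
  have Ptri: "j \<le> i" if "Ph i j \<noteq> 0" for i j using UP that by blast
  have eig: "(\<Sum>l<D. Lp i l * U l j) = of_nat (al j) * U i j" if "i < D" "j < D" for i j
    using UP that by blast
  have Pe: "(\<Sum>l<D. Ph i l * Lm l j) = of_nat (p i) * Ph i j" if "i < D" "j < D" for i j
    using UP that by blast
  have C: "(\<Sum>l<D. Ph i l * U l j) = 1 / of_nat (p i + al j + 1)" if "i < D" "j < D" for i j
    using UP that by blast
  define c where "c = int (al j)"
  have ck: "c - int k = - int (p i) - 1" by (simp add: c_def k)
  have xU: "(\<Sum>m<D. xc l m c * U m j) = 0" if "l < D" for l
  proof -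
    have "(\<Sum>m<D. xc l m c * U m j) = (\<Sum>m<D. (if l = m then of_int c * U m j else 0) - Lp l m * U m j)"
      by (rule sum.cong) (auto simp: xc_def c_def algebra_simps)
    also have "\<dots> = of_int c * U l j - of_nat (al j) * U l j"
      using that eig[OF that ij(2)] by (simp add: sum_subtractf)
    finally show ?thesis by (simp add: c_def)
  qed
  have Px: "(\<Sum>m<D. Ph i m * xc m l (c - int k)) = 0" if "l < D" for l
  proof -
    have "(\<Sum>m<D. Ph i m * xc m l (c - int k))
        = (\<Sum>m<D. (if m = l then - of_nat (p i) * Ph i m else 0) + Ph i m * Lm m l)"
      by (rule sum.cong) (auto simp: xc_def ck algebra_simps)
    also have "\<dots> = - of_nat (p i) * Ph i l + of_nat (p i) * Ph i l"
      using that Pe[OF ij(1) that] by (simp add: sum.distrib)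
    finally show ?thesis by simp
  qed
  let ?E = "\<lambda>a b. (\<Sum>l<D. g (c + 1) a l * xc l b c) - (\<Sum>l<D. xc a l (c - int k) * g c l b)"
  have "(\<Sum>a<D. \<Sum>b<D. Ph i a * ?E a b * U b j) = (\<Sum>a<D. \<Sum>b<D. Ph i a * (if a = b then 1 else 0) * U b j)"
  proof (intro sum.cong refl)
    fix a b assume ab: "a \<in> {..<D}" "b \<in> {..<D}"
    show "Ph i a * ?E a b * U b j = Ph i a * (if a = b then 1 else 0) * U b j"
    proof (cases "Ph i a = 0 \<or> U b j = 0")
      case False
      then have "p i \<le> p a" "al j \<le> al b" using Ptri[of i a] tri[of b j] p_mono al_mono ij by auto
      then have "valid a (c - int k + 1)" "valid b c" using ab by (auto simp: valid_def c_def k)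
      then have "?E a b = (if a = b then 1 else 0)" using g unfolding commutes_raises_def by blast
      then show ?thesis by simp
    qed auto
  qed
  also have "\<dots> = 1 / of_nat (p i + al j + 1)"
    using C[OF ij] by (simp add: if_distrib[where f="\<lambda>x. x * _"] if_distrib[where f="\<lambda>x. _ * x"] cong: if_cong)
  also have "\<dots> \<noteq> 0" using hook_length_nz[of i j] by (metis divide_eq_0_iff one_neq_zero)
  finally have "(\<Sum>a<D. \<Sum>b<D. Ph i a * ?E a b * U b j) \<noteq> 0" .
  moreover have "(\<Sum>a<D. \<Sum>b<D. Ph i a * ?E a b * U b j)
    = (\<Sum>a<D. \<Sum>b<D. Ph i a * (\<Sum>l<D. g (c + 1) a l * xc l b c) * U b j)
    - (\<Sum>a<D. \<Sum>b<D. Ph i a * (\<Sum>l<D. xc a l (c - int k) * g c l b) * U b j)"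
    by (simp add: left_diff_distrib right_diff_distrib sum_subtractf)
  moreover have "\<dots> = 0" unfolding sum_sandwich using xU Px by simp
  ultimately show False by simp
qed

lemma eigenvector_pair_dual:
  assumes "eigenvector_pair U Ph"
  shows "frobenius.eigenvector_pair D al p w v (\<lambda>i j. Ph j i) (\<lambda>i j. U j i)"
  using assms unfolding eigenvector_pair_def frobenius.eigenvector_pair_def[OF dual] Lp_dual Lm_dual
  by (simp add: mult.commute add.commute)

text \<open>
  The solution of the Sylvester equation in the eigenbases.
\<close>

definition cauchy_quotient :: "nat \<Rightarrow> nat \<Rightarrow> nat \<Rightarrow> complex" where
  "cauchy_quotient k i j =
     1 / (of_nat (p i + al j + 1) * (of_nat k - of_nat (p i + al j + 1)))"

lemma cauchy_quotient_shift:
  assumes "k \<ge> 1" "k \<noteq> p i + al j + 1" "al j' + k = al j"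
  shows "cauchy_quotient k i j = (1 / of_nat (p i + al j + 1) - 1 / of_nat (p i + al j' + 1)) / of_nat k"
proof -
  define N where "N = p i + al j + 1"
  define N' where "N' = p i + al j' + 1"
  have N: "N = N' + k" using assms by (simp add: N_def N'_def)
  have nz: "of_nat N' \<noteq> (0::complex)" "of_nat k \<noteq> (0::complex)" "of_nat N' + of_nat k \<noteq> (0::complex)"
  proof -
    have "N' \<noteq> 0" "k \<noteq> 0" "N' + k \<noteq> 0" using assms(1) by (auto simp: N'_def)
    then show "of_nat N' \<noteq> (0::complex)" "of_nat k \<noteq> (0::complex)" "of_nat N' + of_nat k \<noteq> (0::complex)"
      by (metis of_nat_eq_0_iff of_nat_add)+
  qed
  show ?thesis
  proof -
    have "of_nat k - of_nat N = - (of_nat N' :: complex)" by (simp add: N)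
    moreover have "1 / (of_nat N' + of_nat k) - 1 / of_nat N' = - of_nat k / ((of_nat N' + of_nat k) * of_nat N' :: complex)"
      using nz by (simp add: field_simps)
    ultimately show ?thesis
      unfolding cauchy_quotient_def N_def[symmetric] N'_def[symmetric] using nz(2)
      by (simp add: N del: of_nat_add) (simp add: add.commute)
  qed
qed

text \<open>
  For \<open>al j \<ge> k\<close> the quotient of the Cauchy entries is a difference of two of
  them, so \<open>q\<close> maps the eigenvector \<open>u\<^sub>j\<close> to \<open>(u\<^sub>j -
  u\<^sub>l) / k\<close> with \<open>al l = al j - k\<close>. This gives the support of
  \<open>q\<close>, and the normalization gives \<open>w q = 0\<close> on these columns.
\<close>

lemma arm_half:
  assumes k: "k \<ge> 1" and UP: "eigenvector_pair U Ph"
    and arm: "\<And>j. j < D \<Longrightarrow> k \<le> al j \<Longrightarrow> \<exists>l<D. al l = al j - k"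
    and hook: "\<And>i j. i < D \<Longrightarrow> j < D \<Longrightarrow> k \<noteq> p i + al j + 1"
    and q: "\<And>i j. i < D \<Longrightarrow> j < D \<Longrightarrow>
       (\<Sum>a<D. \<Sum>b<D. Ph i a * q a b * U b j) = cauchy_quotient k i j"
  shows "\<And>i j. i < D \<Longrightarrow> j < D \<Longrightarrow> al i + k < al j \<Longrightarrow> q i j = 0"
    and "\<And>j. j < D \<Longrightarrow> k \<le> al j \<Longrightarrow> (\<Sum>a<D. w a * q a j) = 0"
proof -
  note UP' = UP[unfolded eigenvector_pair_def]
  have Ut: "i \<le> j" if "U i j \<noteq> 0" for i j using UP' that by blast
  have Ud: "U j j \<noteq> 0" if "j < D" for j using UP' that by blast
  have Pt: "j \<le> i" if "Ph i j \<noteq> 0" for i j using UP' that by blast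
  have Pd: "Ph j j \<noteq> 0" if "j < D" for j using UP' that by blast
  have wU: "(\<Sum>l<D. w l * U l j) = 1" if "j < D" for j using UP' that by blast
  have C: "(\<Sum>l<D. Ph i l * U l j) = 1 / of_nat (p i + al j + 1)" if "i < D" "j < D" for i j
    using UP' that by blast
  define s where "s a j = (\<Sum>b<D. q a b * U b j)" for a j
  have s: "s a j = (U a j - U a j') / of_nat k"
    if "a < D" "j < D" "j' < D" and shift: "al j' + k = al j" for a j j'
  proof -
    have "(\<Sum>l<D. (s l j - (U l j - U l j') / of_nat k) * Ph i l) = 0" if i: "i < D" for i
    proof -
      have "(\<Sum>l<D. s l j * Ph i l) = cauchy_quotient k i j"
        unfolding s_def q[OF i \<open>j < D\<close>, symmetric]
        by (simp add: sum_distrib_left sum_distrib_right mult_ac)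
      moreover have "(\<Sum>l<D. (U l j - U l j') / of_nat k * Ph i l)
          = ((\<Sum>l<D. Ph i l * U l j) - (\<Sum>l<D. Ph i l * U l j')) / of_nat k"
        by (simp add: sum_divide_distrib sum_subtractf[symmetric] algebra_simps diff_divide_distrib)
      ultimately show ?thesis
        using C[OF i \<open>j < D\<close>] C[OF i \<open>j' < D\<close>] cauchy_quotient_shift[OF k hook[OF i \<open>j < D\<close>] shift]
        by (simp add: left_diff_distrib sum_subtractf)
    qed
    from triangular_zero[where U = "\<lambda>l i. Ph i l" and N = D and D = D, OF _ _ _ this \<open>a < D\<close>] Pt Pd
    show ?thesis by simp
  qed
  show "q i j = 0" if ij: "i < D" "j < D" "al i + k < al j" for i j
  proof -
    have "(\<Sum>l<D. q i l * U l m) = 0" if m: "m < Suc j" for m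
    proof -
      have am: "al j \<le> al m" using al_mono[of m j] m ij by simp
      then obtain m' where m': "m' < D" "al m' + k = al m" using arm[of m] m ij by fastforce
      have "U i m = 0" using Ut[of i m] al_le_iff[of i m] am ij m by (meson leD le_trans less_Suc_eq_le le_less_trans linorder_not_le le_add1)
      moreover have "U i m' = 0"
      proof (rule ccontr)
        assume "U i m' \<noteq> 0"
        then have "al m' \<le> al i" using Ut al_mono m' by blast
        then show False using m' am ij by linarith
      qed
      ultimately show ?thesis using s[of i m m'] m m' ij unfolding s_def by simp
    qed
    from triangular_zero[where N = "Suc j" and D = D and U = U, OF Ut Ud _ this, of j] ij show ?thesis by simp
  qed
  show "(\<Sum>a<D. w a * q a j) = 0" if j: "j < D" "k \<le> al j" for j
  proof -
    have "(\<Sum>b<D. (\<Sum>a<D. w a * q a b) * U b m) = 0" if m: "m < Suc j" for m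
    proof -
      have am: "al j \<le> al m" using al_mono[of m j] m j by simp
      then obtain m' where m': "m' < D" "al m' + k = al m" using arm[of m] m j by fastforce
      have "(\<Sum>b<D. (\<Sum>a<D. w a * q a b) * U b m) = (\<Sum>a<D. w a * s a m)"
        unfolding s_def by (simp add: sum_distrib_left sum_distrib_right mult.assoc) (rule sum.swap)
      also have "\<dots> = (\<Sum>a<D. (w a * U a m - w a * U a m') / of_nat k)"
        using s[of _ m m'] m m' j by (intro sum.cong) (auto simp: algebra_simps)
      also have "\<dots> = 0" using wU[of m] wU[of m'] m m' j
        by (simp add: sum_subtractf flip: sum_divide_distrib)
      finally show ?thesis .
    qed
    from triangular_zero[where N = "Suc j" and D = D and U = U, OF Ut Ud _ this, of j] j show ?thesis by simp
  qed
qed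

text \<open>
  Prescribe \<open>q\<close> between the eigenbases by the quotients of the Cauchy entries. The
  boundary conditions for the arms are those for the legs of the dual data.
\<close>

lemma raising_matrix_exists:
  assumes k: "k \<ge> 1"
    and leg: "\<And>j. j < D \<Longrightarrow> k \<le> p j \<Longrightarrow> \<exists>l<D. p l = p j - k"
    and arm: "\<And>j. j < D \<Longrightarrow> k \<le> al j \<Longrightarrow> \<exists>l<D. al l = al j - k"
    and hook: "\<And>i j. i < D \<Longrightarrow> j < D \<Longrightarrow> k \<noteq> p i + al j + 1"
  shows "\<exists>q. (\<forall>i<D. \<forall>j<D. al i + k < al j \<longrightarrow> q i j = 0) \<and>
    (\<forall>j<D. k \<le> al j \<longrightarrow> (\<Sum>a<D. w a * q a j) = 0) \<and>
    (\<forall>i<D. \<forall>j<D. p j + k < p i \<longrightarrow> q i j = 0) \<and>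
    (\<forall>i<D. k \<le> p i \<longrightarrow> (\<Sum>a<D. q i a * v a) = 0) \<and>
    (\<forall>i<D. \<forall>j<D. (\<Sum>l<D. Lm i l * q l j) + (\<Sum>l<D. q i l * Lp l j)
        = (of_nat k - 1) * q i j - (if i = j then 1 else 0))"
proof -
  obtain U Ph where UP: "eigenvector_pair U Ph" using eigenvector_pair_exists by blast
  note UP' = UP[unfolded eigenvector_pair_def]
  have Ut: "i \<le> j" if "U i j \<noteq> 0" for i j using UP' that by blast
  have Ud: "U j j \<noteq> 0" if "j < D" for j using UP' that by blast
  have Ue: "(\<Sum>l<D. Lp i l * U l j) = of_nat (al j) * U i j" if "i < D" "j < D" for i j using UP' that by blast
  have Pt: "j \<le> i" if "Ph i j \<noteq> 0" for i j using UP' that by blast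
  have Pd: "Ph j j \<noteq> 0" if "j < D" for j using UP' that by blast
  have Pe: "(\<Sum>l<D. Ph i l * Lm l j) = of_nat (p i) * Ph i j" if "i < D" "j < D" for i j using UP' that by blast
  have C: "(\<Sum>l<D. Ph i l * U l j) = 1 / of_nat (p i + al j + 1)" if "i < D" "j < D" for i j
    using UP' that by blast
  have "\<exists>y. \<forall>i<D. (\<Sum>a<D. y a * Ph i a) = cauchy_quotient k i j" for j
    by (rule triangular_solve[where U = "\<lambda>l i. Ph i l"]) (use Pt Pd in auto)
  then obtain s where s: "\<And>i j. i < D \<Longrightarrow> (\<Sum>a<D. s j a * Ph i a) = cauchy_quotient k i j"
    by metis
  have "\<exists>y. \<forall>j<D. (\<Sum>b<D. y b * U b j) = s j a" for a
    by (rule triangular_solve) (use Ut Ud in auto)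
  then obtain q where q: "\<And>a j. j < D \<Longrightarrow> (\<Sum>b<D. q a b * U b j) = s j a" by metis
  have F: "(\<Sum>a<D. \<Sum>b<D. Ph i a * q a b * U b j) = cauchy_quotient k i j" if ij: "i < D" "j < D" for i j
  proof -
    have "(\<Sum>a<D. \<Sum>b<D. Ph i a * q a b * U b j) = (\<Sum>a<D. Ph i a * (\<Sum>b<D. q a b * U b j))"
      by (simp add: sum_distrib_left mult.assoc)
    then show ?thesis using s[OF ij(1)] q[OF ij(2)] by (simp add: mult.commute)
  qed
  have F': "(\<Sum>a<D. \<Sum>b<D. U a i * q b a * Ph j b) = frobenius.cauchy_quotient al p k i j"
    if ij: "i < D" "j < D" for i j
  proof -
    have "(\<Sum>a<D. \<Sum>b<D. U a i * q b a * Ph j b) = (\<Sum>b<D. \<Sum>a<D. Ph j b * q b a * U a i)"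
      by (subst sum.swap) (simp add: mult_ac)
    also have "\<dots> = cauchy_quotient k j i" using F ij by simp
    finally show ?thesis by (simp add: cauchy_quotient_def frobenius.cauchy_quotient_def[OF dual] add.commute)
  qed
  have hook': "k \<noteq> al i + p j + 1" if "i < D" "j < D" for i j using hook[OF that(2,1)] by simp
  have 1: "q i j = 0" if "i < D" "j < D" "al i + k < al j" for i j
    using arm_half(1)[where q = q, OF k UP arm hook F that] .
  have 2: "(\<Sum>a<D. w a * q a j) = 0" if "j < D" "k \<le> al j" for j
    using arm_half(2)[where q = q, OF k UP arm hook F that] .
  have 3: "q i j = 0" if "i < D" "j < D" "p j + k < p i" for i j
    using frobenius.arm_half(1)[OF dual k eigenvector_pair_dual[OF UP], where q = "\<lambda>a b. q b a",
        OF leg hook' F' that(2,1,3)] .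
  have 4: "(\<Sum>a<D. q i a * v a) = 0" if "i < D" "k \<le> p i" for i
    using frobenius.arm_half(2)[OF dual k eigenvector_pair_dual[OF UP], where q = "\<lambda>a b. q b a",
        OF leg hook' F' that] by (simp add: mult.commute)
  define E where "E a b = (\<Sum>l<D. Lm a l * q l b) + (\<Sum>l<D. q a l * Lp l b)
        - (of_nat k - 1) * q a b + (if a = b then 1 else 0)" for a b
  have E: "(\<Sum>b<D. (\<Sum>a<D. Ph i a * E a b) * U b j) = 0" if ij: "i < D" "j < D" for i j
  proof -
    have "(\<Sum>b<D. (\<Sum>a<D. Ph i a * E a b) * U b j) = (\<Sum>a<D. \<Sum>b<D. Ph i a * E a b * U b j)"
      by (simp add: sum_distrib_right) (rule sum.swap)
    also have "\<dots> = (\<Sum>a<D. \<Sum>b<D. Ph i a * (\<Sum>l<D. Lm a l * q l b) * U b j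
        + Ph i a * (\<Sum>l<D. q a l * Lp l b) * U b j
        - (of_nat k - 1) * (Ph i a * q a b * U b j) + Ph i a * (if a = b then 1 else 0) * U b j)"
      by (intro sum.cong refl) (simp add: E_def algebra_simps del: sum_distrib_left sum_distrib_right)
    also have "\<dots> = (\<Sum>l<D. (\<Sum>a<D. Ph i a * Lm a l) * (\<Sum>b<D. q l b * U b j))
        + (\<Sum>l<D. (\<Sum>a<D. Ph i a * q a l) * (\<Sum>b<D. Lp l b * U b j))
        - (of_nat k - 1) * cauchy_quotient k i j + 1 / of_nat (p i + al j + 1)"
      using F[OF ij] C[OF ij]
      by (simp add: sum.distrib sum_subtractf sum_sandwich if_distrib[where f="\<lambda>x. x * _"]
          if_distrib[where f="\<lambda>x. _ * x"] cong: if_cong flip: sum_distrib_left)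
    also have "(\<Sum>l<D. (\<Sum>a<D. Ph i a * Lm a l) * (\<Sum>b<D. q l b * U b j))
        = of_nat (p i) * cauchy_quotient k i j"
      using Pe[OF ij(1)] by (simp add: F[OF ij, symmetric] sum_distrib_left mult_ac)
    also have "(\<Sum>l<D. (\<Sum>a<D. Ph i a * q a l) * (\<Sum>b<D. Lp l b * U b j))
        = (\<Sum>l<D. \<Sum>a<D. of_nat (al j) * (Ph i a * q a l * U l j))"
      using Ue[OF _ ij(2)] by (simp add: sum_distrib_left sum_distrib_right mult_ac)
    also have "\<dots> = of_nat (al j) * cauchy_quotient k i j"
      by (subst sum.swap) (simp add: F[OF ij, symmetric] sum_distrib_left)
    also have "of_nat (p i) * cauchy_quotient k i j + of_nat (al j) * cauchy_quotient k i j
        - (of_nat k - 1) * cauchy_quotient k i j + 1 / of_nat (p i + al j + 1)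
      = 1 / of_nat (p i + al j + 1) - (of_nat k - of_nat (p i + al j + 1)) * cauchy_quotient k i j"
      by (simp add: algebra_simps)
    also have "\<dots> = 0"
    proof -
      have "of_nat k - of_nat (p i + al j + 1) \<noteq> (0::complex)"
        using hook[OF ij] by (metis eq_iff_diff_eq_0 of_nat_eq_iff)
      then show ?thesis unfolding cauchy_quotient_def using hook_length_nz[of i j] by simp
    qed
    finally show ?thesis .
  qed
  have E0: "E a b = 0" if ab: "a < D" "b < D" for a b
  proof -
    have "(\<Sum>a<D. E a b * Ph i a) = 0" if i: "i < D" for i
      using triangular_zero[where N = D and D = D and U = U and y = "\<lambda>b. \<Sum>a<D. Ph i a * E a b",
          OF Ut Ud _ E[OF i] ab(2)] by (simp add: mult.commute)
    from triangular_zero[where U = "\<lambda>l i. Ph i l" and N = D and D = D, OF _ _ _ this ab(1)] Pt Pd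
    show ?thesis by simp
  qed
  show ?thesis
  proof (intro exI[of _ q] conjI allI impI)
    show "(\<Sum>l<D. Lm i l * q l j) + (\<Sum>l<D. q i l * Lp l j)
        = (of_nat k - 1) * q i j - (if i = j then 1 else 0)" if "i < D" "j < D" for i j
      using E0[OF that] unfolding E_def by (simp add: algebra_simps)
  qed (use 1 2 3 4 in blast)+
qed

text \<open>
  A single matrix \<open>q\<close> on the hooks, cut off at the ends of the hooks, gives all
  blocks of \<open>Q\<close>. The support conditions make the truncations compatible with
  \<open>Y\<close>. On the contents from 0 to \<open>k - 1\<close> the relation with
  \<open>X\<close> is the Sylvester equation, and outside this range it follows from that equation
  because the rank one term vanishes.
\<close>

theorem commutes_raises_exists:
  assumes k: "k \<ge> 1"
    and leg: "\<And>j. j < D \<Longrightarrow> k \<le> p j \<Longrightarrow> \<exists>l<D. p l = p j - k"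
    and arm: "\<And>j. j < D \<Longrightarrow> k \<le> al j \<Longrightarrow> \<exists>l<D. al l = al j - k"
    and hook: "\<And>i j. i < D \<Longrightarrow> j < D \<Longrightarrow> k \<noteq> p i + al j + 1"
  shows "\<exists>g. commutes_raises k g"
proof -
  obtain q where q: "(\<forall>i<D. \<forall>j<D. al i + k < al j \<longrightarrow> q i j = 0) \<and>
    (\<forall>j<D. k \<le> al j \<longrightarrow> (\<Sum>a<D. w a * q a j) = 0) \<and>
    (\<forall>i<D. \<forall>j<D. p j + k < p i \<longrightarrow> q i j = 0) \<and>
    (\<forall>i<D. k \<le> p i \<longrightarrow> (\<Sum>a<D. q i a * v a) = 0) \<and>
    (\<forall>i<D. \<forall>j<D. (\<Sum>l<D. Lm i l * q l j) + (\<Sum>l<D. q i l * Lp l j)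
        = (of_nat k - 1) * q i j - (if i = j then 1 else 0))"
    using raising_matrix_exists[OF assms] by blast
  have q1: "q i j = 0" if "i < D" "j < D" "al i + k < al j" for i j using q that by blast
  have q2: "(\<Sum>a<D. w a * q a j) = 0" if "j < D" "k \<le> al j" for j using q that by blast
  have q3: "q i j = 0" if "i < D" "j < D" "p j + k < p i" for i j using q that by blast
  have q4: "(\<Sum>a<D. q i a * v a) = 0" if "i < D" "k \<le> p i" for i using q that by blast
  have q5: "(\<Sum>l<D. Lm i l * q l j) + (\<Sum>l<D. q i l * Lp l j)
        = (of_nat k - 1) * q i j - (if i = j then 1 else 0)" if "i < D" "j < D" for i j
    using q that by blast
  define g where "g c i j = (if valid i (c - int k) \<and> valid j c then q i j else 0)" for c i j
  have "commutes_raises k g"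
    unfolding commutes_raises_def
  proof (intro conjI allI impI)
    fix c i j assume "\<not> (valid i (c - int k) \<and> valid j c)"
    then show "g c i j = 0" by (auto simp: g_def)
  next
    fix c i j assume v: "valid i (c - 1 - int k)" "valid j c"
    show "g c i j = g (c - 1) i j"
    proof (cases "q i j = 0")
      case False
      then have "al j \<le> al i + k" "p i \<le> p j + k"
        using q1[of i j] q3[of i j] v by (auto simp: valid_def not_less[symmetric])
      then show ?thesis using v by (auto simp: g_def valid_def)
    qed (simp add: g_def)
  next
    fix c i j assume v: "valid i (c - int k + 1)" "valid j c"
    have ij: "i < D" "j < D" using v by (auto simp: valid_def)
    have "(\<Sum>l<D. g (c + 1) i l * xc l j c) = (\<Sum>l<D. q i l * xc l j c)"
    proof (rule sum.cong[OF refl])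
      fix l assume l: "l \<in> {..<D}"
      show "g (c + 1) i l * xc l j c = q i l * xc l j c"
      proof (cases "valid l (c + 1)")
        case True
        then show ?thesis using v by (simp add: g_def algebra_simps)
      next
        case False
        show ?thesis
        proof (cases "0 \<le> c")
          case True
          with False have "int (al l) \<le> c" using l by (auto simp: valid_def)
          moreover from this have "j \<le> l" using v al_le_iff[of j l] l by (auto simp: valid_def)
          ultimately have "xc l j c = 0" using True v by (auto simp: xc_def Lp_def valid_def)
          then show ?thesis by simp
        next
          case c: False
          then have "int (p l) < - c - 1" using False l by (auto simp: valid_def)
          then have "q i l = 0" using q3[of i l] v l by (auto simp: valid_def)
          then show ?thesis by (simp add: g_def)
        qed
      qed
    qed
    moreover have "(\<Sum>l<D. xc i l (c - int k) * g c l j) = (\<Sum>l<D. xc i l (c - int k) * q l j)"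
    proof (rule sum.cong[OF refl])
      fix l assume l: "l \<in> {..<D}"
      show "xc i l (c - int k) * g c l j = xc i l (c - int k) * q l j"
      proof (cases "valid l (c - int k)")
        case True
        then show ?thesis using v by (simp add: g_def)
      next
        case False
        show ?thesis
        proof (cases "int (al l) < c - int k")
          case True
          then have "q l j = 0" using q1[of l j] v l by (auto simp: valid_def)
          then show ?thesis by (simp add: g_def)
        next
          case c: False
          then have pl: "int (p l) < int k - c" using False l by (auto simp: valid_def)
          moreover from this have "i \<le> l" using v p_le_iff[of i l] l by (auto simp: valid_def)
          moreover have "c - int k = - int (p l) - 1" if "i = l"
            using v pl that by (auto simp: valid_def)
          ultimately have "xc i l (c - int k) = 0"
            by (cases "i = l") (auto simp: xc_def Lm_def)
          then show ?thesis by simp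
        qed
      qed
    qed
    moreover have "(\<Sum>l<D. q i l * xc l j c) - (\<Sum>l<D. xc i l (c - int k) * q l j)
         = (if i = j then 1 else 0)"
    proof -
      have A: "(\<Sum>l<D. q i l * xc l j c) = (if 0 \<le> c then of_int c * q i j - (\<Sum>l<D. q i l * Lp l j)
          else of_int (c + 1) * q i j + (\<Sum>l<D. q i l * Lm l j))"
      proof -
        have "(\<Sum>l<D. q i l * xc l j c) = (\<Sum>l<D. if 0 \<le> c then (if l = j then of_int c * q i j else 0) - q i l * Lp l j
          else (if l = j then of_int (c + 1) * q i j else 0) + q i l * Lm l j)"
          by (rule sum.cong) (auto simp: xc_def algebra_simps)
        then show ?thesis using ij by (simp add: sum_subtractf sum.distrib)
      qed
      have B: "(\<Sum>l<D. xc i l (c - int k) * q l j) = (if 0 \<le> c - int k then of_int (c - int k) * q i j - (\<Sum>l<D. Lp i l * q l j)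
          else of_int (c - int k + 1) * q i j + (\<Sum>l<D. Lm i l * q l j))"
      proof -
        have "(\<Sum>l<D. xc i l (c - int k) * q l j) = (\<Sum>l<D. if 0 \<le> c - int k then (if l = i then of_int (c - int k) * q i j else 0) - Lp i l * q l j
          else (if l = i then of_int (c - int k + 1) * q i j else 0) + Lm i l * q l j)"
          by (rule sum.cong) (auto simp: xc_def algebra_simps)
        then show ?thesis using ij by (simp add: sum_subtractf sum.distrib)
      qed
      have MP: "(\<Sum>l<D. Lp i l * q l j) = v i * (\<Sum>l<D. w l * q l j) - q i j - (\<Sum>l<D. Lm i l * q l j)"
      proof -
        have "(\<Sum>l<D. Lp i l * q l j) = (\<Sum>l<D. v i * (w l * q l j) - (if l = i then q i j else 0) - Lm i l * q l j)"
        proof (rule sum.cong[OF refl])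
          fix l assume "l \<in> {..<D}"
          then have e: "Lp i l = v i * w l - (if i = l then 1 else 0) - Lm i l"
            using Lp_Lm[of i l] ij by (simp add: algebra_simps)
          show "Lp i l * q l j = v i * (w l * q l j) - (if l = i then q i j else 0) - Lm i l * q l j"
            unfolding e by (auto simp: algebra_simps)
        qed
        then show ?thesis using ij by (simp add: sum_subtractf sum_distrib_left)
      qed
      have MQ: "(\<Sum>l<D. q i l * Lm l j) = (\<Sum>l<D. q i l * v l) * w j - q i j - (\<Sum>l<D. q i l * Lp l j)"
      proof -
        have "(\<Sum>l<D. q i l * Lm l j) = (\<Sum>l<D. (q i l * v l) * w j - (if l = j then q i j else 0) - q i l * Lp l j)"
        proof (rule sum.cong[OF refl])
          fix l assume "l \<in> {..<D}"
          then have e: "Lm l j = v l * w j - (if l = j then 1 else 0) - Lp l j"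
            using Lp_Lm[of l j] ij by (simp add: algebra_simps)
          show "q i l * Lm l j = (q i l * v l) * w j - (if l = j then q i j else 0) - q i l * Lp l j"
            unfolding e by (auto simp: algebra_simps)
        qed
        then show ?thesis using ij by (simp add: sum_subtractf sum_distrib_right)
      qed
      define S1 where "S1 = (\<Sum>l<D. Lm i l * q l j)"
      define S2 where "S2 = (\<Sum>l<D. q i l * Lp l j)"
      have q5': "S1 = (of_nat k - 1) * q i j - (if i = j then 1 else 0) - S2"
        using q5[OF ij] by (simp add: S1_def S2_def algebra_simps)
      consider "c \<ge> int k" | "0 \<le> c" "c < int k" | "c < 0" by linarith
      then show ?thesis
      proof cases
        case 1
        then have "(\<Sum>l<D. w l * q l j) = 0" using q2[of j] v by (auto simp: valid_def)
        then show ?thesis using 1 unfolding A B MP S1_def[symmetric] S2_def[symmetric] q5'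
          by (simp add: algebra_simps)
      next
        case 2
        then show ?thesis unfolding A B S1_def[symmetric] S2_def[symmetric] q5' by (simp add: algebra_simps)
      next
        case 3
        then have "(\<Sum>l<D. q i l * v l) = 0" using q4[of i] v by (auto simp: valid_def)
        then show ?thesis using 3 unfolding A B MQ S1_def[symmetric] S2_def[symmetric] q5' by (simp add: algebra_simps)
      qed
    qed
    ultimately show "(\<Sum>l<D. g (c + 1) i l * xc l j c) - (\<Sum>l<D. xc i l (c - int k) * g c l j)
         = (if i = j then 1 else 0)" by simp
  qed
  then show ?thesis by blast
qed

end

section \<open>Matrices graded by content\<close>

type_synonym cell = "nat \<times> int"
type_synonym cell_matrix = "cell \<Rightarrow> cell \<Rightarrow> complex"

text \<open>
  Cell-indexed matrices are functions; sums are pointwise, the product below is the matrix product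
  over the finite set of cells.
\<close>

definition scale :: "complex \<Rightarrow> cell_matrix \<Rightarrow> cell_matrix" where
  "scale a A = (\<lambda>r s. a * A r s)"

lemma scale_apply [simp]: "scale a A r s = a * A r s" by (simp add: scale_def)

lemma cell_matrix_eqI:
  assumes "\<And>i c j d. A (i, c) (j, d) = B (i, c) (j, d)" shows "A = (B :: cell_matrix)"
  using assms by (intro ext) auto

text \<open>
  The degree of the matrix unit at \<open>(r, s)\<close> is the content of \<open>s\<close> minus
  that of \<open>r\<close>.
\<close>

definition homogeneous :: "int \<Rightarrow> cell_matrix \<Rightarrow> bool" where
  "homogeneous e A \<longleftrightarrow> (\<forall>r s. A r s \<noteq> 0 \<longrightarrow> snd s - snd r = e)"

definition component :: "int \<Rightarrow> cell_matrix \<Rightarrow> cell_matrix" where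
  "component e A = (\<lambda>r s. if snd s - snd r = e then A r s else 0)"

lemma homogeneousD: "homogeneous e A \<Longrightarrow> A r s \<noteq> 0 \<Longrightarrow> snd s - snd r = e"
  unfolding homogeneous_def by blast
lemma homogeneous_component: "homogeneous e (component e A)"
  by (auto simp: homogeneous_def component_def)
lemma component_add: "component e (A + B) = component e A + component e B"
  by (auto simp: component_def fun_eq_iff)
lemma component_scale: "component e (scale a A) = scale a (component e A)"
  by (auto simp: component_def fun_eq_iff)
lemma component_zero: "component e 0 = 0"
  by (auto simp: component_def fun_eq_iff)
lemma component_sum: "component e (\<Sum>i\<in>I. f i) = (\<Sum>i\<in>I. component e (f i))"
  by (induction I rule: infinite_finite_induct)
    (simp_all only: sum.infinite sum.empty sum.insert not_False_eq_True component_add component_zero)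

lemma scale_simps:
  "scale a (A + B) = scale a A + scale a B" "scale a (A - B) = scale a A - scale a B"
  "scale (a + b) A = scale a A + scale b A" "scale a (scale b A) = scale (a * b) A"
  "scale 0 A = 0" "scale a 0 = 0" "scale 1 A = A" "scale (- a) A = - scale a A"
  by (auto simp: fun_eq_iff algebra_simps)
lemma scale_sum: "scale a (\<Sum>i\<in>I. f i) = (\<Sum>i\<in>I. scale a (f i))"
  by (induction I rule: infinite_finite_induct)
    (simp_all only: sum.infinite sum.empty sum.insert not_False_eq_True scale_simps)

context frobenius
begin

definition cells :: "cell set" where "cells = {(i, c). valid i c}"

lemma in_cells [simp]: "(i, c) \<in> cells \<longleftrightarrow> valid i c" by (simp add: cells_def)

lemma finite_cells: "finite cells"
proof -
  have "cells = (SIGMA i:{..<D}. {- int (p i)..int (al i)})" by (auto simp: cells_def valid_def)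
  then show ?thesis by simp
qed

definition supported :: "cell_matrix \<Rightarrow> bool" where
  "supported A \<longleftrightarrow> (\<forall>r s. A r s \<noteq> 0 \<longrightarrow> r \<in> cells \<and> s \<in> cells)"

lemma supportedD: "supported A \<Longrightarrow> r \<notin> cells \<or> s \<notin> cells \<Longrightarrow> A r s = 0"
  unfolding supported_def by blast

lemma supported_eqI:
  assumes "supported A" "supported B" "\<And>i c j d. valid i c \<Longrightarrow> valid j d \<Longrightarrow> A (i, c) (j, d) = B (i, c) (j, d)"
  shows "A = B"
proof (rule cell_matrix_eqI)
  fix i c j d
  show "A (i, c) (j, d) = B (i, c) (j, d)"
    using assms supportedD[of A "(i,c)" "(j,d)"] supportedD[of B "(i,c)" "(j,d)"]
    by (cases "valid i c \<and> valid j d") auto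
qed

definition mul :: "cell_matrix \<Rightarrow> cell_matrix \<Rightarrow> cell_matrix" (infixl "\<odot>" 70) where
  "A \<odot> B = (\<lambda>r s. \<Sum>t\<in>cells. A r t * B t s)"

lemma mul_assoc: "A \<odot> B \<odot> C = A \<odot> (B \<odot> C)"
proof (intro ext)
  fix r s
  show "(A \<odot> B \<odot> C) r s = (A \<odot> (B \<odot> C)) r s"
    by (simp add: mul_def sum_distrib_left sum_distrib_right mult.assoc) (rule sum.swap)
qed

lemma mul_distribs:
  "(A + B) \<odot> C = A \<odot> C + B \<odot> C" "C \<odot> (A + B) = C \<odot> A + C \<odot> B"
  "(A - B) \<odot> C = A \<odot> C - B \<odot> C" "C \<odot> (A - B) = C \<odot> A - C \<odot> B"
  "0 \<odot> C = 0" "C \<odot> 0 = 0" "(- A) \<odot> C = - (A \<odot> C)" "C \<odot> (- A) = - (C \<odot> A)"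
  "scale a A \<odot> C = scale a (A \<odot> C)" "C \<odot> scale a A = scale a (C \<odot> A)"
  by (auto simp: mul_def fun_eq_iff algebra_simps sum.distrib sum_subtractf sum_negf sum_distrib_left)

lemma mul_sum: "(\<Sum>i\<in>I. f i) \<odot> C = (\<Sum>i\<in>I. f i \<odot> C)" "C \<odot> (\<Sum>i\<in>I. f i) = (\<Sum>i\<in>I. C \<odot> f i)"
  by (induction I rule: infinite_finite_induct)
    (simp_all only: sum.infinite sum.empty sum.insert not_False_eq_True mul_distribs)

lemma supported_intros:
  "supported A \<Longrightarrow> supported B \<Longrightarrow> supported (A \<odot> B)"
  "supported A \<Longrightarrow> supported B \<Longrightarrow> supported (A + B)"
  "supported A \<Longrightarrow> supported B \<Longrightarrow> supported (A - B)"
  "supported A \<Longrightarrow> supported (scale a A)" "supported 0"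
  "supported A \<Longrightarrow> supported (component e A)"
proof -
  show "supported (A \<odot> B)" if "supported A" "supported B"
    unfolding supported_def
  proof (intro allI impI)
    fix r s assume "(A \<odot> B) r s \<noteq> 0"
    then obtain t where "A r t * B t s \<noteq> 0" unfolding mul_def by (meson sum.neutral)
    then show "r \<in> cells \<and> s \<in> cells" using that unfolding supported_def by (metis mult_zero_left mult_zero_right)
  qed
  show "supported (A + B)" if "supported A" "supported B"
    using that unfolding supported_def by (metis add.right_neutral plus_fun_apply)
  show "supported (A - B)" if "supported A" "supported B"
    using that unfolding supported_def by (metis cancel_comm_monoid_add_class.diff_cancel minus_apply)
qed (auto simp: supported_def component_def)

lemma supported_sum: "(\<And>i. i \<in> I \<Longrightarrow> supported (f i)) \<Longrightarrow> supported (\<Sum>i\<in>I. f i)"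
  by (induction I rule: infinite_finite_induct) (auto intro: supported_intros)

lemma component_mul_left: "homogeneous e B \<Longrightarrow> component d (B \<odot> A) = B \<odot> component (d - e) A"
  by (intro ext) (force simp: component_def mul_def homogeneous_def intro!: sum.cong sum.neutral)

lemma component_mul_right: "homogeneous e B \<Longrightarrow> component d (A \<odot> B) = component (d - e) A \<odot> B"
  by (intro ext) (force simp: component_def mul_def homogeneous_def intro!: sum.cong sum.neutral)

lemma homogeneous_mul: "homogeneous d A \<Longrightarrow> homogeneous e B \<Longrightarrow> homogeneous (d + e) (A \<odot> B)"
  unfolding homogeneous_def mul_def
proof (intro allI impI)
  fix r s
  assume A: "\<forall>r s. A r s \<noteq> 0 \<longrightarrow> snd s - snd r = d" and B: "\<forall>r s. B r s \<noteq> 0 \<longrightarrow> snd s - snd r = e"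
    and "(\<Sum>t\<in>cells. A r t * B t s) \<noteq> 0"
  then obtain t where "A r t * B t s \<noteq> 0" by (meson sum.neutral)
  then show "snd s - snd r = d + e" using A B by (smt (verit) mult_eq_0_iff)
qed

text \<open>
  The power \<open>Y\<^sup>m\<close> of the nilpotent matrix that lowers the content in every
  hook; \<open>Ysh 0\<close> is the unit.
\<close>

definition Ysh :: "nat \<Rightarrow> cell_matrix" where
  "Ysh m = (\<lambda>(i, c') (j, c). if valid i c' \<and> valid j c \<and> i = j \<and> c' = c - int m then 1 else 0)"

definition YY :: cell_matrix where "YY = Ysh 1"

definition XX :: cell_matrix where
  "XX = (\<lambda>(i, c') (j, c). if valid i c' \<and> valid j c \<and> c' = c + 1 then xc i j c else 0)"

text \<open>
  The rank one matrix \<open>X Y - Y X + 1\<close>.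
\<close>

definition MM :: cell_matrix where
  "MM = (\<lambda>(i, c') (j, c). if valid i c' \<and> valid j c \<and> c' = 0 \<and> c = 0 then v i * w j else 0)"

lemma Ysh_entry: "Ysh m (i, c') (j, c) = (if valid i c' \<and> valid j c \<and> i = j \<and> c' = c - int m then 1 else 0)"
  by (simp add: Ysh_def)
lemma XX_entry: "XX (i, c') (j, c) = (if valid i c' \<and> valid j c \<and> c' = c + 1 then xc i j c else 0)"
  by (simp add: XX_def)
lemma MM_entry: "MM (i, c') (j, c) = (if valid i c' \<and> valid j c \<and> c' = 0 \<and> c = 0 then v i * w j else 0)"
  by (simp add: MM_def)

lemma supported_basic: "supported (Ysh m)" "supported YY" "supported XX" "supported MM"
  by (auto simp: supported_def YY_def Ysh_entry XX_entry MM_entry)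

lemmas supported_rules = supported_intros supported_basic supported_sum

lemma homogeneous_basic: "homogeneous (int m) (Ysh m)" "homogeneous 1 YY" "homogeneous (- 1) XX" "homogeneous 0 MM"
  by (auto simp: homogeneous_def YY_def Ysh_entry XX_entry MM_entry split: if_splits)

lemma mul_Ysh: "supported A \<Longrightarrow> (A \<odot> Ysh m) r (j, c) = (if valid j c then A r (j, c - int m) else 0)"
proof -
  assume A: "supported A"
  have "(A \<odot> Ysh m) r (j, c) = (\<Sum>t\<in>cells. if t = (j, c - int m) then (if valid j c then A r t else 0) else 0)"
    unfolding mul_def by (rule sum.cong) (auto simp: Ysh_entry split: if_splits)
  then show ?thesis using finite_cells supportedD[OF A, of r "(j, c - int m)"] by auto
qed

lemma Ysh_mul: "supported A \<Longrightarrow> (Ysh m \<odot> A) (i, c) s = (if valid i c then A (i, c + int m) s else 0)"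
proof -
  assume A: "supported A"
  have "(Ysh m \<odot> A) (i, c) s = (\<Sum>t\<in>cells. if t = (i, c + int m) then (if valid i c then A t s else 0) else 0)"
    unfolding mul_def by (rule sum.cong) (auto simp: Ysh_entry split: if_splits)
  then show ?thesis using finite_cells supportedD[OF A, of "(i, c + int m)" s] by auto
qed

lemma sum_cells_column:
  assumes "\<And>i c'. c' \<noteq> c \<Longrightarrow> f (i, c') = 0" "\<And>i. \<not> valid i c \<Longrightarrow> f (i, c) = 0"
  shows "(\<Sum>t\<in>cells. f t) = (\<Sum>l<D. (f (l, c) :: complex))"
proof -
  have "(\<Sum>t\<in>cells. f t) = (\<Sum>t\<in>{t \<in> cells. snd t = c}. f t)"
  proof (rule sum.mono_neutral_right[OF finite_cells])
    have "f t = 0" if "snd t \<noteq> c" for t using assms(1)[of "snd t" "fst t"] that by simp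
    then show "\<forall>t\<in>cells - {t \<in> cells. snd t = c}. f t = 0" by blast
  qed auto
  also have "{t \<in> cells. snd t = c} = (\<lambda>l. (l, c)) ` {l. valid l c}" by (auto simp: image_iff)
  also have "(\<Sum>t\<in>\<dots>. f t) = (\<Sum>l\<in>{l. valid l c}. f (l, c))"
    by (subst sum.reindex) (auto simp: inj_on_def)
  also have "\<dots> = (\<Sum>l<D. f (l, c))"
    using assms(2) by (intro sum.mono_neutral_left) (auto simp: valid_def)
  finally show ?thesis .
qed

lemma mul_XX: "supported A \<Longrightarrow>
  (A \<odot> XX) r (j, c) = (if valid j c then \<Sum>l<D. A r (l, c + 1) * xc l j c else 0)"
proof -
  assume A: "supported A"
  have "(A \<odot> XX) r (j, c) = (\<Sum>l<D. A r (l, c + 1) * XX (l, c + 1) (j, c))"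
    unfolding mul_def by (rule sum_cells_column) (auto simp: XX_entry)
  also have "\<dots> = (\<Sum>l<D. if valid j c then A r (l, c + 1) * xc l j c else 0)"
    using supportedD[OF A, of r "(_, c + 1)"] by (intro sum.cong) (auto simp: XX_entry)
  finally show ?thesis by simp
qed

lemma XX_mul: "supported A \<Longrightarrow>
  (XX \<odot> A) (i, c) s = (if valid i c then \<Sum>l<D. xc i l (c - 1) * A (l, c - 1) s else 0)"
proof -
  assume A: "supported A"
  have "(XX \<odot> A) (i, c) s = (\<Sum>l<D. XX (i, c) (l, c - 1) * A (l, c - 1) s)"
    unfolding mul_def by (rule sum_cells_column) (auto simp: XX_entry)
  also have "\<dots> = (\<Sum>l<D. if valid i c then xc i l (c - 1) * A (l, c - 1) s else 0)"
    using supportedD[OF A, of "(_, c - 1)" s] by (intro sum.cong) (auto simp: XX_entry)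
  finally show ?thesis by simp
qed

lemma Ysh_Ysh: "Ysh m \<odot> Ysh l = Ysh (m + l)"
  by (rule cell_matrix_eqI) (auto simp: mul_Ysh supported_basic Ysh_entry valid_def)

lemma YY_powers: "YY \<odot> Ysh m = Ysh (Suc m)" "Ysh m \<odot> YY = Ysh (Suc m)"
  by (simp_all add: YY_def Ysh_Ysh)

lemma YY_Ysh_mul: "YY \<odot> (Ysh m \<odot> A) = Ysh (Suc m) \<odot> A"
  by (simp only: mul_assoc[symmetric] YY_powers)

lemma mul_YY: "supported A \<Longrightarrow> (A \<odot> YY) r (j, c) = (if valid j c then A r (j, c - 1) else 0)"
  by (simp add: YY_def mul_Ysh)

lemma YY_mul: "supported A \<Longrightarrow> (YY \<odot> A) (i, c) s = (if valid i c then A (i, c + 1) s else 0)"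
  by (simp add: YY_def Ysh_mul)

lemma unit_mul: "supported A \<Longrightarrow> Ysh 0 \<odot> A = A" "supported A \<Longrightarrow> A \<odot> Ysh 0 = A"
  by (auto intro!: supported_eqI supported_rules simp: mul_Ysh Ysh_mul)

text \<open>
  Dropping the nonexistent cell beyond the end of an arm loses nothing, as the coefficient there
  vanishes: on the diagonal because \<open>c\<close> is the arm length, elsewhere by
  triangularity.
\<close>

lemma xc_top: "valid j c \<Longrightarrow> valid i c \<Longrightarrow> \<not> valid i (c + 1) \<Longrightarrow> xc i j c = 0"
proof -
  assume a: "valid j c" "valid i c" "\<not> valid i (c + 1)"
  then have c: "c = int (al i)" by (auto simp: valid_def)
  then have "j \<le> i" using a al_le_iff[of j i] by (auto simp: valid_def)
  then show ?thesis using c by (auto simp: xc_def Lp_def)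
qed

lemma xc_bottom: "valid i (c + 1) \<Longrightarrow> valid j (c + 1) \<Longrightarrow> \<not> valid j c \<Longrightarrow> xc i j c = 0"
proof -
  assume a: "valid i (c + 1)" "valid j (c + 1)" "\<not> valid j c"
  then have c: "c = - int (p j) - 1" by (auto simp: valid_def)
  then have "i \<le> j" using a p_le_iff[of i j] by (auto simp: valid_def)
  then show ?thesis using c by (auto simp: xc_def Lm_def)
qed

lemma commutator_relation: "XX \<odot> YY - YY \<odot> XX + Ysh 0 = MM"
proof (rule supported_eqI)
  fix i c j d assume v: "valid i c" "valid j d"
  have 1: "(XX \<odot> YY) (i, c) (j, d) = (if c = d then xc i j (c - 1) else 0)"
    using v xc_bottom[of i "c - 1" j] by (auto simp: mul_YY supported_basic XX_entry)
  have 2: "(YY \<odot> XX) (i, c) (j, d) = (if c = d then xc i j c else 0)"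
    using v xc_top[of j c i] by (auto simp: YY_mul supported_basic XX_entry)
  have 3: "xc i j (c - 1) - xc i j c + (if i = j then 1 else 0) = (if c = 0 then v i * w j else 0)"
    using v Lp_Lm[of i j] by (auto simp: xc_def valid_def add_ac)
  show "(XX \<odot> YY - YY \<odot> XX + Ysh 0) (i, c) (j, d) = MM (i, c) (j, d)"
    using 3 v by (auto simp: 1 2 Ysh_entry MM_entry)
qed (auto intro!: supported_rules)

lemma Ysh_nilpotent: "\<exists>N. \<forall>m\<ge>N. Ysh m = 0"
proof -
  define N where "N = Max (insert 0 ((\<lambda>i. p i + al i + 1) ` {..<D}))"
  have "Ysh m = 0" if "m \<ge> N" for m
  proof (rule supported_eqI)
    fix i c j d assume v: "valid i c" "valid j d"
    then have "p i + al i + 1 \<le> N" unfolding N_def by (intro Max_ge) (auto simp: valid_def)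
    with that v show "Ysh m (i, c) (j, d) = 0 (i, c) (j, d)" by (auto simp: Ysh_entry valid_def)
  qed (auto intro: supported_rules)
  then show ?thesis by blast
qed

lemma commutes_with_powers:
  assumes "supported A" "A \<odot> YY = YY \<odot> A" shows "A \<odot> Ysh m = Ysh m \<odot> A"
proof (induction m)
  case 0 then show ?case using assms by (simp add: unit_mul)
next
  case (Suc m)
  have Y: "Ysh (Suc m) = YY \<odot> Ysh m" by (simp add: YY_powers)
  have "A \<odot> Ysh (Suc m) = YY \<odot> (A \<odot> Ysh m)"
    by (simp only: Y mul_assoc[symmetric] assms)
  also have "\<dots> = Ysh (Suc m) \<odot> A" by (simp only: Y Suc mul_assoc)
  finally show ?case .
qed

text \<open>
  On the image of \<open>Z\<close> the matrices satisfy the Heisenberg relation \<open>X Y - Y X =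
  -1\<close>, which gives \<open>X Y\<^sup>k Z = Y\<^sup>k X Z - k Y\<^sup>k\<^sup>-\<^sup>1
  Z\<close>. As \<open>Y\<close> is nilpotent, \<open>Y\<^sup>k Z = 0\<close> follows downwards to
  \<open>k = 0\<close>.
\<close>

lemma schur_zero:
  assumes Z: "supported Z" and ZX: "Z \<odot> XX = XX \<odot> Z" and ZY: "Z \<odot> YY = YY \<odot> Z"
    and MZ: "MM \<odot> Z = 0"
  shows "Z = 0"
proof -
  have XY: "XX \<odot> YY = YY \<odot> XX + MM - Ysh 0"
    by (simp flip: commutator_relation)
  have comm: "XX \<odot> (Ysh k \<odot> Z) = Ysh k \<odot> (XX \<odot> Z) - scale (of_nat k) (Ysh (k - 1) \<odot> Z)" for k
  proof (induction k)
    case 0 then show ?case using Z by (simp add: unit_mul supported_rules scale_simps)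
  next
    case (Suc k)
    have "XX \<odot> (Ysh (Suc k) \<odot> Z) = XX \<odot> YY \<odot> (Ysh k \<odot> Z)"
      by (simp only: mul_assoc YY_Ysh_mul)
    also have "\<dots> = YY \<odot> (XX \<odot> (Ysh k \<odot> Z)) + MM \<odot> (Ysh k \<odot> Z) - Ysh k \<odot> Z"
      unfolding XY using Z by (simp add: mul_distribs mul_assoc unit_mul supported_rules)
    also have "MM \<odot> (Ysh k \<odot> Z) = 0"
      by (simp only: commutes_with_powers[OF Z ZY, symmetric] mul_assoc[symmetric] MZ mul_distribs)
    also have "YY \<odot> (XX \<odot> (Ysh k \<odot> Z)) = Ysh (Suc k) \<odot> (XX \<odot> Z) - scale (of_nat k) (Ysh k \<odot> Z)"
      unfolding Suc by (cases k) (simp_all add: mul_distribs YY_Ysh_mul scale_simps)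
    finally show ?case by (simp add: scale_simps algebra_simps)
  qed
  obtain N where N: "\<And>m. m \<ge> N \<Longrightarrow> Ysh m = 0" using Ysh_nilpotent by blast
  have "Ysh (N - k) \<odot> Z = 0" for k
  proof (induction k)
    case 0 then show ?case by (simp only: diff_zero N[OF order_refl] mul_distribs)
  next
    case (Suc k)
    show ?case
    proof (cases "k < N")
      case True
      then obtain t where t: "N - k = Suc t" by (metis Suc_diff_Suc)
      have YZ: "Ysh (Suc t) \<odot> Z = 0" using Suc unfolding t .
      have "Ysh (Suc t) \<odot> (XX \<odot> Z) = Ysh (Suc t) \<odot> Z \<odot> XX" by (simp only: ZX mul_assoc)
      then have "Ysh (Suc t) \<odot> (XX \<odot> Z) = 0" by (simp only: YZ mul_distribs)
      then have "scale (of_nat (Suc t)) (Ysh t \<odot> Z) = 0"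
        using comm[of "Suc t"] unfolding YZ by (simp add: mul_distribs)
      then have "Ysh t \<odot> Z = 0" by (simp add: fun_eq_iff del: of_nat_Suc)
      moreover have "N - Suc k = t" using t by simp
      ultimately show ?thesis by simp
    qed (use Suc in simp)
  qed
  from this[of N] show ?thesis using Z by (simp add: unit_mul)
qed

lemma MM_mul: "supported A \<Longrightarrow>
  (MM \<odot> A) (i, c) s = (if i < D \<and> c = 0 then v i * (\<Sum>l<D. w l * A (l, 0) s) else 0)"
proof -
  assume A: "supported A"
  have "(MM \<odot> A) (i, c) s = (\<Sum>l<D. MM (i, c) (l, 0) * A (l, 0) s)"
    unfolding mul_def by (rule sum_cells_column) (auto simp: MM_entry)
  also have "\<dots> = (\<Sum>l<D. if i < D \<and> c = 0 then v i * (w l * A (l, 0) s) else 0)"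
    by (intro sum.cong) (auto simp: MM_entry valid_def)
  finally show ?thesis by (cases "i < D"; cases "c = 0") (simp_all add: sum_distrib_left)
qed

lemma mul_MM: "supported A \<Longrightarrow>
  (A \<odot> MM) r (j, c) = (if j < D \<and> c = 0 then (\<Sum>l<D. A r (l, 0) * v l) * w j else 0)"
proof -
  assume A: "supported A"
  have "(A \<odot> MM) r (j, c) = (\<Sum>l<D. A r (l, 0) * MM (l, 0) (j, c))"
    unfolding mul_def by (rule sum_cells_column) (auto simp: MM_entry)
  also have "\<dots> = (\<Sum>l<D. if j < D \<and> c = 0 then A r (l, 0) * v l * w j else 0)"
    by (intro sum.cong) (auto simp: MM_entry valid_def)
  finally show ?thesis by (cases "j < D"; cases "c = 0") (simp_all add: sum_distrib_right)
qed

text \<open>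
  A matrix commuting with \<open>X\<close> and \<open>Y\<close> commutes with the rank one matrix
  \<open>MM\<close>, hence acts on it by a scalar. After subtracting this scalar, the previous
  lemma applies.
\<close>

lemma schur:
  assumes D: "D > 0" and Z: "supported Z" and ZX: "Z \<odot> XX = XX \<odot> Z" and ZY: "Z \<odot> YY = YY \<odot> Z"
  shows "\<exists>a. Z = scale a (Ysh 0)"
proof -
  have MZ: "MM \<odot> Z = Z \<odot> MM"
  proof -
    have "Z \<odot> (XX \<odot> YY) = XX \<odot> (Z \<odot> YY)" by (simp only: mul_assoc[symmetric] ZX)
    then have "Z \<odot> (XX \<odot> YY) = XX \<odot> YY \<odot> Z" by (simp only: ZY mul_assoc)
    moreover have "Z \<odot> (YY \<odot> XX) = YY \<odot> (Z \<odot> XX)" by (simp only: mul_assoc[symmetric] ZY)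
    then have "Z \<odot> (YY \<odot> XX) = YY \<odot> XX \<odot> Z" by (simp only: ZX mul_assoc)
    ultimately show ?thesis using Z unfolding commutator_relation[symmetric]
      by (simp add: mul_distribs unit_mul)
  qed
  define b where "b i = (\<Sum>l<D. Z (i, 0) (l, 0) * v l)" for i
  define a where "a = b 0 / v 0"
  have a: "(\<Sum>l<D. w l * Z (l, 0) (j, c)) = (if c = 0 then a * w j else 0)" if j: "j < D" for j c
  proof -
    have "(MM \<odot> Z) (0, 0) (j, c) = (Z \<odot> MM) (0, 0) (j, c)" by (simp only: MZ)
    then have "v 0 * (\<Sum>l<D. w l * Z (l, 0) (j, c)) = (if c = 0 then b 0 * w j else 0)"
      using j D unfolding MM_mul[OF Z] mul_MM[OF Z] b_def by simp
    moreover have "v 0 * (if c = 0 then a * w j else 0) = (if c = 0 then b 0 * w j else 0)"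
      using v_nz[OF D] by (simp add: a_def)
    ultimately have "v 0 * (\<Sum>l<D. w l * Z (l, 0) (j, c)) = v 0 * (if c = 0 then a * w j else 0)"
      by (simp only:)
    then show ?thesis by (simp only: mult_left_cancel[OF v_nz[OF D]])
  qed
  have "MM \<odot> Z = scale a MM"
  proof (rule supported_eqI)
    fix i c j d assume "valid i c" "valid j d"
    then show "(MM \<odot> Z) (i, c) (j, d) = scale a MM (i, c) (j, d)"
      using a[of j d] unfolding MM_mul[OF Z] scale_apply MM_entry by (simp add: valid_def)
  qed (auto intro!: supported_rules Z)
  then have z1: "MM \<odot> (Z - scale a (Ysh 0)) = 0"
    by (simp add: mul_distribs unit_mul supported_rules)
  have z2: "(Z - scale a (Ysh 0)) \<odot> XX = XX \<odot> (Z - scale a (Ysh 0))"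
    by (simp add: mul_distribs unit_mul supported_rules ZX)
  have z3: "(Z - scale a (Ysh 0)) \<odot> YY = YY \<odot> (Z - scale a (Ysh 0))"
    by (simp add: mul_distribs unit_mul supported_rules ZY)
  have "Z - scale a (Ysh 0) = 0"
    by (rule schur_zero[OF _ z2 z3 z1]) (intro supported_rules Z)
  then have "Z = scale a (Ysh 0)" by (simp only: right_minus_eq)
  then show ?thesis by blast
qed

text \<open>
  The infinitesimal form of the conjugation that adds a multiple of \<open>Y\<^sup>m\<close> to
  \<open>X\<close>.
\<close>

definition raiser :: "nat \<Rightarrow> cell_matrix \<Rightarrow> bool" where
  "raiser m Q \<longleftrightarrow> supported Q \<and> homogeneous (int m + 1) Q \<and> Q \<odot> YY = YY \<odot> Q
     \<and> Q \<odot> XX - XX \<odot> Q = Ysh m"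

definition admissible :: "nat \<Rightarrow> bool" where
  "admissible k \<longleftrightarrow> (\<forall>j<D. k \<le> p j \<longrightarrow> (\<exists>l<D. p l = p j - k)) \<and>
     (\<forall>j<D. k \<le> al j \<longrightarrow> (\<exists>l<D. al l = al j - k)) \<and>
     (\<forall>i<D. \<forall>j<D. k \<noteq> p i + al j + 1)"

text \<open>
  The remaining ingredient is that \<open>Q\<close> commutes with \<open>MM\<close>, by the Jacobi
  identity. Since \<open>Q\<close> has nonzero degree, both products vanish.
\<close>

lemma raiser_admissible:
  assumes "raiser m Q" shows "admissible (Suc m)"
proof -
  note r = assms[unfolded raiser_def]
  have Q: "supported Q" and QY: "Q \<odot> YY = YY \<odot> Q" and QX: "Q \<odot> XX - XX \<odot> Q = Ysh m"
    using r by auto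
  define k where "k = Suc m"
  define g where "g c i j = Q (i, c - int k) (j, c)" for c i j
  have "commutes_raises k g"
    unfolding commutes_raises_def
  proof (intro conjI allI impI)
    fix c i j assume "\<not> (valid i (c - int k) \<and> valid j c)"
    then show "g c i j = 0" unfolding g_def by (intro supportedD[OF Q]) auto
  next
    fix c i j assume "valid i (c - 1 - int k)" "valid j c"
    moreover have "(Q \<odot> YY) (i, c - 1 - int k) (j, c) = (YY \<odot> Q) (i, c - 1 - int k) (j, c)"
      using QY by simp
    ultimately show "g c i j = g (c - 1) i j"
      by (simp add: mul_YY[OF Q] YY_mul[OF Q] g_def algebra_simps)
  next
    fix c i j assume v: "valid i (c - int k + 1)" "valid j c"
    have "(Q \<odot> XX - XX \<odot> Q) (i, c - int k + 1) (j, c) = Ysh m (i, c - int k + 1) (j, c)"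
      using QX by simp
    then show "(\<Sum>l<D. g (c + 1) i l * xc l j c) - (\<Sum>l<D. xc i l (c - int k) * g c l j)
         = (if i = j then 1 else 0)"
      using v by (simp add: mul_XX[OF Q] XX_mul[OF Q] g_def Ysh_entry k_def algebra_simps)
  qed
  moreover have "kills_framing k g"
  proof -
    have QM: "Q \<odot> MM = MM \<odot> Q"
    proof -
      have QX': "Q \<odot> XX = XX \<odot> Q + Ysh m" using QX by (simp add: algebra_simps)
      have "Q \<odot> (XX \<odot> YY) = XX \<odot> (Q \<odot> YY) + Ysh (Suc m)"
        by (simp add: mul_assoc[symmetric] QX' mul_distribs YY_powers)
      moreover have "Q \<odot> (YY \<odot> XX) = YY \<odot> (XX \<odot> Q) + Ysh (Suc m)"
      proof -
        have "Q \<odot> (YY \<odot> XX) = YY \<odot> (Q \<odot> XX)" by (simp only: mul_assoc[symmetric] QY)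
        then show ?thesis by (simp add: QX' mul_distribs YY_powers)
      qed
      ultimately show ?thesis unfolding commutator_relation[symmetric] using Q
        by (simp add: mul_distribs unit_mul mul_assoc QY)
    qed
    have e: "(MM \<odot> Q) (i, c) (j, d) = (Q \<odot> MM) (i, c) (j, d)" for i c j d using QM by simp
    show ?thesis unfolding kills_framing_def
    proof (intro conjI allI impI)
      fix j assume "j < D" "k \<le> al j"
      then show "(\<Sum>l<D. w l * g (int k) l j) = 0"
        using e[of 0 0 j "int k"] v_nz[of 0] by (simp add: MM_mul[OF Q] mul_MM[OF Q] g_def k_def)
    next
      fix i assume "i < D" "k \<le> p i"
      then show "(\<Sum>l<D. g 0 i l * v l) = 0"
        using e[of i "- int k" 0 0] w_nz[of 0] by (simp add: MM_mul[OF Q] mul_MM[OF Q] g_def k_def)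
    qed
  qed
  moreover have "k \<ge> 1" by (simp add: k_def)
  ultimately have g: "commutes_raises k g" "kills_framing k g" "k \<ge> 1" by blast+
  show ?thesis unfolding admissible_def k_def[symmetric]
  proof (intro conjI allI impI)
    show "\<exists>l<D. p l = p j - k" if "j < D" "k \<le> p j" for j
      by (rule leg_condition_necessary[OF g(3,1,2) that])
    show "\<exists>l<D. al l = al j - k" if "j < D" "k \<le> al j" for j
      by (rule arm_condition_necessary[OF g(3,1,2) that])
    show "k \<noteq> p i + al j + 1" if "i < D" "j < D" for i j
      by (rule hook_condition_necessary[OF g(1) that])
  qed
qed

lemma admissible_raiser:
  assumes "admissible (Suc m)" shows "\<exists>Q. raiser m Q"
proof -
  define k where "k = Suc m"
  obtain g where g: "commutes_raises k g"
    using commutes_raises_exists[of k] assms unfolding admissible_def k_def by force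
  have gz: "g c i j = 0" if "\<not> (valid i (c - int k) \<and> valid j c)" for c i j
    using g that unfolding commutes_raises_def by blast
  have gy: "g c i j = g (c - 1) i j" if "valid i (c - 1 - int k)" "valid j c" for c i j
    using g that unfolding commutes_raises_def by blast
  have gx: "(\<Sum>l<D. g (c + 1) i l * xc l j c) - (\<Sum>l<D. xc i l (c - int k) * g c l j)
          = (if i = j then 1 else 0)" if "valid i (c - int k + 1)" "valid j c" for c i j
    using g that unfolding commutes_raises_def by blast
  define Q :: cell_matrix where "Q = (\<lambda>(i, c') (j, c). if c' = c - int k then g c i j else 0)"
  have Qe: "Q (i, c') (j, c) = (if c' = c - int k then g c i j else 0)" for i j c c' by (simp add: Q_def)
  have Q: "supported Q" using gz by (auto simp: supported_def Qe split: if_splits)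
  have "homogeneous (int m + 1) Q" by (auto simp: homogeneous_def Q_def k_def split: if_splits)
  moreover have "Q \<odot> YY = YY \<odot> Q"
  proof (rule supported_eqI)
    fix i c j d assume v: "valid i c" "valid j d"
    show "(Q \<odot> YY) (i, c) (j, d) = (YY \<odot> Q) (i, c) (j, d)"
    proof (cases "c + 1 = d - int k")
      case True
      then have c: "c = d - 1 - int k" by simp
      from gy[of i d j] v have "g d i j = g (d - 1) i j" unfolding c by blast
      then show ?thesis using v unfolding mul_YY[OF Q] YY_mul[OF Q] Qe c by simp
    next
      case False
      then have "c \<noteq> d - 1 - int k" by simp
      with False show ?thesis using v unfolding mul_YY[OF Q] YY_mul[OF Q] Qe by simp
    qed
  qed (auto intro!: supported_rules Q)
  moreover have "Q \<odot> XX - XX \<odot> Q = Ysh m"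
  proof (rule supported_eqI)
    fix i c j d assume v: "valid i c" "valid j d"
    show "(Q \<odot> XX - XX \<odot> Q) (i, c) (j, d) = Ysh m (i, c) (j, d)"
    proof (cases "c = d - int k + 1")
      case True
      then have c: "c - 1 = d - int k" and c': "(c = d + 1 - int k) \<longleftrightarrow> True" by simp_all
      have "(\<Sum>l<D. g (d + 1) i l * xc l j d) - (\<Sum>l<D. xc i l (d - int k) * g d l j)
          = (if i = j then 1 else 0)" using gx[of i d j] v unfolding True by blast
      then have "(Q \<odot> XX - XX \<odot> Q) (i, c) (j, d) = (if i = j then 1 else 0)"
        using v unfolding minus_apply mul_XX[OF Q] XX_mul[OF Q] Qe c c' by simp
      also have "\<dots> = Ysh m (i, c) (j, d)" using v True by (simp add: Ysh_entry k_def)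
      finally show ?thesis .
    next
      case False
      then show ?thesis using v
        by (auto simp: mul_XX[OF Q] XX_mul[OF Q] Qe Ysh_entry k_def)
    qed
  qed (auto intro!: supported_rules Q)
  ultimately show ?thesis using Q unfolding raiser_def by blast
qed

end

section \<open>Polynomial translations of the fixed point\<close>

context frobenius
begin

definition Ypoly :: "complex poly \<Rightarrow> cell_matrix" where
  "Ypoly r = (\<Sum>i\<le>degree r. scale (coeff r i) (Ysh i))"

lemma Ypoly_alt: "degree r \<le> N \<Longrightarrow> Ypoly r = (\<Sum>i\<le>N. scale (coeff r i) (Ysh i))"
  unfolding Ypoly_def
  by (rule sum.mono_neutral_left) (auto simp: coeff_eq_0 scale_simps)

lemma Ypoly_add: "Ypoly (r + s) = Ypoly r + Ypoly s"
proof -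
  define N where "N = max (degree r) (degree s)"
  have "degree (r + s) \<le> N" "degree r \<le> N" "degree s \<le> N" by (auto simp: N_def degree_add_le_max)
  then show ?thesis by (simp only: Ypoly_alt coeff_add scale_simps sum.distrib)
qed

lemma Ypoly_monom: "Ypoly (monom a m) = scale a (Ysh m)"
proof -
  have "Ypoly (monom a m) = (\<Sum>i\<le>m. scale (coeff (monom a m) i) (Ysh i))"
    by (rule Ypoly_alt) (rule degree_monom_le)
  also have "\<dots> = (\<Sum>i\<le>m. if i = m then scale a (Ysh m) else 0)"
    by (intro sum.cong) (auto simp: scale_simps)
  also have "\<dots> = scale a (Ysh m)" by (simp only: sum.delta finite_atMost atMost_iff order_refl if_True)
  finally show ?thesis .
qed

lemma supported_Ypoly: "supported (Ypoly r)"
  unfolding Ypoly_def by (intro supported_rules)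

lemma commutes_Ypoly:
  assumes "supported A" "A \<odot> YY = YY \<odot> A" shows "A \<odot> Ypoly r = Ypoly r \<odot> A"
  unfolding Ypoly_def mul_sum mul_distribs commutes_with_powers[OF assms] ..

text \<open>
  Conjugation by \<open>P\<close> fixes \<open>Y\<close> and adds \<open>r(Y)\<close> to
  \<open>X\<close>.
\<close>

definition translates :: "complex poly \<Rightarrow> cell_matrix \<Rightarrow> bool" where
  "translates r P \<longleftrightarrow> supported P \<and> (\<exists>P'. supported P' \<and> P \<odot> P' = Ysh 0 \<and> P' \<odot> P = Ysh 0)
     \<and> P \<odot> YY = YY \<odot> P \<and> P \<odot> XX = (XX + Ypoly r) \<odot> P"

lemma translates_zero: "translates 0 (Ysh 0)"
proof -
  have "Ypoly 0 = 0" by (simp add: Ypoly_def scale_simps)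
  moreover have "supported (Ysh 0)" by (rule supported_basic)
  moreover have "Ysh 0 \<odot> Ysh 0 = Ysh 0" by (rule unit_mul(1)[OF supported_basic(1)])
  moreover have "Ysh 0 \<odot> YY = YY \<odot> Ysh 0" "Ysh 0 \<odot> XX = XX \<odot> Ysh 0"
    by (simp_all only: unit_mul supported_basic)
  ultimately show ?thesis unfolding translates_def by (metis add.right_neutral)
qed

text \<open>
  Conjugating twice adds the polynomials, because \<open>P\<close> commutes with \<open>Y\<close>.
\<close>

lemma translates_add:
  assumes "translates r P" "translates s R" shows "translates (r + s) (P \<odot> R)"
proof -
  from assms(1) obtain P' where P: "supported P" "supported P'" "P \<odot> P' = Ysh 0" "P' \<odot> P = Ysh 0"
    "P \<odot> YY = YY \<odot> P" "P \<odot> XX = (XX + Ypoly r) \<odot> P" unfolding translates_def by blast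
  from assms(2) obtain R' where R: "supported R" "supported R'" "R \<odot> R' = Ysh 0" "R' \<odot> R = Ysh 0"
    "R \<odot> YY = YY \<odot> R" "R \<odot> XX = (XX + Ypoly s) \<odot> R" unfolding translates_def by blast
  have 1: "(P \<odot> R) \<odot> (R' \<odot> P') = Ysh 0"
  proof -
    have "(P \<odot> R) \<odot> (R' \<odot> P') = P \<odot> (R \<odot> R') \<odot> P'" by (simp only: mul_assoc)
    then show ?thesis by (simp only: R(3) unit_mul P)
  qed
  have 2: "(R' \<odot> P') \<odot> (P \<odot> R) = Ysh 0"
  proof -
    have "(R' \<odot> P') \<odot> (P \<odot> R) = R' \<odot> (P' \<odot> P) \<odot> R" by (simp only: mul_assoc)
    then show ?thesis by (simp only: P(4) unit_mul R)
  qed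
  have "(P \<odot> R) \<odot> YY = P \<odot> YY \<odot> R" by (simp only: mul_assoc R(5))
  then have 3: "(P \<odot> R) \<odot> YY = YY \<odot> (P \<odot> R)" by (simp only: P(5) mul_assoc)
  have "(P \<odot> R) \<odot> XX = P \<odot> XX \<odot> R + P \<odot> Ypoly s \<odot> R"
    by (simp only: mul_assoc R(6) mul_distribs)
  also have "\<dots> = (XX + Ypoly (r + s)) \<odot> (P \<odot> R)"
    by (simp only: P(6) commutes_Ypoly[OF P(1,5)] Ypoly_add mul_distribs mul_assoc add.assoc)
  finally have 4: "(P \<odot> R) \<odot> XX = (XX + Ypoly (r + s)) \<odot> (P \<odot> R)" .
  have "supported (P \<odot> R)" "supported (R' \<odot> P')" using P R by (auto intro: supported_rules)
  then show ?thesis unfolding translates_def using 1 2 3 4 by blast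
qed

fun pw :: "cell_matrix \<Rightarrow> nat \<Rightarrow> cell_matrix" where
  "pw Q 0 = Ysh 0"
| "pw Q (Suc k) = Q \<odot> pw Q k"

lemma supported_pw: "supported Q \<Longrightarrow> supported (pw Q k)"
  by (induction k) (auto intro: supported_rules)

lemma homogeneous_pw: "homogeneous e Q \<Longrightarrow> homogeneous (int k * e) (pw Q k)"
proof (induction k)
  case 0 then show ?case using homogeneous_basic(1)[of 0] by simp
next
  case (Suc k)
  then have "homogeneous (e + int k * e) (pw Q (Suc k))" by (simp add: homogeneous_mul)
  then show ?case by (simp add: algebra_simps)
qed

lemma degree_bound: "\<exists>B. \<forall>e A. supported A \<longrightarrow> homogeneous e A \<longrightarrow> \<bar>e\<bar> > int B \<longrightarrow> A = 0"
proof -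
  define f where "f = (\<lambda>i. p i + al i)"
  define S where "S = (\<Sum>i<D. f i)"
  define B where "B = S + S"
  have f: "f i \<le> S" if "i < D" for i unfolding S_def using that by (intro member_le_sum) auto
  have "A = 0" if A: "supported A" "homogeneous e A" "\<bar>e\<bar> > int B" for e A
  proof (rule supported_eqI[OF A(1) supported_intros(5)])
    fix i c j d assume v: "valid i c" "valid j d"
    have "\<bar>d - c\<bar> \<le> int (f i) + int (f j)" using v by (auto simp: valid_def f_def)
    then have "d - c \<noteq> e" using f[of i] f[of j] v A(3) by (auto simp: B_def valid_def)
    then show "A (i, c) (j, d) = 0 (i, c) (j, d)" using homogeneousD[OF A(2), of "(i, c)" "(j, d)"] by auto
  qed
  then show ?thesis by blast
qed

text \<open>
  The exponential of \<open>a Q\<close>, once \<open>N\<close> exceeds the nilpotency index of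
  \<open>Q\<close>.
\<close>

definition truncated_exp :: "complex \<Rightarrow> nat \<Rightarrow> cell_matrix \<Rightarrow> cell_matrix" where
  "truncated_exp a N Q = (\<Sum>k<N. scale (a ^ k / fact k) (pw Q k))"

lemma pw_commutes_YY:
  assumes "Q \<odot> YY = YY \<odot> Q" shows "pw Q k \<odot> YY = YY \<odot> pw Q k"
proof (induction k)
  case 0 show ?case by (simp only: pw.simps unit_mul supported_basic)
next
  case (Suc k)
  have "pw Q (Suc k) \<odot> YY = Q \<odot> YY \<odot> pw Q k" by (simp only: pw.simps mul_assoc Suc)
  then show ?case by (simp only: assms mul_assoc pw.simps)
qed

lemma pw_XX:
  assumes Q: "supported Q" "Q \<odot> YY = YY \<odot> Q" and QX: "Q \<odot> XX - XX \<odot> Q = Ysh m"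
  shows "pw Q k \<odot> XX = XX \<odot> pw Q k + scale (of_nat k) (Ysh m \<odot> pw Q (k - 1))"
proof (induction k)
  case 0
  have "pw Q 0 \<odot> XX = XX" "XX \<odot> pw Q 0 = XX" by (simp_all only: pw.simps unit_mul supported_basic)
  then show ?case by (simp only: of_nat_0 scale_simps add_0_right)
next
  case (Suc k)
  have QX': "Q \<odot> XX = XX \<odot> Q + Ysh m" using QX by (metis diff_add_cancel add.commute)
  have step: "Q \<odot> scale (of_nat k) (Ysh m \<odot> pw Q (k - 1)) = scale (of_nat k) (Ysh m \<odot> pw Q k)"
  proof (cases k)
    case 0 then show ?thesis by (simp only: of_nat_0 scale_simps mul_distribs)
  next
    case (Suc l)
    have "Q \<odot> (Ysh m \<odot> pw Q l) = Ysh m \<odot> pw Q (Suc l)"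
      by (simp only: pw.simps mul_assoc[symmetric] commutes_with_powers[OF Q])
    then show ?thesis by (simp only: Suc mul_distribs diff_Suc_1)
  qed
  have "pw Q (Suc k) \<odot> XX = Q \<odot> (pw Q k \<odot> XX)" by (simp only: pw.simps mul_assoc)
  also have "\<dots> = Q \<odot> XX \<odot> pw Q k + scale (of_nat k) (Ysh m \<odot> pw Q k)"
    by (simp only: Suc mul_distribs(2) step mul_assoc)
  also have "Q \<odot> XX \<odot> pw Q k = XX \<odot> pw Q (Suc k) + Ysh m \<odot> pw Q k"
    by (simp only: QX' mul_distribs mul_assoc pw.simps)
  finally have "pw Q (Suc k) \<odot> XX = XX \<odot> pw Q (Suc k) + (Ysh m \<odot> pw Q k + scale (of_nat k) (Ysh m \<odot> pw Q k))"
    by (simp only: add.assoc)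
  also have "Ysh m \<odot> pw Q k + scale (of_nat k) (Ysh m \<odot> pw Q k) = scale (of_nat (Suc k)) (Ysh m \<odot> pw Q k)"
    by (simp only: of_nat_Suc scale_simps)
  finally show ?case by (simp only: diff_Suc_1)
qed

lemma supported_truncated_exp: "supported Q \<Longrightarrow> supported (truncated_exp a N Q)"
  unfolding truncated_exp_def by (intro supported_rules supported_pw)

lemma truncated_exp_YY: "Q \<odot> YY = YY \<odot> Q \<Longrightarrow> truncated_exp a N Q \<odot> YY = YY \<odot> truncated_exp a N Q"
  unfolding truncated_exp_def by (simp only: mul_sum mul_distribs pw_commutes_YY)

lemma truncated_exp_XX:
  assumes Q: "supported Q" "Q \<odot> YY = YY \<odot> Q" and QX: "Q \<odot> XX - XX \<odot> Q = Ysh m"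
    and N: "pw Q N = 0"
  shows "truncated_exp a (Suc N) Q \<odot> XX
    = XX \<odot> truncated_exp a (Suc N) Q + scale a (Ysh m \<odot> truncated_exp a (Suc N) Q)"
proof -
  let ?E = "truncated_exp a (Suc N) Q"
  have "?E \<odot> XX = XX \<odot> ?E + (\<Sum>k<Suc N. scale (a ^ k / fact k) (scale (of_nat k) (Ysh m \<odot> pw Q (k - 1))))"
    unfolding truncated_exp_def by (simp only: mul_sum mul_distribs pw_XX[OF Q QX] scale_simps(1) sum.distrib)
  also have "(\<Sum>k<Suc N. scale (a ^ k / fact k) (scale (of_nat k) (Ysh m \<odot> pw Q (k - 1))))
     = (\<Sum>k<N. scale (a ^ Suc k / fact (Suc k)) (scale (of_nat (Suc k)) (Ysh m \<odot> pw Q k)))"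
    unfolding sum.lessThan_Suc_shift by (simp only: of_nat_0 scale_simps add_0 diff_Suc_1)
  also have "\<dots> = (\<Sum>k<N. scale a (scale (a ^ k / fact k) (Ysh m \<odot> pw Q k)))"
  proof (rule sum.cong[OF refl])
    fix k
    have "a ^ Suc k / fact (Suc k) * of_nat (Suc k) = a * (a ^ k / fact k)"
      using of_nat_neq_0[of k, where 'a=complex] by (simp add: fact_Suc del: of_nat_Suc)
    then show "scale (a ^ Suc k / fact (Suc k)) (scale (of_nat (Suc k)) (Ysh m \<odot> pw Q k))
      = scale a (scale (a ^ k / fact k) (Ysh m \<odot> pw Q k))" by (simp only: scale_simps)
  qed
  also have "\<dots> = scale a (Ysh m \<odot> ?E)"
  proof -
    have "?E = (\<Sum>k<N. scale (a ^ k / fact k) (pw Q k))"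
      unfolding truncated_exp_def sum.lessThan_Suc by (simp only: N scale_simps add_0_right)
    then show ?thesis by (simp only: mul_sum mul_distribs scale_sum)
  qed
  finally show ?thesis .
qed

lemma truncated_exp_diagonal:
  assumes Q: "homogeneous e Q" "e > 0"
  shows "truncated_exp a (Suc N) Q (i, c) (j, d) =
    (if d < c then 0 else if d = c then Ysh 0 (i, c) (j, d) else truncated_exp a (Suc N) Q (i, c) (j, d))"
proof -
  have z: "pw Q (Suc k) (i, c) (j, d) = 0" if "d \<le> c" for k
  proof -
    have "int (Suc k) * e > 0" using Q(2) by simp
    then show ?thesis using homogeneousD[OF homogeneous_pw[OF Q(1), of "Suc k"], of "(i, c)" "(j, d)"] that
      by (metis diff_gt_0_iff_gt linorder_not_less snd_conv)
  qed
  have app: "(\<Sum>k<n. F k) r s = (\<Sum>k<n. F k r s)" for F :: "nat \<Rightarrow> cell_matrix" and n r s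
    by (induction n) (simp_all only: sum.lessThan_Suc lessThan_0 sum.empty zero_fun_apply plus_fun_apply)
  have "truncated_exp a (Suc N) Q (i, c) (j, d) = Ysh 0 (i, c) (j, d)" if "d \<le> c"
    unfolding truncated_exp_def sum.lessThan_Suc_shift plus_fun_apply app scale_apply z[OF that]
    by simp
  moreover have "Ysh 0 (i, c) (j, d) = 0" if "d < c" using that by (simp add: Ysh_entry)
  ultimately show ?thesis by auto
qed

text \<open>
  The exponential of \<open>a Q\<close> adds \<open>a Y\<^sup>m\<close> to \<open>X\<close>. Its
  product with the exponential of \<open>-a Q\<close> commutes with \<open>X\<close> and
  \<open>Y\<close>, so it is scalar by Schur, and its diagonal entries are 1 because
  \<open>Q\<close> has positive degree.
\<close>

lemma raiser_translates:
  assumes D: "D > 0" and Q: "raiser m Q"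
  shows "\<exists>P. translates (monom a m) P"
proof -
  note q = Q[unfolded raiser_def]
  have Qs: "supported Q" and Qh: "homogeneous (int m + 1) Q" and QY: "Q \<odot> YY = YY \<odot> Q"
    and QX: "Q \<odot> XX - XX \<odot> Q = Ysh m" using q by auto
  obtain B where B: "\<And>e A. supported A \<Longrightarrow> homogeneous e A \<Longrightarrow> \<bar>e\<bar> > int B \<Longrightarrow> A = 0"
    using degree_bound by blast
  have N: "pw Q (Suc B) = 0"
  proof (rule B[OF supported_pw[OF Qs] homogeneous_pw[OF Qh]])
    have "int (Suc B) * 1 \<le> int (Suc B) * (int m + 1)" by (rule mult_left_mono) auto
    moreover have "int B < int (Suc B) * 1" by simp
    ultimately show "int B < \<bar>int (Suc B) * (int m + 1)\<bar>" by (rule order.strict_trans2[OF _ order.trans[OF _ abs_ge_self], rotated])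
  qed
  define P where "P b = truncated_exp b (Suc (Suc B)) Q" for b
  have Ps: "supported (P b)" for b unfolding P_def by (rule supported_truncated_exp[OF Qs])
  have PY: "P b \<odot> YY = YY \<odot> P b" for b unfolding P_def by (rule truncated_exp_YY[OF QY])
  have PX: "P b \<odot> XX = XX \<odot> P b + scale b (Ysh m \<odot> P b)" for b
    unfolding P_def by (rule truncated_exp_XX[OF Qs QY QX N])
  have inverse: "P b \<odot> P (- b) = Ysh 0" for b
  proof -
    let ?R = "P b \<odot> P (- b)"
    have RY: "?R \<odot> YY = YY \<odot> ?R" 
    proof -
      have "?R \<odot> YY = P b \<odot> (YY \<odot> P (- b))" by (simp only: mul_assoc PY)
      also have "\<dots> = P b \<odot> YY \<odot> P (- b)" by (simp only: mul_assoc)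
      also have "\<dots> = YY \<odot> ?R" by (simp only: PY) (simp only: mul_assoc)
      finally show ?thesis .
    qed
    have RX: "?R \<odot> XX = XX \<odot> ?R"
    proof -
      have "?R \<odot> XX = P b \<odot> (XX \<odot> P (- b) + scale (- b) (Ysh m \<odot> P (- b)))"
        by (simp only: mul_assoc PX)
      also have "\<dots> = P b \<odot> XX \<odot> P (- b) + scale (- b) (P b \<odot> Ysh m \<odot> P (- b))"
        by (simp only: mul_assoc mul_distribs)
      also have "P b \<odot> Ysh m = Ysh m \<odot> P b" by (rule commutes_with_powers[OF Ps PY])
      also have "P b \<odot> XX \<odot> P (- b) = XX \<odot> ?R + scale b (Ysh m \<odot> P b \<odot> P (- b))"
        by (simp only: PX) (simp only: mul_distribs mul_assoc)
      finally show ?thesis by (simp only: scale_simps add.assoc add.right_inverse add_0_right)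
    qed
    obtain z where z: "?R = scale z (Ysh 0)"
      using schur[OF D supported_intros(1)[OF Ps Ps] RX RY] by blast
    have v0: "valid 0 0" using D by (simp add: valid_def)
    have "?R (0, 0) (0, 0) = (\<Sum>t\<in>cells. if t = (0, 0) then 1 else 0)"
      unfolding mul_def
    proof (rule sum.cong[OF refl])
      fix t assume t: "t \<in> cells"
      obtain l e where [simp]: "t = (l, e)" by (cases t)
      have h: "homogeneous (int m + 1) Q" "int m + 1 > 0" using Qh by auto
      have 1: "P b (0, 0) (l, e) = (if e < 0 then 0 else if e = 0 then Ysh 0 (0, 0) (l, e) else P b (0, 0) (l, e))" for b
        unfolding P_def by (rule truncated_exp_diagonal[OF h])
      have 2: "P b (l, e) (0, 0) = (if 0 < e then 0 else if 0 = e then Ysh 0 (l, e) (0, 0) else P b (l, e) (0, 0))" for b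
        unfolding P_def by (rule truncated_exp_diagonal[OF h])
      consider "e < 0" | "e > 0" | "e = 0" by linarith
      then show "P b (0, 0) t * P (- b) t (0, 0) = (if t = (0, 0) then 1 else 0)"
      proof cases
        case 1 then show ?thesis using \<open>\<And>b. P b (0, 0) (l, e) = _\<close>[of b] by simp
      next
        case 2 then show ?thesis using \<open>\<And>b. P b (l, e) (0, 0) = _\<close>[of "- b"] by simp
      next
        case 3
        have "P b (0, 0) (l, e) = Ysh 0 (0, 0) (l, e)" using 1[of b] 3 by simp
        moreover have "P (- b) (l, e) (0, 0) = Ysh 0 (l, e) (0, 0)" using 2[of "- b"] 3 by simp
        ultimately show ?thesis using t v0 3 by (simp add: Ysh_entry)
      qed
    qed
    also have "\<dots> = 1" using v0 finite_cells by simp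
    finally have "z = 1" unfolding z using v0 by (simp add: Ysh_entry)
    then show ?thesis using z by (simp only: scale_simps)
  qed
  have "P a \<odot> P (- a) = Ysh 0" "P (- a) \<odot> P a = Ysh 0" using inverse[of a] inverse[of "- a"] by simp_all
  moreover have "P a \<odot> XX = (XX + Ypoly (monom a m)) \<odot> P a"
    by (simp only: PX Ypoly_monom mul_distribs)
  ultimately have "translates (monom a m) (P a)" unfolding translates_def using Ps PY by blast
  then show ?thesis by blast
qed

lemma translates_admissible:
  assumes D: "D > 0" and adm: "\<And>m. coeff r m \<noteq> 0 \<Longrightarrow> admissible (Suc m)"
  shows "\<exists>P. translates r P"
proof -
  have "\<exists>P. translates (\<Sum>i<N. monom (coeff r i) i) P" for N
  proof (induction N)
    case 0 show ?case using translates_zero by (simp only: lessThan_0 sum.empty) blast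
  next
    case (Suc N)
    then obtain P where P: "translates (\<Sum>i<N. monom (coeff r i) i) P" by blast
    show ?case
    proof (cases "coeff r N = 0")
      case True
      then show ?thesis using P by (auto simp only: sum.lessThan_Suc monom_0 monom_eq_0 add_0_right)
    next
      case False
      then obtain Q where "raiser N Q" using admissible_raiser adm by blast
      then obtain R where "translates (monom (coeff r N) N) R" using raiser_translates[OF D] by blast
      then show ?thesis using translates_add[OF P] by (auto simp only: sum.lessThan_Suc)
    qed
  qed
  from this[of "Suc (degree r)"] show ?thesis
    by (simp only: lessThan_Suc_atMost poly_as_sum_of_monoms)
qed

lemma component_Ypoly_mul:
  "component e (Ypoly r \<odot> A) = (\<Sum>i\<le>degree r. scale (coeff r i) (Ysh i \<odot> component (e - int i) A))"
  unfolding Ypoly_def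
  by (simp only: mul_sum mul_distribs component_sum component_scale component_mul_left[OF homogeneous_basic(1)])

text \<open>
  Compare homogeneous components in \<open>P X - X P = r(Y) P\<close>. The lowest component of
  \<open>P\<close> commutes with \<open>X\<close> and \<open>Y\<close>, hence is a scalar and has
  degree zero. In degree \<open>m\<close> of the equation only the lowest term of \<open>r\<close>
  then contributes, and the component of degree \<open>m + 1\<close> is the raiser up to a factor.
\<close>

lemma lowest_term_admissible:
  assumes D: "D > 0" and P: "supported P" "P \<noteq> 0" and PY: "P \<odot> YY = YY \<odot> P"
    and PX: "P \<odot> XX = (XX + Ypoly r) \<odot> P"
    and m: "coeff r m \<noteq> 0" "\<And>i. i < m \<Longrightarrow> coeff r i = 0"
  shows "admissible (Suc m)"
proof -
  have cY: "component e P \<odot> YY = YY \<odot> component e P" for e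
  proof -
    have "component (e + 1) (P \<odot> YY) = component (e + 1) (YY \<odot> P)" by (simp only: PY)
    then show ?thesis
      by (simp only: component_mul_left[OF homogeneous_basic(2)] component_mul_right[OF homogeneous_basic(2)] add_diff_cancel)
  qed
  have cX: "component e P \<odot> XX - XX \<odot> component e P
      = (\<Sum>i\<le>degree r. scale (coeff r i) (Ysh i \<odot> component (e - 1 - int i) P))" for e
  proof -
    have "component (e - 1) (P \<odot> XX) = component (e - 1) (XX \<odot> P) + component (e - 1) (Ypoly r \<odot> P)"
      by (simp only: PX mul_distribs component_add)
    moreover have "e - 1 - - 1 = e" by simp
    ultimately show ?thesis
      by (simp only: component_mul_left[OF homogeneous_basic(3)] component_mul_right[OF homogeneous_basic(3)]
          component_Ypoly_mul add_diff_cancel_left')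
  qed
  obtain r0 s0 where rs: "P r0 s0 \<noteq> 0" using P(2) by (metis ext zero_fun_apply)
  obtain B where B: "\<And>e A. supported A \<Longrightarrow> homogeneous e A \<Longrightarrow> \<bar>e\<bar> > int B \<Longrightarrow> A = 0"
    using degree_bound by blast
  have comp0: "component e P = 0" if "\<bar>e\<bar> > int B" for e
    using B[OF supported_intros(6)[OF P(1)] homogeneous_component that] .
  have "component (snd s0 - snd r0) P r0 s0 \<noteq> 0" using rs by (simp add: component_def)
  then have ex: "component (snd s0 - snd r0) P \<noteq> 0" by (metis zero_fun_apply)
  define t where "t = (LEAST t. component (int t - int B) P \<noteq> 0)"
  have "\<bar>snd s0 - snd r0\<bar> \<le> int B" using ex comp0 by (meson not_less)
  then have "component (int (nat (snd s0 - snd r0 + int B)) - int B) P \<noteq> 0" using ex by simp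
  then have t: "component (int t - int B) P \<noteq> 0" unfolding t_def by (rule LeastI)
  define e0 where "e0 = int t - int B"
  have below: "component e P = 0" if "e < e0" for e
  proof (cases "e < - int B")
    case True then show ?thesis by (intro comp0) auto
  next
    case False
    then have "nat (e + int B) < t" using that by (auto simp: e0_def)
    then have "component (int (nat (e + int B)) - int B) P = 0" unfolding t_def using not_less_Least by blast
    then show ?thesis using False by simp
  qed
  have "component e0 P \<odot> XX - XX \<odot> component e0 P = 0"
  proof -
    have "scale (coeff r i) (Ysh i \<odot> component (e0 - 1 - int i) P) = 0" for i
      by (subst below) (simp, simp only: mul_distribs scale_simps)
    then show ?thesis by (simp only: cX sum.neutral_const)
  qed
  then have "component e0 P \<odot> XX = XX \<odot> component e0 P" by (simp only: right_minus_eq)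
  then obtain z where z: "component e0 P = scale z (Ysh 0)"
    using schur[OF D supported_intros(6)[OF P(1)] _ cY] by blast
  have znz: "z \<noteq> 0" using t unfolding e0_def[symmetric] z by (metis scale_simps(5))
  \<comment> \<open>A nonzero scalar matrix has nonzero diagonal entries, which are of degree zero.\<close>
  have "e0 = 0"
  proof -
    have "valid 0 0" using D by (simp add: valid_def)
    then have "component e0 P (0, 0) (0, 0) \<noteq> 0" unfolding z using znz by (simp add: Ysh_entry)
    then show ?thesis using homogeneousD[OF homogeneous_component[of e0 P], of "(0, 0)" "(0, 0)"] by simp
  qed
  have "component (int m + 1) P \<odot> XX - XX \<odot> component (int m + 1) P = scale (coeff r m * z) (Ysh m)"
  proof -
    have "scale (coeff r i) (Ysh i \<odot> component (int m + 1 - 1 - int i) P)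
      = (if i = m then scale (coeff r m * z) (Ysh m) else 0)" for i
    proof (cases i m rule: linorder_cases)
      case less then show ?thesis using m(2)[OF less] by (simp only: scale_simps less_imp_neq if_False)
    next
      case greater
      then have "component (int m + 1 - 1 - int i) P = 0" using \<open>e0 = 0\<close> by (intro below) simp
      with greater show ?thesis by (simp only: mul_distribs scale_simps) simp
    next
      case equal
      have "component (int m + 1 - 1 - int m) P = scale z (Ysh 0)" using z \<open>e0 = 0\<close> by simp
      then show ?thesis unfolding equal
        by (simp only: mul_distribs unit_mul supported_basic scale_simps simp_thms if_True)
    qed
    then have "component (int m + 1) P \<odot> XX - XX \<odot> component (int m + 1) P
       = (\<Sum>i\<le>degree r. if i = m then scale (coeff r m * z) (Ysh m) else 0)" by (simp only: cX)
    also have "\<dots> = scale (coeff r m * z) (Ysh m)"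
      using le_degree[OF m(1)] by (simp only: sum.delta finite_atMost atMost_iff if_True)
    finally show ?thesis .
  qed
  then have "scale (1 / (coeff r m * z)) (component (int m + 1) P \<odot> XX - XX \<odot> component (int m + 1) P)
      = Ysh m" using znz m(1) by (simp add: scale_simps)
  then have "raiser m (scale (1 / (coeff r m * z)) (component (int m + 1) P))"
    unfolding raiser_def
  proof (intro conjI)
    show "homogeneous (int m + 1) (scale (1 / (coeff r m * z)) (component (int m + 1) P))"
      using homogeneous_component[of "int m + 1" P] unfolding homogeneous_def scale_apply by force
  qed (simp_all only: supported_intros P(1) cY mul_distribs scale_simps)
  then show ?thesis by (rule raiser_admissible)
qed

text \<open>
  If some monomial of \<open>r\<close> were not admissible, the lower ones could be subtracted,
  since they come from raisers, and the lowest remaining monomial would have to be admissible.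
\<close>

theorem translates_iff_admissible:
  assumes D: "D > 0"
  shows "(\<exists>P. translates r P) \<longleftrightarrow> (\<forall>m. coeff r m \<noteq> 0 \<longrightarrow> admissible (Suc m))"
proof
  assume "\<forall>m. coeff r m \<noteq> 0 \<longrightarrow> admissible (Suc m)"
  then show "\<exists>P. translates r P" using translates_admissible[OF D] by blast
next
  assume "\<exists>P. translates r P"
  then obtain P where P: "translates r P" by blast
  show "\<forall>m. coeff r m \<noteq> 0 \<longrightarrow> admissible (Suc m)"
  proof (rule ccontr)
    assume "\<not> (\<forall>m. coeff r m \<noteq> 0 \<longrightarrow> admissible (Suc m))"
    then obtain m where m: "coeff r m \<noteq> 0" "\<not> admissible (Suc m)"
      and least: "\<And>i. i < m \<Longrightarrow> \<not> (coeff r i \<noteq> 0 \<and> \<not> admissible (Suc i))"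
      using exists_least_iff[of "\<lambda>m. coeff r m \<noteq> 0 \<and> \<not> admissible (Suc m)"] by blast
    \<comment> \<open>Adding this polynomial removes all terms below \<open>m\<close>.\<close>
    define low where "low = - (\<Sum>i<m. monom (coeff r i) i)"
    have low: "coeff low i = (if i < m then - coeff r i else 0)" for i
      by (auto simp: low_def coeff_sum coeff_monom)
    obtain R where R: "translates low R"
      using translates_admissible[OF D, of low] low least by (metis neg_equal_0_iff_equal)
    have "translates (low + r) (R \<odot> P)" by (rule translates_add[OF R P])
    then obtain P' where T: "supported (R \<odot> P)" "(R \<odot> P) \<odot> P' = Ysh 0" "(R \<odot> P) \<odot> YY = YY \<odot> (R \<odot> P)"
      "(R \<odot> P) \<odot> XX = (XX + Ypoly (low + r)) \<odot> (R \<odot> P)" unfolding translates_def by blast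
    have "Ysh 0 (0, 0) (0, 0) = 1" using D by (simp add: Ysh_entry valid_def)
    then have "R \<odot> P \<noteq> 0" using T(2) by (metis mul_distribs(5) zero_fun_apply zero_neq_one)
    then have "admissible (Suc m)"
      by (rule lowest_term_admissible[OF D T(1) _ T(3,4)]) (use low m in simp_all)
    then show False using m by blast
  qed
qed

end

section \<open>Conjugacy of triangular images and uniqueness of the fixed point\<close>

context frobenius
begin

definition simultaneously_conjugate ::
  "cell_matrix \<Rightarrow> cell_matrix \<Rightarrow> cell_matrix \<Rightarrow> cell_matrix \<Rightarrow> bool" where
  "simultaneously_conjugate A B A' B' \<longleftrightarrow> (\<exists>P P'. supported P \<and> supported P' \<and>
     P \<odot> P' = Ysh 0 \<and> P' \<odot> P = Ysh 0 \<and> A \<odot> P = P \<odot> A' \<and> B \<odot> P = P \<odot> B')"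

definition diagonal :: "(cell \<Rightarrow> complex) \<Rightarrow> cell_matrix" where
  "diagonal f = (\<lambda>r s. if r = s \<and> r \<in> cells then f r else 0)"

lemma supported_diagonal: "supported (diagonal f)"
  unfolding supported_def diagonal_def by presburger

lemma diagonal_mul: "supported A \<Longrightarrow> (diagonal f \<odot> A) r s = f r * A r s"
proof -
  assume A: "supported A"
  have "(diagonal f \<odot> A) r s = (\<Sum>t\<in>cells. if t = r then f r * A r s else 0)"
    unfolding mul_def diagonal_def by (rule sum.cong) auto
  also have "\<dots> = f r * A r s"
    using finite_cells supportedD[OF A, of r s] by (cases "r \<in> cells") simp_all
  finally show ?thesis .
qed

lemma mul_diagonal: "supported A \<Longrightarrow> (A \<odot> diagonal f) r s = A r s * f s"
proof -
  assume A: "supported A"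
  have "(A \<odot> diagonal f) r s = (\<Sum>t\<in>cells. if t = s then A r s * f s else 0)"
    unfolding mul_def diagonal_def by (rule sum.cong) auto
  also have "\<dots> = A r s * f s"
    using finite_cells supportedD[OF A, of r s] by (cases "s \<in> cells") simp_all
  finally show ?thesis .
qed

lemma diagonal_inverse:
  assumes "\<And>r. r \<in> cells \<Longrightarrow> f r \<noteq> 0"
  shows "diagonal f \<odot> diagonal (\<lambda>r. inverse (f r)) = Ysh 0"
    "diagonal (\<lambda>r. inverse (f r)) \<odot> diagonal f = Ysh 0"
proof -
  have "diagonal f \<odot> diagonal (\<lambda>r. inverse (f r)) = Ysh 0 \<and> diagonal (\<lambda>r. inverse (f r)) \<odot> diagonal f = Ysh 0"
  proof (intro conjI cell_matrix_eqI)
    fix i c j d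
    show "(diagonal f \<odot> diagonal (\<lambda>r. inverse (f r))) (i, c) (j, d) = Ysh 0 (i, c) (j, d)"
      "(diagonal (\<lambda>r. inverse (f r)) \<odot> diagonal f) (i, c) (j, d) = Ysh 0 (i, c) (j, d)"
      using assms[of "(i, c)"]
      by (auto simp: diagonal_mul[OF supported_diagonal]) (auto simp: diagonal_def Ysh_entry)
  qed
  then show "diagonal f \<odot> diagonal (\<lambda>r. inverse (f r)) = Ysh 0"
    "diagonal (\<lambda>r. inverse (f r)) \<odot> diagonal f = Ysh 0" by blast+
qed

definition torus :: "complex \<Rightarrow> cell_matrix" where
  "torus b = diagonal (\<lambda>r. b powi snd r)"

text \<open>
  Conjugation by the diagonal matrix of the powers \<open>b\<^sup>c\<close> of the contents scales
  degree \<open>e\<close> by \<open>b\<^sup>e\<close>.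
\<close>

lemma torus_commute:
  assumes b: "b \<noteq> 0" and A: "supported A" "homogeneous e A"
  shows "A \<odot> torus b = scale (b powi e) (torus b \<odot> A)"
proof (rule cell_matrix_eqI)
  fix i c j d
  show "(A \<odot> torus b) (i, c) (j, d) = scale (b powi e) (torus b \<odot> A) (i, c) (j, d)"
  proof (cases "A (i, c) (j, d) = 0")
    case False
    then have "d = e + c" using homogeneousD[OF A(2) False] by simp
    then show ?thesis using b
      by (simp add: torus_def mul_diagonal[OF A(1)] diagonal_mul[OF A(1)] power_int_add)
  qed (simp add: torus_def mul_diagonal[OF A(1)] diagonal_mul[OF A(1)])
qed

lemma supported_torus: "supported (torus b)" unfolding torus_def by (rule supported_diagonal)

lemma torus_inverse:
  assumes "b \<noteq> 0" shows "torus b \<odot> torus (inverse b) = Ysh 0" "torus (inverse b) \<odot> torus b = Ysh 0"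
proof -
  have "torus (inverse b) = diagonal (\<lambda>r. inverse (b powi snd r))"
    unfolding torus_def by (simp add: power_int_inverse)
  then show "torus b \<odot> torus (inverse b) = Ysh 0" "torus (inverse b) \<odot> torus b = Ysh 0"
    using diagonal_inverse[of "\<lambda>r. b powi snd r"] assms by (simp_all add: torus_def)
qed

lemma torus_XX: "b \<noteq> 0 \<Longrightarrow> scale b XX \<odot> torus b = torus b \<odot> XX"
  using torus_commute[OF _ supported_basic(3) homogeneous_basic(3), of b]
  by (simp add: mul_distribs scale_simps power_int_minus)

lemma torus_YY: "b \<noteq> 0 \<Longrightarrow> scale (inverse b) YY \<odot> torus b = torus b \<odot> YY"
  using torus_commute[OF _ supported_basic(2) homogeneous_basic(2), of b]
  by (simp add: mul_distribs scale_simps)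

lemma torus_Ypoly:
  assumes b: "b \<noteq> 0" shows "Ypoly r \<odot> torus b = torus b \<odot> Ypoly (pcompose r [:0, b:])"
proof -
  have c: "coeff (pcompose r [:0, b:]) m = b ^ m * coeff r m" for m
  proof (induction r arbitrary: m)
    case (pCons a r)
    then show ?case by (cases m) (simp_all add: pcompose_pCons coeff_pCons)
  qed simp
  have "degree (pcompose r [:0, b:]) \<le> degree r" using degree_pcompose_le[of r "[:0, b:]"] by (simp add: b)
  then have "Ypoly (pcompose r [:0, b:]) = (\<Sum>i\<le>degree r. scale (b ^ i * coeff r i) (Ysh i))"
    using Ypoly_alt[of "pcompose r [:0, b:]" "degree r"] by (simp only: c)
  moreover have "Ysh i \<odot> torus b = scale (b ^ i) (torus b \<odot> Ysh i)" for i
    using torus_commute[OF b supported_basic(1) homogeneous_basic(1)] by simp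
  ultimately show ?thesis
    unfolding Ypoly_def[of r] by (simp only: mul_sum mul_distribs scale_simps mult.commute)
qed

text \<open>
  A nonzero column of \<open>P Y\<^sup>k\<close>, with \<open>k\<close> maximal, would be an
  eigenvector of the nilpotent \<open>Y\<close> for the eigenvalue \<open>-b g\<close>.
\<close>

lemma no_eigenvalue_shift:
  assumes P: "supported P" "P \<noteq> 0" and b: "b \<noteq> 0"
    and eq: "(scale (inverse b) YY + scale g (Ysh 0)) \<odot> P = P \<odot> YY"
  shows "g = 0"
proof (rule ccontr)
  assume g: "g \<noteq> 0"
  obtain N where N: "\<And>m. m \<ge> N \<Longrightarrow> Ysh m = 0" using Ysh_nilpotent by blast
  have PN: "P \<odot> Ysh N = 0" by (simp only: N[OF order_refl] mul_distribs)
  define m where "m = (LEAST m. P \<odot> Ysh m = 0)"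
  have m: "P \<odot> Ysh m = 0" unfolding m_def by (rule LeastI[of _ N]) (rule PN)
  have "m \<noteq> 0" 
  proof
    assume "m = 0"
    then show False using m P by (simp only: unit_mul) 
  qed
  then obtain k where k: "m = Suc k" by (cases m) auto
  define Z where "Z = P \<odot> Ysh k"
  have Znz: "Z \<noteq> 0" unfolding Z_def using not_less_Least[of k "\<lambda>m. P \<odot> Ysh m = 0"] k by (simp only: m_def) simp
  have Zs: "supported Z" unfolding Z_def by (intro supported_rules P)
  have "(scale (inverse b) YY + scale g (Ysh 0)) \<odot> Z = P \<odot> YY \<odot> Ysh k"
    unfolding Z_def by (simp only: mul_assoc[symmetric] eq)
  also have "\<dots> = 0" using m by (simp only: mul_assoc YY_powers k)
  finally have "scale (inverse b) (YY \<odot> Z) + scale g Z = 0" using Zs by (simp only: mul_distribs unit_mul)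
  then have "scale b (scale (inverse b) (YY \<odot> Z) + scale g Z) = 0" by (simp only: scale_simps)
  then have "YY \<odot> Z + scale (b * g) Z = 0" using b by (simp add: scale_simps)
  define e where "e = - (b * g)"
  have YZ: "YY \<odot> Z = scale e Z"
    using \<open>YY \<odot> Z + scale (b * g) Z = 0\<close> unfolding e_def by (simp only: scale_simps eq_neg_iff_add_eq_0)
  have enz: "e \<noteq> 0" using b g by (simp add: e_def)
  have pow: "Ysh t \<odot> Z = scale (e ^ t) Z" for t
  proof (induction t)
    case 0 then show ?case using Zs by (simp only: unit_mul power_0 scale_simps)
  next
    case (Suc t)
    have "Ysh (Suc t) \<odot> Z = YY \<odot> (Ysh t \<odot> Z)" by (simp only: YY_Ysh_mul)
    then show ?case by (simp only: Suc mul_distribs YZ scale_simps power_Suc mult.commute)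
  qed
  have "scale (e ^ N) Z = 0" using pow[of N] by (simp only: N[OF order_refl] mul_distribs)
  then have "\<forall>r s. e ^ N * Z r s = 0" by (metis scale_apply zero_fun_apply)
  then have "Z r s = 0" for r s using enz by (metis mult_eq_0_iff power_not_zero)
  then have "Z = 0" by (simp only: fun_eq_iff zero_fun_apply) blast
  with Znz show False by blast
qed

theorem conjugate_triangular_iff:
  assumes D: "D > 0" and b: "b \<noteq> 0"
  shows "simultaneously_conjugate (scale b XX + Ypoly r) (scale (inverse b) YY + scale g (Ysh 0)) XX YY
    \<longleftrightarrow> g = 0 \<and> (\<forall>m. coeff r m \<noteq> 0 \<longrightarrow> admissible (Suc m))"
proof -
  let ?T = "torus b" and ?T' = "torus (inverse b)"
  let ?r = "pcompose r [:0, b:]"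
  have c: "coeff ?r m = b ^ m * coeff r m" for m
  proof (induction r arbitrary: m)
    case (pCons a r)
    then show ?case by (cases m) (simp_all add: pcompose_pCons coeff_pCons)
  qed simp
  have E: "Ysh 0 (0, 0) (0, 0) = 1" using D by (simp add: Ysh_entry valid_def)
  have X: "(scale b XX + Ypoly r) \<odot> ?T = ?T \<odot> (XX + Ypoly ?r)"
    by (simp only: mul_distribs(1,2) torus_XX[OF b] torus_Ypoly[OF b])
  have Y: "(scale (inverse b) YY + scale 0 (Ysh 0)) \<odot> ?T = ?T \<odot> YY"
    by (simp only: scale_simps add_0_right torus_YY[OF b])
  have "(\<exists>P. translates ?r P) \<longleftrightarrow> simultaneously_conjugate (scale b XX + Ypoly r) (scale (inverse b) YY + scale 0 (Ysh 0)) XX YY"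
  proof
    assume "\<exists>P. translates ?r P"
    then obtain R R' where R: "supported R" "supported R'" "R \<odot> R' = Ysh 0" "R' \<odot> R = Ysh 0"
      "R \<odot> YY = YY \<odot> R" "R \<odot> XX = (XX + Ypoly ?r) \<odot> R" unfolding translates_def by blast
    have "(?T \<odot> R) \<odot> (R' \<odot> ?T') = ?T \<odot> (R \<odot> R') \<odot> ?T'" by (simp only: mul_assoc)
    then have 1: "(?T \<odot> R) \<odot> (R' \<odot> ?T') = Ysh 0" by (simp only: R(3) unit_mul supported_torus torus_inverse[OF b])
    have "(R' \<odot> ?T') \<odot> (?T \<odot> R) = R' \<odot> (?T' \<odot> ?T) \<odot> R" by (simp only: mul_assoc)
    then have 2: "(R' \<odot> ?T') \<odot> (?T \<odot> R) = Ysh 0" by (simp only: torus_inverse[OF b] unit_mul R)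
    have "(scale b XX + Ypoly r) \<odot> (?T \<odot> R) = ?T \<odot> ((XX + Ypoly ?r) \<odot> R)"
      by (simp only: mul_assoc[symmetric] X)
    then have 3: "(scale b XX + Ypoly r) \<odot> (?T \<odot> R) = (?T \<odot> R) \<odot> XX" by (simp only: R(6)[symmetric] mul_assoc)
    have "(scale (inverse b) YY + scale 0 (Ysh 0)) \<odot> (?T \<odot> R) = ?T \<odot> (YY \<odot> R)"
      by (simp only: mul_assoc[symmetric] Y)
    then have 4: "(scale (inverse b) YY + scale 0 (Ysh 0)) \<odot> (?T \<odot> R) = (?T \<odot> R) \<odot> YY"
      by (simp only: R(5)[symmetric] mul_assoc)
    have "supported (?T \<odot> R)" "supported (R' \<odot> ?T')" by (intro supported_rules supported_torus R)+
    then show "simultaneously_conjugate (scale b XX + Ypoly r) (scale (inverse b) YY + scale 0 (Ysh 0)) XX YY"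
      unfolding simultaneously_conjugate_def using 1 2 3 4 by blast
  next
    assume "simultaneously_conjugate (scale b XX + Ypoly r) (scale (inverse b) YY + scale 0 (Ysh 0)) XX YY"
    then obtain P P' where P: "supported P" "supported P'" "P \<odot> P' = Ysh 0" "P' \<odot> P = Ysh 0"
      "(scale b XX + Ypoly r) \<odot> P = P \<odot> XX" "(scale (inverse b) YY + scale 0 (Ysh 0)) \<odot> P = P \<odot> YY"
      unfolding simultaneously_conjugate_def by blast
    define R where "R = ?T' \<odot> P"
    have TR: "P = ?T \<odot> R" unfolding R_def
      by (simp only: mul_assoc[symmetric] torus_inverse[OF b] unit_mul P)
    have cancel: "A = B" if "?T \<odot> A = ?T \<odot> B" "supported A" "supported B" for A B
    proof -
      have "?T' \<odot> (?T \<odot> A) = ?T' \<odot> (?T \<odot> B)" by (simp only: that(1))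
      then show ?thesis by (simp only: mul_assoc[symmetric] torus_inverse[OF b] unit_mul that(2,3))
    qed
    have Rs: "supported R" "supported (P' \<odot> ?T)" unfolding R_def by (intro supported_rules supported_torus P)+
    have "R \<odot> (P' \<odot> ?T) = ?T' \<odot> (P \<odot> P') \<odot> ?T" unfolding R_def by (simp only: mul_assoc)
    then have 1: "R \<odot> (P' \<odot> ?T) = Ysh 0" by (simp only: P(3) unit_mul supported_torus torus_inverse[OF b])
    have "(P' \<odot> ?T) \<odot> R = P' \<odot> (?T \<odot> R)" by (simp only: mul_assoc)
    then have 2: "(P' \<odot> ?T) \<odot> R = Ysh 0" by (simp only: TR[symmetric] P(4))
    have "?T \<odot> ((XX + Ypoly ?r) \<odot> R) = (scale b XX + Ypoly r) \<odot> P"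
      by (simp only: mul_assoc[symmetric] X[symmetric]) (simp only: mul_assoc TR[symmetric])
    then have "?T \<odot> ((XX + Ypoly ?r) \<odot> R) = ?T \<odot> (R \<odot> XX)"
      by (simp only: P(5) mul_assoc[symmetric] TR[symmetric])
    then have 3: "(XX + Ypoly ?r) \<odot> R = R \<odot> XX"
      by (rule cancel) (intro supported_rules supported_Ypoly Rs)+
    have "?T \<odot> (YY \<odot> R) = (scale (inverse b) YY + scale 0 (Ysh 0)) \<odot> P"
      by (simp only: mul_assoc[symmetric] Y[symmetric]) (simp only: mul_assoc TR[symmetric])
    then have "?T \<odot> (YY \<odot> R) = ?T \<odot> (R \<odot> YY)"
      by (simp only: P(6) mul_assoc[symmetric] TR[symmetric])
    then have 4: "YY \<odot> R = R \<odot> YY"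
      by (rule cancel) (intro supported_rules Rs)+
    show "\<exists>P. translates ?r P" unfolding translates_def using Rs 1 2 3 4 by metis
  qed
  moreover have "(\<exists>P. translates ?r P) \<longleftrightarrow> (\<forall>m. coeff r m \<noteq> 0 \<longrightarrow> admissible (Suc m))"
    unfolding translates_iff_admissible[OF D] c using b by simp
  moreover have "g = 0" if sc: "simultaneously_conjugate (scale b XX + Ypoly r) (scale (inverse b) YY + scale g (Ysh 0)) XX YY"
  proof -
    from sc obtain P P' where P: "supported P" "P \<odot> P' = Ysh 0"
      "(scale (inverse b) YY + scale g (Ysh 0)) \<odot> P = P \<odot> YY"
      unfolding simultaneously_conjugate_def by blast
    have "P \<noteq> 0"
    proof
      assume "P = 0"
      then have "Ysh 0 = 0" using P(2) by (simp only: mul_distribs)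
      then show False using E by (metis zero_fun_apply zero_neq_one)
    qed
    then show ?thesis using no_eigenvalue_shift[OF P(1) _ b P(3)] by blast
  qed
  ultimately show ?thesis by blast
qed

text \<open>
  Commuting with \<open>Y\<close> makes the entries constant along the diagonals of each block.
  Every diagonal of degree -1 in an off-diagonal block runs out of the block at one end, because
  one of the two hooks is longer in its arm and its leg.
\<close>

lemma lowering_commutant_zero:
  assumes A: "supported A" "homogeneous (- 1) A" and AY: "A \<odot> YY = YY \<odot> A"
    and diag: "\<And>i c d. A (i, c) (i, d) = 0"
  shows "A = 0"
proof -
  have step: "A (i, c) (j, c - 1) = A (i, c + 1) (j, c)" if "valid i c" "valid j c" for i j c
  proof -
    have "(A \<odot> YY) (i, c) (j, c) = (YY \<odot> A) (i, c) (j, c)" by (simp only: AY)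
    then show ?thesis using that by (simp add: mul_YY[OF A(1)] YY_mul[OF A(1)])
  qed
  have z: "A r s = 0" if "r \<notin> cells \<or> s \<notin> cells" for r s using supportedD[OF A(1)] that by blast
  have up: "A (i, - int (p j) + int t + 1) (j, - int (p j) + int t) = 0" if ij: "i < j" "j < D" for i j t
  proof (induction t)
    case 0
    have v: "valid i (- int (p j))" "valid j (- int (p j))" using p_dec[OF ij] ij by (auto simp: valid_def)
    have "A (i, - int (p j)) (j, - int (p j) - 1) = 0" by (rule z) (simp add: valid_def)
    then show ?case using step[OF v] by simp
  next
    case (Suc t)
    let ?c = "- int (p j) + int (Suc t)"
    show ?case
    proof (cases "valid j ?c")
      case True
      then have v: "valid i ?c" using p_dec[OF ij] al_dec[OF ij] ij by (auto simp: valid_def)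
      have "?c = - int (p j) + int t + 1" "?c - 1 = - int (p j) + int t" by auto
      then have "A (i, ?c) (j, ?c - 1) = 0" using Suc by metis
      then show ?thesis using step[OF v True] by simp
    next
      case False then show ?thesis by (intro z) simp
    qed
  qed
  have down: "A (i, int (al i) - int t) (j, int (al i) - int t - 1) = 0" if ij: "j < i" "i < D" for i j t
  proof (induction t)
    case 0
    have v: "valid i (int (al i))" "valid j (int (al i))" using al_dec[OF ij] ij by (auto simp: valid_def)
    have "A (i, int (al i) + 1) (j, int (al i)) = 0" by (rule z) (simp add: valid_def)
    then show ?case using step[OF v] by simp
  next
    case (Suc t)
    let ?c = "int (al i) - int (Suc t)"
    show ?case
    proof (cases "valid i ?c")
      case True
      then have v: "valid j ?c" using p_dec[OF ij] al_dec[OF ij] ij by (auto simp: valid_def)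
      have "?c + 1 = int (al i) - int t" "?c = int (al i) - int t - 1" by auto
      then have "A (i, ?c + 1) (j, ?c) = 0" using Suc by metis
      then show ?thesis using step[OF True v] by simp
    next
      case False then show ?thesis by (intro z) simp
    qed
  qed
  show ?thesis
  proof (rule supported_eqI[OF A(1) supported_intros(5)])
    fix i c j d assume v: "valid i c" "valid j d"
    have "A (i, c) (j, d) = 0"
    proof (cases "d = c - 1")
      case False
      then show ?thesis using homogeneousD[OF A(2), of "(i, c)" "(j, d)"] by force
    next
      case d: True
      consider "i = j" | "i < j" | "j < i" by linarith
      then show ?thesis
      proof cases
        case 1 then show ?thesis using diag by simp
      next
        case 2
        have "d = - int (p j) + int (nat (d + int (p j)))" "c = - int (p j) + int (nat (d + int (p j))) + 1"
          using v d by (auto simp: valid_def)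
        then show ?thesis using up[OF 2, of "nat (d + int (p j))"] v by (metis valid_def)
      next
        case 3
        have "c = int (al i) - int (nat (int (al i) - c))" "d = int (al i) - int (nat (int (al i) - c)) - 1"
          using v d by (auto simp: valid_def)
        then show ?thesis using down[OF 3, of "nat (int (al i) - c)"] v by (metis valid_def)
      qed
    qed
    then show "A (i, c) (j, d) = 0 (i, c) (j, d)" by simp
  qed
qed

text \<open>
  The diagonal entries at content zero determine the rank one matrix up to the factors
  \<open>v\<close>, \<open>w\<close>: they are the nonzero hook sizes, and the vanishing of all
  entries of nonzero degree kills the other coordinates. The difference from the matrix with these
  factors commutes with \<open>Y\<close>, so it is zero by the previous lemma.
\<close>

lemma fixed_shape_unique:
  assumes D: "D > 0" and A: "supported A" and A_diag: "\<And>i c d. i < D \<Longrightarrow> A (i, c) (i, d) = XX (i, c) (i, d)"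
    and A_off: "\<And>i j c d. i \<noteq> j \<Longrightarrow> A (i, c) (j, d) \<noteq> 0 \<Longrightarrow> c = d + 1"
    and rank: "\<And>r s. r \<in> cells \<Longrightarrow> s \<in> cells \<Longrightarrow> (A \<odot> YY - YY \<odot> A + Ysh 0) r s = f r * g s"
  shows "\<exists>v' w'. frobenius D p al v' w' \<and> A = frobenius.XX D p al v' w'"
proof -
  have hom: "homogeneous (- 1) A"
    unfolding homogeneous_def
  proof (intro allI impI)
    fix r s assume ne: "A r s \<noteq> 0"
    obtain i c j d where rs: "r = (i, c)" "s = (j, d)" by (metis surj_pair)
    have v: "valid i c" using ne supportedD[OF A, of r s] by (auto simp: rs)
    have "c = d + 1"
    proof (cases "i = j")
      case True
      then have "XX (i, c) (j, d) \<noteq> 0" using ne A_diag[of i c d] v by (auto simp: rs valid_def)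
      then show ?thesis by (auto simp: XX_entry split: if_splits)
    qed (use A_off ne rs in blast)
    then show "snd s - snd r = - 1" by (simp add: rs)
  qed
  have entry: "(A \<odot> YY - YY \<odot> A + Ysh 0) (i, c) (j, d) = A (i, c) (j, d - 1) - A (i, c + 1) (j, d) + Ysh 0 (i, c) (j, d)"
    if "valid i c" "valid j d" for i c j d
    using that by (simp add: mul_YY[OF A] YY_mul[OF A])
  have off: "f (i, c) * g (j, d) = 0" if "valid i c" "valid j d" "c \<noteq> d" for i c j d
  proof -
    have "A (i, c) (j, d - 1) = 0" "A (i, c + 1) (j, d) = 0"
      using homogeneousD[OF hom, of "(i, c)" "(j, d - 1)"] homogeneousD[OF hom, of "(i, c + 1)" "(j, d)"] that by auto
    then show ?thesis using rank[of "(i, c)" "(j, d)"] entry[OF that(1,2)] that by (simp add: Ysh_entry)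
  qed
  have dia: "f (i, c) * g (i, c) = (if c = 0 then v i * w i else 0)" if v: "valid i c" for i c
  proof -
    have i: "i < D" using v by (simp add: valid_def)
    have "(XX \<odot> YY - YY \<odot> XX + Ysh 0) (i, c) (i, c) = MM (i, c) (i, c)" by (simp only: commutator_relation)
    then have "XX (i, c) (i, c - 1) - XX (i, c + 1) (i, c) + Ysh 0 (i, c) (i, c) = MM (i, c) (i, c)"
      using v by (simp add: mul_YY[OF supported_basic(3)] YY_mul[OF supported_basic(3)])
    then show ?thesis using rank[of "(i, c)" "(i, c)"] entry[OF v v] v by (simp add: A_diag[OF i] MM_entry)
  qed
  have v0: "valid i 0" if "i < D" for i using that by (simp add: valid_def)
  have h: "f (i, 0) * g (i, 0) = of_nat (p i + al i + 1)" if "i < D" for i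
    using dia[OF v0[OF that]] vw[OF that] by simp
  define v' where "v' i = f (i, 0)" for i
  define w' where "w' i = g (i, 0)" for i
  have F: "frobenius D p al v' w'"
    by unfold_locales (use p_dec al_dec h in \<open>auto simp: v'_def w'_def\<close>)
  interpret F: frobenius D p al v' w' by (rule F)
  have nz: "f (0, 0) \<noteq> 0" "g (0, 0) \<noteq> 0" using F.v_nz[OF D] F.w_nz[OF D] by (auto simp: v'_def w'_def)
  have f0: "f (i, c) = 0" if "valid i c" "c \<noteq> 0" for i c using off[OF that(1) v0[OF D] that(2)] nz by simp
  have g0: "g (i, c) = 0" if "valid i c" "c \<noteq> 0" for i c using off[OF v0[OF D] that(1)] nz that by simp
  have "mul A YY - mul YY A + Ysh 0 = F.MM"
  proof (rule supported_eqI)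
    fix i c j d assume v: "valid i c" "valid j d"
    then show "(mul A YY - mul YY A + Ysh 0) (i, c) (j, d) = F.MM (i, c) (j, d)"
      using rank[of "(i, c)" "(j, d)"] f0[of i c] g0[of j d]
      by (auto simp: F.MM_entry v'_def w'_def)
  qed (intro supported_rules A F.supported_basic)+
  also have "\<dots> = mul F.XX YY - mul YY F.XX + Ysh 0" by (rule F.commutator_relation[symmetric])
  finally have eq: "mul A YY - mul YY A = mul F.XX YY - mul YY F.XX" by (simp only: add_right_cancel)
  have "A - F.XX = 0"
  proof (rule lowering_commutant_zero)
    show "supported (A - F.XX)" by (intro supported_rules A F.supported_basic)
    show "homogeneous (- 1) (A - F.XX)"
      unfolding homogeneous_def
    proof (intro allI impI)
      fix r s assume "(A - F.XX) r s \<noteq> 0"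
      then have "A r s \<noteq> 0 \<or> F.XX r s \<noteq> 0" by auto
      then show "snd s - snd r = - 1"
        using homogeneousD[OF hom] homogeneousD[OF F.homogeneous_basic(3)] by blast
    qed
    show "mul (A - F.XX) YY = mul YY (A - F.XX)"
      using eq by (simp add: mul_distribs algebra_simps)
    show "(A - F.XX) (i, c) (i, d) = 0" for i c d
    proof (cases "i < D")
      case True
      have "F.xc i i d = xc i i d" by (simp add: xc_def F.xc_def Lp_def F.Lp_def Lm_def F.Lm_def)
      then have "F.XX (i, c) (i, d) = XX (i, c) (i, d)" by (simp only: XX_entry F.XX_entry)
      then show ?thesis using A_diag[OF True, of c d] by simp
    next
      case False
      then have "\<not> valid i c" by (simp add: valid_def)
      then show ?thesis using supportedD[OF A, of "(i, c)" "(i, d)"] by (simp add: F.XX_entry)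
    qed
  qed
  then have "A = F.XX" by simp
  with F show ?thesis by blast
qed

text \<open>
  A change of the factors \<open>v\<close>, \<open>w\<close> with fixed products \<open>v i * w
  i\<close> is absorbed by a matrix that is scalar on every hook.
\<close>

lemma fixed_shape_conjugate:
  assumes "frobenius D p al v' w'"
  shows "simultaneously_conjugate (frobenius.XX D p al v' w') YY XX YY"
proof -
  interpret F: frobenius D p al v' w' by (rule assms)
  define d where "d r = v' (fst r) / v (fst r)" for r :: cell
  have dnz: "d r \<noteq> 0" if "r \<in> cells" for r
    using that v_nz[of "fst r"] F.v_nz[of "fst r"] by (cases r) (auto simp: d_def valid_def)
  have "mul F.XX (diagonal d) = mul (diagonal d) XX"
  proof (rule cell_matrix_eqI)
    fix i c j e
    show "(mul F.XX (diagonal d)) (i, c) (j, e) = (mul (diagonal d) XX) (i, c) (j, e)"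
    proof (cases "valid i c \<and> valid j e \<and> c = e + 1")
      case True
      then have ij: "i < D" "j < D" by (auto simp: valid_def)
      have "v' i * w' j * (v' j / v j) = v' i * (v' j * w' j) / v j" by simp
      also have "\<dots> = v' i * (v j * w j) / v j" by (simp only: vw[OF ij(2)] F.vw[OF ij(2)])
      also have "\<dots> = v' i / v i * (v i * w j)" using v_nz[OF ij(1)] v_nz[OF ij(2)] by simp
      finally have e: "v' i * w' j * (v' j / v j) = v' i / v i * (v i * w j)" .
      have "F.xc i j e * d (j, e) = d (i, c) * xc i j e"
      proof (cases "i = j")
        case True
        then show ?thesis by (simp add: d_def xc_def F.xc_def Lp_def F.Lp_def Lm_def F.Lm_def)
      next
        case False
        then show ?thesis using e by (simp add: d_def xc_def F.xc_def Lp_def F.Lp_def Lm_def F.Lm_def)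
      qed
      then show ?thesis using True
        by (simp add: mul_diagonal[OF F.supported_basic(3)] diagonal_mul[OF supported_basic(3)] XX_entry F.XX_entry)
    next
      case False
      then show ?thesis
        by (auto simp: mul_diagonal[OF F.supported_basic(3)] diagonal_mul[OF supported_basic(3)] XX_entry F.XX_entry)
    qed
  qed
  moreover have "mul YY (diagonal d) = mul (diagonal d) YY"
  proof (rule cell_matrix_eqI)
    fix i c j e
    show "(mul YY (diagonal d)) (i, c) (j, e) = (mul (diagonal d) YY) (i, c) (j, e)"
      by (simp only: mul_diagonal[OF supported_basic(2)] diagonal_mul[OF supported_basic(2)])
        (simp add: YY_def Ysh_entry d_def)
  qed
  ultimately show ?thesis unfolding simultaneously_conjugate_def
    using supported_diagonal diagonal_inverse[of d, OF dnz] by blast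
qed

end

section \<open>From cell-indexed matrices to square matrices\<close>

text \<open>
  All columns are multiples of a nonzero one; two independent columns would give rank two.
\<close>

lemma rank_one_iff:
  fixes A :: "complex mat"
  assumes A: "A \<in> carrier_mat n n"
  shows "vec_space.rank n A = 1 \<longleftrightarrow>
    (\<exists>f g. \<forall>i<n. \<forall>j<n. A $$ (i, j) = f i * g j) \<and> (\<exists>i<n. \<exists>j<n. A $$ (i, j) \<noteq> 0)" (is "?R \<longleftrightarrow> ?P \<and> ?N")
proof -
  interpret V: vec_space "TYPE(complex)" n .
  have cols: "set (cols A) \<subseteq> carrier_vec n" using A cols_dim[of A] by auto
  have nonzero: ?N if ?R
  proof (rule ccontr)
    assume "\<not> ?N"
    then have "A = 0\<^sub>m n n" using A by (intro eq_matI) auto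
    then have "V.rank A = 0" using V.rank_0I[of n] by simp
    with that show False by simp
  qed
  have single: "\<not> V.lin_dep {u}" if u: "u \<in> carrier_vec n" "u \<noteq> 0\<^sub>v n" for u
    using V.lindep_span[of "{u}"] u V.span_empty by auto
  have spanD: "\<exists>a. u = a \<cdot>\<^sub>v x" if ux: "u \<in> V.span {x}" "x \<in> carrier_vec n" for u x
  proof -
    obtain a where "u = V.lincomb a {x}" using ux V.finite_span[of "{x}"] by auto
    then show ?thesis using ux(2) by (auto simp: V.lincomb_def)
  qed
  have column: "col A j \<in> carrier_vec n" "col A j \<in> set (cols A)" if "j < n" for j
    using A that by (auto simp: cols_def)
  show ?thesis
  proof
    assume r: ?R
    then obtain i0 j0 where ij0: "i0 < n" "j0 < n" "A $$ (i0, j0) \<noteq> 0" using nonzero by blast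
    let ?u = "col A j0"
    have unz: "?u \<noteq> 0\<^sub>v n"
    proof
      assume "?u = 0\<^sub>v n"
      then have "?u $ i0 = 0" using ij0 by simp
      then show False using ij0 A by simp
    qed
    have "\<exists>a. col A j = a \<cdot>\<^sub>v ?u" if j: "j < n" for j
    proof (rule ccontr)
      assume no: "\<not> (\<exists>a. col A j = a \<cdot>\<^sub>v ?u)"
      then have ne: "col A j \<noteq> ?u" by (metis one_smult_vec)
      have "V.lin_dep {?u, col A j}"
      proof (rule ccontr)
        assume "\<not> V.lin_dep {?u, col A j}"
        then have "card {?u, col A j} \<le> V.rank A"
          using column j ij0(2) by (intro V.rank_ge_card_indpt[OF A]) auto
        then show False using r ne by simp
      qed
      moreover have "V.lin_dep {?u, col A j} = (\<exists>x\<in>{?u, col A j}. x \<in> V.span ({?u, col A j} - {x}))"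
        by (rule V.lindep_span) (simp_all add: column(1)[OF j] column(1)[OF ij0(2)])
      ultimately obtain x where x: "x \<in> {?u, col A j}" "x \<in> V.span ({?u, col A j} - {x})" by blast
      show False
      proof (cases "x = ?u")
        case True
        have "{?u, col A j} - {x} = {col A j}" unfolding True using ne by auto
        then have "?u \<in> V.span {col A j}" using x(2) unfolding True by (simp only:)
        then obtain a where a: "?u = a \<cdot>\<^sub>v col A j" using spanD[OF _ column(1)[OF j]] by blast
        have "a \<noteq> 0"
        proof
          assume "a = 0"
          then have "?u = 0 \<cdot>\<^sub>v col A j" using a by (simp only:)
          also have "\<dots> = 0\<^sub>v n" using column(1)[OF j] by (intro eq_vecI) auto
          finally show False using unz by blast
        qed
        then have "inverse a \<cdot>\<^sub>v (a \<cdot>\<^sub>v col A j) = col A j" by (simp add: smult_smult_assoc)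
        then have "col A j = inverse a \<cdot>\<^sub>v ?u" by (simp only: a)
        then show False using no by blast
      next
        case False
        then have xj: "x = col A j" using x(1) by blast
        have "{?u, col A j} - {x} = {?u}" unfolding xj using ne by auto
        then have "col A j \<in> V.span {?u}" using x(2) unfolding xj by (simp only:)
        then show False using spanD[OF _ column(1)[OF ij0(2)]] no by blast
      qed
    qed
    then have "\<exists>g. \<forall>j. j < n \<longrightarrow> col A j = g j \<cdot>\<^sub>v ?u" by (intro choice) blast
    then obtain g where g: "\<And>j. j < n \<Longrightarrow> col A j = g j \<cdot>\<^sub>v ?u" by blast
    have "A $$ (i, j) = A $$ (i, j0) * g j" if "i < n" "j < n" for i j
    proof -
      have "A $$ (i, j) = col A j $ i" using that A by simp
      also have "\<dots> = g j * (?u $ i)" unfolding g[OF that(2)] using that A by simp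
      finally show ?thesis using that A ij0 by simp
    qed
    then have "\<forall>i<n. \<forall>j<n. A $$ (i, j) = (\<lambda>i. A $$ (i, j0)) i * g j" by blast
    then have ?P by (intro exI[of _ "\<lambda>i. A $$ (i, j0)"] exI[of _ g])
    then show "?P \<and> ?N" using nonzero[OF r] by (rule conjI)
  next
    assume pn: "?P \<and> ?N"
    then obtain f g where fg: "\<And>i j. i < n \<Longrightarrow> j < n \<Longrightarrow> A $$ (i, j) = f i * g j" by blast
    have "V.rank A \<le> 1"
      by (rule V.rank_le_1_product_entries[OF A, of f g]) (use A fg in auto)
    moreover obtain i0 j0 where ij0: "i0 < n" "j0 < n" "A $$ (i0, j0) \<noteq> 0" using pn by blast
    have "col A j0 \<noteq> 0\<^sub>v n"
    proof
      assume "col A j0 = 0\<^sub>v n"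
      then have "col A j0 $ i0 = 0" using ij0 by simp
      then show False using ij0 A by simp
    qed
    then have "card {col A j0} \<le> V.rank A"
      using column[OF ij0(2)] single by (intro V.rank_ge_card_indpt[OF A]) auto
    ultimately show ?R by simp
  qed
qed

lemma jordan_matrix_entry:
  assumes "i < length xs" "j < length xs" "a < fst (xs ! i)" "b < fst (xs ! j)"
  shows "jordan_matrix xs $$ (sum_list (map fst (take i xs)) + a, sum_list (map fst (take j xs)) + b)
    = (if i = j then jordan_block (fst (xs ! i)) (snd (xs ! i)) $$ (a, b) else 0)"
  using assms
proof (induction xs arbitrary: i j)
  case (Cons x xs)
  obtain m e where x: "x = (m, e)" by (cases x)
  let ?S = "sum_list (map fst xs)"
  have inside: "sum_list (map fst (take k xs)) + c < ?S" if "k < length xs" "c < fst (xs ! k)" for k c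
  proof -
    have "xs = take k xs @ xs ! k # drop (Suc k) xs" using that(1) by (simp add: id_take_nth_drop)
    then have "?S = sum_list (map fst (take k xs)) + fst (xs ! k) + sum_list (map fst (drop (Suc k) xs))"
      by (metis list.simps(9) map_append sum_list.Cons sum_list.append add.assoc)
    then show ?thesis using that(2) by simp
  qed
  show ?case
  proof (cases i)
    case 0
    show ?thesis
    proof (cases j)
      case 0
      then show ?thesis using \<open>i = 0\<close> Cons.prems by (simp add: x jordan_matrix_Cons)
    next
      case (Suc j')
      then show ?thesis using \<open>i = 0\<close> Cons.prems inside[of j' b] by (simp add: x jordan_matrix_Cons)
    qed
  next
    case (Suc i')
    show ?thesis
    proof (cases j)
      case 0
      then show ?thesis using Suc Cons.prems inside[of i' a] by (simp add: x jordan_matrix_Cons)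
    next
      case j: (Suc j')
      then show ?thesis using Suc Cons.prems inside[of i' a] inside[of j' b] Cons.IH[of i' j']
        by (simp add: x jordan_matrix_Cons add.assoc)
    qed
  qed
qed simp

context frobenius
begin

definition offset :: "nat \<Rightarrow> nat" where "offset i = (\<Sum>l<i. p l + al l + 1)"

text \<open>
  The cells are numbered hook by hook, and by increasing content within a hook. This is the
  numbering of the rows of \<open>fixed_Y\<close>.
\<close>

definition index :: "cell \<Rightarrow> nat" where "index r = offset (fst r) + nat (snd r + int (p (fst r)))"

lemma offset_mono: "i \<le> j \<Longrightarrow> offset i \<le> offset j"
  unfolding offset_def by (rule sum_mono2) auto

lemma index_bounds: "valid i c \<Longrightarrow> offset i \<le> index (i, c) \<and> index (i, c) < offset (Suc i)"
  by (auto simp: index_def offset_def valid_def)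

lemma index_bij: "bij_betw index cells {..<offset D}"
proof -
  have inj: "inj_on index cells"
  proof (rule inj_onI)
    fix r s assume rs: "r \<in> cells" "s \<in> cells" "index r = index s"
    obtain i c j d where e: "r = (i, c)" "s = (j, d)" by (metis surj_pair)
    have v: "valid i c" "valid j d" using rs e by auto
    have "\<not> i < j" "\<not> j < i"
      using index_bounds[OF v(1)] index_bounds[OF v(2)] offset_mono[of "Suc i" j] offset_mono[of "Suc j" i] rs e by auto
    then have "i = j" by simp
    then show "r = s" using rs(3) v by (auto simp: e index_def valid_def)
  qed
  have sub: "index ` cells \<subseteq> {..<offset D}"
  proof
    fix x assume "x \<in> index ` cells"
    then obtain i c where x: "x = index (i, c)" "valid i c" by (auto simp: cells_def)
    then have "Suc i \<le> D" by (simp add: valid_def)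
    then show "x \<in> {..<offset D}" using index_bounds[OF x(2)] offset_mono[of "Suc i" D] x by simp
  qed
  have "cells = (SIGMA i:{..<D}. {- int (p i)..int (al i)})" by (auto simp: cells_def valid_def)
  then have "card cells = (\<Sum>i<D. card {- int (p i)..int (al i)})" by simp
  also have "\<dots> = offset D" unfolding offset_def by (intro sum.cong) auto
  finally have "card (index ` cells) = card {..<offset D}" using card_image[OF inj] by simp
  then have "index ` cells = {..<offset D}" using card_subset_eq[OF _ sub] by simp
  with inj show ?thesis by (simp add: bij_betw_def)
qed

lemma index_less: "r \<in> cells \<Longrightarrow> index r < offset D"
  using index_bij by (auto simp: bij_betw_def)

definition cell_of :: "nat \<Rightarrow> cell" where "cell_of = inv_into cells index"

lemma cell_of_in: "a < offset D \<Longrightarrow> cell_of a \<in> cells"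
  and index_cell_of: "a < offset D \<Longrightarrow> index (cell_of a) = a"
  using index_bij unfolding cell_of_def bij_betw_def
  by (metis inv_into_into lessThan_iff, metis f_inv_into_f lessThan_iff)

lemma cell_of_index: "r \<in> cells \<Longrightarrow> cell_of (index r) = r"
  using index_bij unfolding cell_of_def bij_betw_def by (simp add: inv_into_f_f)

definition to_mat :: "cell_matrix \<Rightarrow> complex mat" where
  "to_mat A = mat (offset D) (offset D) (\<lambda>(a, b). A (cell_of a) (cell_of b))"

definition of_mat :: "complex mat \<Rightarrow> cell_matrix" where
  "of_mat M = (\<lambda>r s. if r \<in> cells \<and> s \<in> cells then M $$ (index r, index s) else 0)"

abbreviation "square \<equiv> carrier_mat (offset D) (offset D)"

lemma to_mat_carrier: "to_mat A \<in> square" by (simp add: to_mat_def)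

lemma supported_of_mat: "supported (of_mat M)" unfolding supported_def of_mat_def by presburger

lemma of_to_mat: "supported A \<Longrightarrow> of_mat (to_mat A) = A"
  by (rule supported_eqI[OF supported_of_mat])
    (simp_all add: of_mat_def to_mat_def index_less cell_of_index)

lemma of_mat_inj:
  assumes "M \<in> square" "N \<in> square" "of_mat M = of_mat N" shows "M = N"
proof (rule eq_matI)
  fix a b assume "a < dim_row N" "b < dim_col N"
  then have ab: "a < offset D" "b < offset D" using assms by auto
  have "of_mat M (cell_of a) (cell_of b) = of_mat N (cell_of a) (cell_of b)" by (simp only: assms(3))
  then show "M $$ (a, b) = N $$ (a, b)" using ab by (simp add: of_mat_def cell_of_in index_cell_of)
qed (use assms in auto)

lemma of_mat_mult:
  assumes "M \<in> square" "N \<in> square" shows "of_mat (M * N) = of_mat M \<odot> of_mat N"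
proof (rule supported_eqI[OF supported_of_mat supported_intros(1)[OF supported_of_mat supported_of_mat]])
  fix i c j d assume v: "valid i c" "valid j d"
  have "of_mat (M * N) (i, c) (j, d) = (\<Sum>k<offset D. M $$ (index (i, c), k) * N $$ (k, index (j, d)))"
    using v assms index_less[of "(i, c)"] index_less[of "(j, d)"]
    by (simp add: of_mat_def scalar_prod_def atLeast0LessThan)
  also have "\<dots> = (\<Sum>t\<in>cells. M $$ (index (i, c), index t) * N $$ (index t, index (j, d)))"
    by (rule sum.reindex_bij_betw[OF index_bij, symmetric])
  also have "\<dots> = (of_mat M \<odot> of_mat N) (i, c) (j, d)"
    unfolding mul_def using v by (intro sum.cong) (auto simp: of_mat_def)
  finally show "of_mat (M * N) (i, c) (j, d) = (of_mat M \<odot> of_mat N) (i, c) (j, d)" .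
qed

lemma of_mat_add: "M \<in> square \<Longrightarrow> N \<in> square \<Longrightarrow> of_mat (M + N) = of_mat M + of_mat N"
  and of_mat_diff: "M \<in> square \<Longrightarrow> N \<in> square \<Longrightarrow> of_mat (M - N) = of_mat M - of_mat N"
  and of_mat_one: "of_mat (1\<^sub>m (offset D)) = Ysh 0"
proof -
  show "of_mat (M + N) = of_mat M + of_mat N" if "M \<in> square" "N \<in> square"
  proof (rule supported_eqI)
    fix i c j d assume "valid i c" "valid j d"
    then show "of_mat (M + N) (i, c) (j, d) = (of_mat M + of_mat N) (i, c) (j, d)"
      using that index_less[of "(i, c)"] index_less[of "(j, d)"] by (simp add: of_mat_def)
  qed (intro supported_rules supported_of_mat)+
  show "of_mat (M - N) = of_mat M - of_mat N" if "M \<in> square" "N \<in> square"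
  proof (rule supported_eqI)
    fix i c j d assume "valid i c" "valid j d"
    then show "of_mat (M - N) (i, c) (j, d) = (of_mat M - of_mat N) (i, c) (j, d)"
      using that index_less[of "(i, c)"] index_less[of "(j, d)"] by (simp add: of_mat_def)
  qed (intro supported_rules supported_of_mat)+
  show "of_mat (1\<^sub>m (offset D)) = Ysh 0"
  proof (rule supported_eqI[OF supported_of_mat supported_basic(1)])
    fix i c j d assume v: "valid i c" "valid j d"
    have "index (i, c) = index (j, d) \<longleftrightarrow> (i, c) = (j, d)"
      using v inj_on_eq_iff[of index cells "(i, c)" "(j, d)"] index_bij by (simp add: bij_betw_def)
    then show "of_mat (1\<^sub>m (offset D)) (i, c) (j, d) = Ysh 0 (i, c) (j, d)"
      using v index_less[of "(i, c)"] index_less[of "(j, d)"] by (auto simp: of_mat_def Ysh_entry)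
  qed
qed

definition commutator_plus_one :: "cell_matrix \<Rightarrow> cell_matrix \<Rightarrow> cell_matrix" where
  "commutator_plus_one A B = A \<odot> B - B \<odot> A + Ysh 0"

lemma of_mat_commutator:
  assumes "X \<in> square" "Y \<in> square"
  shows "of_mat (X * Y - Y * X + 1\<^sub>m (offset D)) = commutator_plus_one (of_mat X) (of_mat Y)"
proof -
  have c: "X * Y \<in> square" "Y * X \<in> square" "X * Y - Y * X \<in> square" "1\<^sub>m (offset D) \<in> square"
    using assms by auto
  show ?thesis
    by (simp only: of_mat_add[OF c(3,4)] of_mat_diff[OF c(1,2)] of_mat_mult assms of_mat_one commutator_plus_one_def)
qed

text \<open>
  The rank condition in coordinates: the matrix is a nonzero outer product.
\<close>

lemma cm_pairs_iff:
  "(X, Y) \<in> cm_pairs (offset D) \<longleftrightarrow> X \<in> square \<and> Y \<in> square \<and>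
     (\<exists>f g. \<forall>r\<in>cells. \<forall>s\<in>cells. commutator_plus_one (of_mat X) (of_mat Y) r s = f r * g s) \<and>
     commutator_plus_one (of_mat X) (of_mat Y) \<noteq> 0"
proof (cases "X \<in> square \<and> Y \<in> square")
  case True
  then have XY: "X \<in> square" "Y \<in> square" by auto
  define C where "C = X * Y - Y * X + 1\<^sub>m (offset D)"
  have C: "C \<in> square" using XY unfolding C_def by (intro add_carrier_mat one_carrier_mat)
  have ofC: "of_mat C = commutator_plus_one (of_mat X) (of_mat Y)" unfolding C_def by (rule of_mat_commutator[OF XY])
  have 1: "(\<exists>f g. \<forall>i<offset D. \<forall>j<offset D. C $$ (i, j) = f i * g j)
     \<longleftrightarrow> (\<exists>f g. \<forall>r\<in>cells. \<forall>s\<in>cells. of_mat C r s = f r * g s)"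
  proof
    assume "\<exists>f g. \<forall>i<offset D. \<forall>j<offset D. C $$ (i, j) = f i * g j"
    then obtain f g where "\<forall>i<offset D. \<forall>j<offset D. C $$ (i, j) = f i * g j" by blast
    then have "\<forall>r\<in>cells. \<forall>s\<in>cells. of_mat C r s = (f \<circ> index) r * (g \<circ> index) s"
      using index_less by (simp add: of_mat_def)
    then show "\<exists>f g. \<forall>r\<in>cells. \<forall>s\<in>cells. of_mat C r s = f r * g s" by blast
  next
    assume "\<exists>f g. \<forall>r\<in>cells. \<forall>s\<in>cells. of_mat C r s = f r * g s"
    then obtain f g where fg: "\<And>r s. r \<in> cells \<Longrightarrow> s \<in> cells \<Longrightarrow> of_mat C r s = f r * g s" by blast
    have "C $$ (i, j) = (f \<circ> cell_of) i * (g \<circ> cell_of) j" if "i < offset D" "j < offset D" for i j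
      using fg[OF cell_of_in[OF that(1)] cell_of_in[OF that(2)]] that
      by (simp add: of_mat_def cell_of_in index_cell_of)
    then show "\<exists>f g. \<forall>i<offset D. \<forall>j<offset D. C $$ (i, j) = f i * g j" by blast
  qed
  have 2: "(\<exists>i<offset D. \<exists>j<offset D. C $$ (i, j) \<noteq> 0) \<longleftrightarrow> of_mat C \<noteq> 0"
  proof
    assume "\<exists>i<offset D. \<exists>j<offset D. C $$ (i, j) \<noteq> 0"
    then obtain i j where "i < offset D" "j < offset D" "C $$ (i, j) \<noteq> 0" by blast
    then have "of_mat C (cell_of i) (cell_of j) \<noteq> 0" by (simp add: of_mat_def cell_of_in index_cell_of)
    then show "of_mat C \<noteq> 0" by (metis zero_fun_apply)
  next
    assume "of_mat C \<noteq> 0"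
    then obtain r s where "of_mat C r s \<noteq> 0" by (metis ext zero_fun_apply)
    then have "r \<in> cells" "s \<in> cells" "C $$ (index r, index s) \<noteq> 0" by (auto simp: of_mat_def split: if_splits)
    then show "\<exists>i<offset D. \<exists>j<offset D. C $$ (i, j) \<noteq> 0" using index_less by blast
  qed
  have "(X, Y) \<in> cm_pairs (offset D) \<longleftrightarrow> vec_space.rank (offset D) C = 1"
    using XY by (simp add: cm_pairs_def C_def)
  then show ?thesis unfolding rank_one_iff[OF C] 1 2 ofC using XY by blast
qed (auto simp: cm_pairs_def)

lemma conjugate_of_mat:
  assumes "X \<in> square" "Y \<in> square" "X' \<in> square" "Y' \<in> square"
  shows "(\<exists>P Q. similar_mat_wit X X' P Q \<and> similar_mat_wit Y Y' P Q) \<longleftrightarrow>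
    simultaneously_conjugate (of_mat X) (of_mat Y) (of_mat X') (of_mat Y')"
proof
  assume "\<exists>P Q. similar_mat_wit X X' P Q \<and> similar_mat_wit Y Y' P Q"
  then obtain P Q where w: "similar_mat_wit X X' P Q" "similar_mat_wit Y Y' P Q" by blast
  note x = similar_mat_witD2[OF assms(1) w(1)] and y = similar_mat_witD2[OF assms(2) w(2)]
  note P = x(6) and Q = x(7)
  have 1: "of_mat P \<odot> of_mat Q = Ysh 0" "of_mat Q \<odot> of_mat P = Ysh 0"
    using x(1,2) P Q by (simp_all add: of_mat_mult[symmetric] of_mat_one)
  have 2: "of_mat Z \<odot> of_mat P = of_mat P \<odot> of_mat Z'" if "Z = P * Z' * Q" "Z' \<in> square" for Z Z'
  proof -
    have "P * Z' \<in> square" using P that by (intro mult_carrier_mat)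
    then have "of_mat Z = of_mat P \<odot> of_mat Z' \<odot> of_mat Q"
      by (simp only: that(1) of_mat_mult P Q that(2))
    then have "of_mat Z \<odot> of_mat P = of_mat P \<odot> of_mat Z' \<odot> (of_mat Q \<odot> of_mat P)" by (simp only: mul_assoc)
    then show ?thesis by (simp only: 1 unit_mul supported_rules supported_of_mat)
  qed
  show "simultaneously_conjugate (of_mat X) (of_mat Y) (of_mat X') (of_mat Y')"
    unfolding simultaneously_conjugate_def
    using 1 2[OF x(3) assms(3)] 2[OF y(3) assms(4)] supported_of_mat by blast
next
  assume "simultaneously_conjugate (of_mat X) (of_mat Y) (of_mat X') (of_mat Y')"
  then obtain P P' where P: "supported P" "supported P'" "P \<odot> P' = Ysh 0" "P' \<odot> P = Ysh 0"
    "of_mat X \<odot> P = P \<odot> of_mat X'" "of_mat Y \<odot> P = P \<odot> of_mat Y'"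
    unfolding simultaneously_conjugate_def by blast
  let ?P = "to_mat P" and ?Q = "to_mat P'"
  have c: "?P \<in> square" "?Q \<in> square" by (rule to_mat_carrier)+
  have PQ: "?P * ?Q = 1\<^sub>m (offset D)" "?Q * ?P = 1\<^sub>m (offset D)"
    by (rule of_mat_inj; use c P in \<open>simp add: of_mat_mult of_mat_one of_to_mat\<close>)+
  have "Z = ?P * Z' * ?Q" if "of_mat Z \<odot> P = P \<odot> of_mat Z'" "Z \<in> square" "Z' \<in> square" for Z Z'
  proof (rule of_mat_inj[OF that(2)])
    show "?P * Z' * ?Q \<in> square" using c that(3) by (intro mult_carrier_mat)
    have "?P * Z' \<in> square" using c that(3) by (intro mult_carrier_mat)
    then have "of_mat (?P * Z' * ?Q) = P \<odot> of_mat Z' \<odot> P'"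
      by (simp only: of_mat_mult c that(3) of_to_mat P(1,2))
    also have "\<dots> = of_mat Z \<odot> (P \<odot> P')" by (simp only: that(1)[symmetric] mul_assoc)
    also have "\<dots> = of_mat Z" by (simp only: P(3) unit_mul supported_of_mat)
    finally show "of_mat Z = of_mat (?P * Z' * ?Q)" by simp
  qed
  then have "similar_mat_wit X X' ?P ?Q" "similar_mat_wit Y Y' ?P ?Q"
    using P assms PQ c by (auto intro!: similar_mat_witI[of _ _ "offset D"])
  then show "\<exists>P Q. similar_mat_wit X X' P Q \<and> similar_mat_wit Y Y' P Q" by blast
qed

end

section \<open>The stabilizer of the fixed point\<close>

context frobenius
begin

lemma cm_conj_iff:
  "((X, Y), (X', Y')) \<in> cm_conj (offset D) \<longleftrightarrow> (X, Y) \<in> cm_pairs (offset D) \<and> (X', Y') \<in> cm_pairs (offset D)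
    \<and> simultaneously_conjugate (of_mat X) (of_mat Y) (of_mat X') (of_mat Y')"
proof -
  have "(X, Y) \<in> cm_pairs (offset D) \<Longrightarrow> X \<in> square \<and> Y \<in> square" for X Y by (simp add: cm_pairs_def)
  then show ?thesis using conjugate_of_mat[of X Y X' Y'] by (auto simp: cm_conj_def)
qed

lemma equiv_cm_conj: "equiv (cm_pairs (offset D)) (cm_conj (offset D))"
proof (rule equivI)
  show "cm_conj (offset D) \<subseteq> cm_pairs (offset D) \<times> cm_pairs (offset D)" by (auto simp: cm_conj_def)
  show "refl_on (cm_pairs (offset D)) (cm_conj (offset D))"
  proof (rule refl_onI)
    fix q assume q: "q \<in> cm_pairs (offset D)"
    then obtain X Y where XY: "q = (X, Y)" "X \<in> square" "Y \<in> square" by (auto simp: cm_pairs_def)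
    show "(q, q) \<in> cm_conj (offset D)"
      using q similar_mat_wit_refl[OF XY(2)] similar_mat_wit_refl[OF XY(3)] unfolding XY(1) cm_conj_def by blast
  qed
  show "sym (cm_conj (offset D))"
    by (rule symI) (auto simp: cm_conj_def dest: similar_mat_wit_sym)
  show "trans (cm_conj (offset D))"
    by (rule transI) (auto simp: cm_conj_def dest: similar_mat_wit_trans)
qed

text \<open>
  The value of a polynomial at an arbitrary matrix; at \<open>YY\<close> it is
  \<open>Ypoly\<close>.
\<close>

definition poly_at :: "complex poly \<Rightarrow> cell_matrix \<Rightarrow> cell_matrix" where
  "poly_at r B = (\<Sum>i\<le>degree r. scale (coeff r i) (pw B i))"

lemma pw_YY: "pw YY i = Ysh i"
  by (induction i) (simp_all add: YY_powers)

lemma poly_at_YY: "poly_at r YY = Ypoly r"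
  by (simp only: poly_at_def Ypoly_def pw_YY)

lemma supported_poly_at: "supported B \<Longrightarrow> supported (poly_at r B)"
  unfolding poly_at_def by (intro supported_rules supported_pw)

lemma pw_intertwine:
  assumes "supported P" "B \<odot> P = P \<odot> B'" shows "pw B k \<odot> P = P \<odot> pw B' k"
proof (induction k)
  case 0 show ?case by (simp only: pw.simps unit_mul assms(1))
next
  case (Suc k)
  have "pw B (Suc k) \<odot> P = B \<odot> P \<odot> pw B' k" by (simp only: pw.simps mul_assoc Suc)
  then show ?case by (simp only: assms(2) mul_assoc pw.simps)
qed

lemma poly_at_intertwine:
  assumes "supported P" "B \<odot> P = P \<odot> B'" shows "poly_at r B \<odot> P = P \<odot> poly_at r B'"
  unfolding poly_at_def by (simp only: mul_sum mul_distribs pw_intertwine[OF assms])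

definition subst_cells :: "complex mat \<Rightarrow> complex mat \<Rightarrow> free_alg \<Rightarrow> cell_matrix" where
  "subst_cells X Y f = of_mat (substitute (offset D) X Y f)"

lemma subst_cells_entry:
  assumes "valid i c" "valid j d" "finite W" "Poly_Mapping.keys f \<subseteq> W"
  shows "subst_cells X Y f (i, c) (j, d)
    = (\<Sum>w\<in>W. Poly_Mapping.lookup f w * (eval_word (offset D) X Y w $$ (index (i, c), index (j, d))))"
proof -
  have "subst_cells X Y f (i, c) (j, d)
    = (\<Sum>w\<in>Poly_Mapping.keys f. Poly_Mapping.lookup f w * (eval_word (offset D) X Y w $$ (index (i, c), index (j, d))))"
    using assms(1,2) index_less[of "(i, c)"] index_less[of "(j, d)"]
    by (simp add: subst_cells_def of_mat_def substitute_def)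
  also have "\<dots> = (\<Sum>w\<in>W. Poly_Mapping.lookup f w * (eval_word (offset D) X Y w $$ (index (i, c), index (j, d))))"
    using assms(3,4) by (intro sum.mono_neutral_left) (auto simp: in_keys_iff)
  finally show ?thesis .
qed

lemma supported_subst_cells: "supported (subst_cells X Y f)"
  unfolding subst_cells_def by (rule supported_of_mat)

lemma subst_cells_add: "subst_cells X Y (f + g) = subst_cells X Y f + subst_cells X Y g"
proof (rule supported_eqI)
  fix i c j d assume v: "valid i c" "valid j d"
  let ?W = "Poly_Mapping.keys f \<union> Poly_Mapping.keys g"
  have W: "finite ?W" "Poly_Mapping.keys f \<subseteq> ?W" "Poly_Mapping.keys g \<subseteq> ?W" "Poly_Mapping.keys (f + g) \<subseteq> ?W"
    by (auto simp: Poly_Mapping.keys_add)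
  show "subst_cells X Y (f + g) (i, c) (j, d) = (subst_cells X Y f + subst_cells X Y g) (i, c) (j, d)"
    unfolding plus_fun_apply subst_cells_entry[OF v W(1,2)] subst_cells_entry[OF v W(1,3)] subst_cells_entry[OF v W(1,4)]
    by (simp add: lookup_add distrib_right sum.distrib)
qed (intro supported_rules supported_subst_cells)+

lemma subst_cells_single: "subst_cells X Y (Poly_Mapping.single u a) = scale a (of_mat (eval_word (offset D) X Y u))"
proof (rule supported_eqI)
  fix i c j d assume v: "valid i c" "valid j d"
  have "Poly_Mapping.keys (Poly_Mapping.single u a) \<subseteq> {u}" by simp
  from subst_cells_entry[OF v _ this, of X Y] v
  show "subst_cells X Y (Poly_Mapping.single u a) (i, c) (j, d) = scale a (of_mat (eval_word (offset D) X Y u)) (i, c) (j, d)"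
    by (simp add: of_mat_def)
qed (intro supported_rules supported_subst_cells supported_of_mat)+

lemma eval_word_cells:
  assumes "X \<in> square" "Y \<in> square"
  shows "eval_word (offset D) X Y (Word ls) \<in> square"
    and "of_mat (eval_word (offset D) X Y (Word (replicate k GenY))) = pw (of_mat Y) k"
    and "of_mat (eval_word (offset D) X Y (Word [GenX])) = of_mat X"
proof -
  show c: "eval_word (offset D) X Y (Word ls) \<in> square" for ls
    by (induction ls) (use assms in \<open>auto simp: eval_word_def split: generator.split\<close>)
  show "of_mat (eval_word (offset D) X Y (Word (replicate k GenY))) = pw (of_mat Y) k"
  proof (induction k)
    case 0 show ?case by (simp add: eval_word_def of_mat_one)
  next
    case (Suc k)
    have "eval_word (offset D) X Y (Word (replicate (Suc k) GenY)) = Y * eval_word (offset D) X Y (Word (replicate k GenY))"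
      by (simp add: eval_word_def)
    then show ?case using Suc c by (simp only: of_mat_mult[OF assms(2) c] pw.simps)
  qed
  have "eval_word (offset D) X Y (Word [GenX]) = X * 1\<^sub>m (offset D)" by (simp add: eval_word_def)
  then show "of_mat (eval_word (offset D) X Y (Word [GenX])) = of_mat X" using assms by simp
qed

lemma var_y_power: "var_y ^ k = Poly_Mapping.single (Word (replicate k GenY)) 1"
  by (induction k) (simp_all add: var_y_def mult_single plus_word_def zero_word_def[symmetric])

lemma subst_cells_zero: "subst_cells X Y 0 = 0"
  using subst_cells_add[of X Y 0 0] by simp

lemma subst_cells_sum: "subst_cells X Y (\<Sum>i\<in>I. f i) = (\<Sum>i\<in>I. subst_cells X Y (f i))"
  by (induction I rule: infinite_finite_induct)
    (simp_all only: sum.infinite sum.empty sum.insert not_False_eq_True subst_cells_add subst_cells_zero)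

lemma subst_cells_poly_y:
  assumes "X \<in> square" "Y \<in> square" shows "subst_cells X Y (poly_y r) = poly_at r (of_mat Y)"
  unfolding poly_y_def var_y_power const_mult_single subst_cells_sum subst_cells_single
    eval_word_cells[OF assms] poly_at_def by simp

lemma subst_cells_triangular:
  assumes "X \<in> square" "Y \<in> square"
  shows "subst_cells X Y (const b * var_x + poly_y r) = scale b (of_mat X) + poly_at r (of_mat Y)"
    and "subst_cells X Y (const b * var_y + const g) = scale b (of_mat Y) + scale g (Ysh 0)"
proof -
  have x: "const b * var_x = Poly_Mapping.single (Word [GenX]) b" by (simp add: var_x_def const_mult_single)
  show "subst_cells X Y (const b * var_x + poly_y r) = scale b (of_mat X) + poly_at r (of_mat Y)"
    unfolding subst_cells_add subst_cells_poly_y[OF assms] x subst_cells_single eval_word_cells[OF assms] ..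
  have y: "const b * var_y = Poly_Mapping.single (Word (replicate 1 GenY)) b" by (simp add: var_y_def const_mult_single)
  have g: "const g = Poly_Mapping.single (Word (replicate 0 GenY)) g" by (simp add: const_def zero_word_def)
  have "pw (of_mat Y) 1 = of_mat Y" by (simp add: unit_mul supported_of_mat)
  then show "subst_cells X Y (const b * var_y + const g) = scale b (of_mat Y) + scale g (Ysh 0)"
    unfolding subst_cells_add y g subst_cells_single eval_word_cells[OF assms] by (simp only: pw.simps(1))
qed

definition act_cells :: "complex \<Rightarrow> complex poly \<Rightarrow> complex \<Rightarrow> complex mat \<times> complex mat \<Rightarrow> complex mat \<times> complex mat" where
  "act_cells b r g = (\<lambda>(X, Y). (substitute (offset D) X Y (const b * var_x + poly_y r),
      substitute (offset D) X Y (const (inverse b) * var_y + const g)))"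

lemma substitute_carrier: "substitute (offset D) X Y f \<in> square" by (simp add: substitute_def)

lemma act_cells_of_mat:
  assumes "X \<in> square" "Y \<in> square" "act_cells b r g (X, Y) = (X', Y')"
  shows "X' \<in> square" "Y' \<in> square" "of_mat X' = scale b (of_mat X) + poly_at r (of_mat Y)"
    "of_mat Y' = scale (inverse b) (of_mat Y) + scale g (Ysh 0)"
  using assms(3) subst_cells_triangular[OF assms(1,2)] substitute_carrier
  unfolding act_cells_def subst_cells_def by auto

text \<open>
  Since \<open>R\<close> commutes with \<open>B\<close> and the scalars cancel, the pair stays in
  the Calogero-Moser space.
\<close>

lemma commutator_plus_one_triangular:
  assumes b: "b \<noteq> 0" and s: "supported A" "supported B" and R: "supported R" "R \<odot> B = B \<odot> R"
  shows "commutator_plus_one (scale b A + R) (scale (inverse b) B + scale g (Ysh 0)) = commutator_plus_one A B"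
  using b by (simp add: commutator_plus_one_def mul_distribs scale_simps unit_mul s R)
    (simp add: mult.commute)

lemma act_cells_cm_pairs:
  assumes b: "b \<noteq> 0" and q: "q \<in> cm_pairs (offset D)"
  shows "act_cells b r g q \<in> cm_pairs (offset D)"
proof -
  obtain X Y where XY: "q = (X, Y)" by (cases q)
  then have c: "X \<in> square" "Y \<in> square" using q by (auto simp: cm_pairs_def)
  obtain X' Y' where XY': "act_cells b r g (X, Y) = (X', Y')" by fastforce
  note a = act_cells_of_mat[OF c XY']
  have "poly_at r (of_mat Y) \<odot> of_mat Y = of_mat Y \<odot> poly_at r (of_mat Y)"
    by (rule poly_at_intertwine[OF supported_of_mat]) (rule refl)
  then have "commutator_plus_one (of_mat X') (of_mat Y') = commutator_plus_one (of_mat X) (of_mat Y)"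
    unfolding a(3,4) by (intro commutator_plus_one_triangular[OF b] supported_of_mat supported_poly_at)
  then show ?thesis using q a(1,2) unfolding XY XY' cm_pairs_iff by simp
qed

lemma act_cells_conj:
  assumes b: "b \<noteq> 0" and q: "(q, q') \<in> cm_conj (offset D)"
  shows "(act_cells b r g q, act_cells b r g q') \<in> cm_conj (offset D)"
proof -
  obtain X Y X1 Y1 where e: "q = (X, Y)" "q' = (X1, Y1)" by fastforce
  have m: "q \<in> cm_pairs (offset D)" "q' \<in> cm_pairs (offset D)" using q by (auto simp: cm_conj_def)
  then have c: "X \<in> square" "Y \<in> square" "X1 \<in> square" "Y1 \<in> square" by (auto simp: cm_pairs_def e)
  obtain X' Y' where XY': "act_cells b r g (X, Y) = (X', Y')" by fastforce
  obtain X1' Y1' where XY1': "act_cells b r g (X1, Y1) = (X1', Y1')" by fastforce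
  note a = act_cells_of_mat[OF c(1,2) XY'] and a1 = act_cells_of_mat[OF c(3,4) XY1']
  obtain P P' where P: "supported P" "supported P'" "P \<odot> P' = Ysh 0" "P' \<odot> P = Ysh 0"
    "of_mat X \<odot> P = P \<odot> of_mat X1" "of_mat Y \<odot> P = P \<odot> of_mat Y1"
    using q unfolding e cm_conj_iff simultaneously_conjugate_def by blast
  have "of_mat X' \<odot> P = P \<odot> of_mat X1'"
    by (simp only: a a1 mul_distribs P(5) poly_at_intertwine[OF P(1,6)])
  moreover have "of_mat Y' \<odot> P = P \<odot> of_mat Y1'"
    by (simp only: a a1 mul_distribs P(1,6) unit_mul)
  ultimately have "simultaneously_conjugate (of_mat X') (of_mat Y') (of_mat X1') (of_mat Y1')"
    unfolding simultaneously_conjugate_def using P(1-4) by blast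
  then show ?thesis
    using act_cells_cm_pairs[OF b m(1), of r g] act_cells_cm_pairs[OF b m(2), of r g]
    unfolding e XY' XY1' cm_conj_iff by blast
qed

text \<open>
  The action is compatible with conjugation, so a class is fixed iff the image of one
  representative is conjugate to it.
\<close>

lemma cm_action_class:
  assumes "inv\<^bsub>cm_group\<^esub> \<sigma> = triangular b r g" "b \<noteq> 0" and q: "q \<in> cm_pairs (offset D)"
  shows "cm_action (offset D) \<sigma> (cm_conj (offset D) `` {q}) = cm_conj (offset D) `` {q}
    \<longleftrightarrow> (act_cells b r g q, q) \<in> cm_conj (offset D)"
proof -
  let ?C = "cm_conj (offset D)"
  have act: "act_pair (offset D) \<sigma> = act_cells b r g"
    unfolding act_pair_def act_cells_def assms(1) triangular_vars ..
  have "cm_action (offset D) \<sigma> (?C `` {q}) = ?C `` {act_cells b r g q}"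
  proof -
    have "?C `` {act_cells b r g q'} = ?C `` {act_cells b r g q}" if "q' \<in> ?C `` {q}" for q'
    proof -
      have "(q, q') \<in> ?C" using that by simp
      from equiv_class_eq[OF equiv_cm_conj act_cells_conj[OF assms(2) this]] show ?thesis by (rule sym)
    qed
    then have "\<forall>q' \<in> ?C `` {q}. ?C `` {act_cells b r g q'} = ?C `` {act_cells b r g q}" by blast
    then show ?thesis unfolding cm_action_def act
      by (intro UN_constant_eq[OF equiv_class_self[OF equiv_cm_conj q]])
  qed
  then show ?thesis
    by (simp only: eq_equiv_class_iff[OF equiv_cm_conj act_cells_cm_pairs[OF assms(2) q, of r g] q])
qed

text \<open>
  A representative of the fixed point for one choice of the factors \<open>v\<close>,
  \<open>w\<close>.
\<close>

definition base_X :: "complex mat" where "base_X = to_mat XX"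
definition base_Y :: "complex mat" where "base_Y = to_mat YY"

lemma of_mat_base: "of_mat base_X = XX" "of_mat base_Y = YY" "base_X \<in> square" "base_Y \<in> square"
  by (simp_all only: base_X_def base_Y_def of_to_mat supported_basic to_mat_carrier)

lemma base_cm_pair: "D > 0 \<Longrightarrow> (base_X, base_Y) \<in> cm_pairs (offset D)"
proof -
  assume D: "D > 0"
  have C: "commutator_plus_one (of_mat base_X) (of_mat base_Y) = MM"
    by (simp only: commutator_plus_one_def of_mat_base commutator_relation)
  have "\<exists>f g. \<forall>r\<in>cells. \<forall>s\<in>cells. MM r s = f r * g s"
  proof (intro exI ballI)
    fix r s assume "r \<in> cells" "s \<in> cells"
    then show "MM r s = (if snd r = 0 then v (fst r) else 0) * (if snd s = 0 then w (fst s) else 0)"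
      by (cases r; cases s) (simp add: MM_entry)
  qed
  moreover have "MM \<noteq> 0"
  proof -
    have "MM (0, 0) (0, 0) \<noteq> 0" using D v_nz[OF D] w_nz[OF D] by (simp add: MM_entry valid_def)
    then show ?thesis by (metis zero_fun_apply)
  qed
  ultimately show ?thesis unfolding cm_pairs_iff C using of_mat_base by blast
qed

lemma stabilizer_iff:
  assumes D: "D > 0" and b: "b \<noteq> 0" and inv: "inv\<^bsub>cm_group\<^esub> \<sigma> = triangular b r g"
  shows "cm_action (offset D) \<sigma> (cm_conj (offset D) `` {(base_X, base_Y)}) = cm_conj (offset D) `` {(base_X, base_Y)}
    \<longleftrightarrow> g = 0 \<and> (\<forall>m. coeff r m \<noteq> 0 \<longrightarrow> admissible (Suc m))"
proof -
  obtain X' Y' where XY': "act_cells b r g (base_X, base_Y) = (X', Y')" by fastforce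
  note a = act_cells_of_mat[OF of_mat_base(3,4) XY']
  have "cm_action (offset D) \<sigma> (cm_conj (offset D) `` {(base_X, base_Y)}) = cm_conj (offset D) `` {(base_X, base_Y)}
    \<longleftrightarrow> ((X', Y'), (base_X, base_Y)) \<in> cm_conj (offset D)"
    using cm_action_class[OF inv b base_cm_pair[OF D]] by (simp only: XY')
  also have "\<dots> \<longleftrightarrow> simultaneously_conjugate (of_mat X') (of_mat Y') XX YY"
    using act_cells_cm_pairs[OF b base_cm_pair[OF D], of r g] base_cm_pair[OF D]
    by (simp only: XY' cm_conj_iff of_mat_base simp_thms)
  also have "\<dots> \<longleftrightarrow> g = 0 \<and> (\<forall>m. coeff r m \<noteq> 0 \<longrightarrow> admissible (Suc m))"
    by (simp only: a of_mat_base poly_at_YY conjugate_triangular_iff[OF D b])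
  finally show ?thesis .
qed

end

text \<open>
  This is used as the factor \<open>v\<close>, with \<open>w\<close> constantly 1.
\<close>

definition hook_length :: "nat list \<Rightarrow> nat \<Rightarrow> complex" where
  "hook_length \<mu> i = of_nat (leg \<mu> i + arm \<mu> i + 1)"

context
  fixes \<mu> :: "nat list" and n :: nat
  assumes part: "is_partition \<mu> n" and n: "n \<ge> 1"
begin

lemma D_pos: "num_hooks \<mu> > 0" by (rule num_hooks_pos[OF part n])

interpretation frobenius "num_hooks \<mu>" "leg \<mu>" "arm \<mu>" "hook_length \<mu>" "\<lambda>i. 1"
  by unfold_locales (use leg_decreasing[OF part] arm_decreasing[OF part] in \<open>auto simp: hook_length_def\<close>)

lemma hook_offset_eq: "i \<le> num_hooks \<mu> \<Longrightarrow> hook_offset \<mu> i = offset i"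
  unfolding hook_offset_def offset_def by (rule sum.cong) (auto simp: hook_size_eq[OF part])

lemma size_eq: "offset (num_hooks \<mu>) = n" "sum_list \<mu> = n"
  using sum_hook_size[OF part] hook_offset_eq[of "num_hooks \<mu>"] part by (simp_all add: hook_offset_def is_partition_def)

lemma fixed_Y_cells: "fixed_Y \<mu> \<in> carrier_mat n n" "of_mat (fixed_Y \<mu>) = YY"
proof -
  let ?D = "num_hooks \<mu>"
  let ?xs = "map (\<lambda>i. (hook_size \<mu> i, 0::complex)) [0..<?D]"
  have "sum_list (map fst ?xs) = (\<Sum>i<?D. hook_size \<mu> i)"
    by (simp add: o_def interv_sum_list_conv_sum_set_nat atLeast0LessThan)
  then have "sum_list (map fst ?xs) = n" using sum_hook_size[OF part] by simp
  then show "fixed_Y \<mu> \<in> carrier_mat n n" unfolding fixed_Y_def using jordan_matrix_carrier[of ?xs] by simp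
  have off: "sum_list (map fst (take i ?xs)) = offset i" if "i < ?D" for i
  proof -
    have "take i ?xs = map (\<lambda>i. (hook_size \<mu> i, 0)) [0..<i]" using that by (simp add: take_map)
    then have "sum_list (map fst (take i ?xs)) = hook_offset \<mu> i"
      by (simp add: o_def hook_offset_def interv_sum_list_conv_sum_set_nat atLeast0LessThan)
    then show ?thesis using hook_offset_eq that by simp
  qed
  show "of_mat (fixed_Y \<mu>) = YY"
  proof (rule supported_eqI[OF supported_of_mat supported_basic(2)])
    fix i c j d assume v: "valid i c" "valid j d"
    then have ij: "i < ?D" "j < ?D" by (auto simp: valid_def)
    let ?a = "nat (c + int (leg \<mu> i))" and ?b = "nat (d + int (leg \<mu> j))"
    have ab: "?a < hook_size \<mu> i" "?b < hook_size \<mu> j"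
      using v by (auto simp: valid_def hook_size_eq[OF part])
    have "of_mat (fixed_Y \<mu>) (i, c) (j, d) = jordan_matrix ?xs $$ (offset i + ?a, offset j + ?b)"
      using v by (simp add: of_mat_def index_def fixed_Y_def)
    also have "\<dots> = (if i = j then jordan_block (hook_size \<mu> i) 0 $$ (?a, ?b) else 0)"
      using jordan_matrix_entry[of i ?xs j ?a ?b] ij ab off by simp
    also have "\<dots> = YY (i, c) (j, d)"
      using ab v by (auto simp: YY_def Ysh_entry valid_def)
    finally show "of_mat (fixed_Y \<mu>) (i, c) (j, d) = YY (i, c) (j, d)" .
  qed
qed

lemma fixed_Y_base: "fixed_Y \<mu> = base_Y"
  by (rule of_mat_inj) (use fixed_Y_cells of_mat_base size_eq in simp_all)

lemma hook_block_entry: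
  assumes "valid i c" "valid j d"
  shows "hook_block \<mu> X i j $$ (nat (c + int (leg \<mu> i)), nat (d + int (leg \<mu> j))) = of_mat X (i, c) (j, d)"
    and "nat (c + int (leg \<mu> i)) < hook_size \<mu> i" "nat (d + int (leg \<mu> j)) < hook_size \<mu> j"
proof -
  have ij: "i < num_hooks \<mu>" "j < num_hooks \<mu>" using assms by (auto simp: valid_def)
  show ab: "nat (c + int (leg \<mu> i)) < hook_size \<mu> i" "nat (d + int (leg \<mu> j)) < hook_size \<mu> j"
    using assms by (auto simp: valid_def hook_size_eq[OF part])
  show "hook_block \<mu> X i j $$ (nat (c + int (leg \<mu> i)), nat (d + int (leg \<mu> j))) = of_mat X (i, c) (j, d)"
    using assms ab ij by (simp add: hook_block_def of_mat_def index_def hook_offset_eq)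
qed

text \<open>
  In the block of the hook \<open>i\<close> the matrix index of content \<open>c\<close> is
  \<open>c + leg i\<close>, so the index reaches the number of rows exactly where the content
  becomes positive.
\<close>

lemma hook_matrix_entry:
  assumes "valid i c" "valid i d"
  shows "hook_matrix (hook_size \<mu> i) (hook_rows \<mu> i) $$ (nat (c + int (leg \<mu> i)), nat (d + int (leg \<mu> i))) = XX (i, c) (i, d)"
proof -
  have i: "i < num_hooks \<mu>" using assms by (auto simp: valid_def)
  let ?a = "nat (c + int (leg \<mu> i))" and ?b = "nat (d + int (leg \<mu> i))"
  note ab = hook_block_entry(2,3)[OF assms]
  have s: "?a = ?b + 1 \<longleftrightarrow> c = d + 1" using assms by (auto simp: valid_def)
  have "hook_matrix (hook_size \<mu> i) (hook_rows \<mu> i) $$ (?a, ?b)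
     = (if c = d + 1 then (if ?a < hook_rows \<mu> i then of_nat ?a else - of_nat (hook_size \<mu> i - ?a)) else 0)"
    using ab by (simp add: hook_matrix_def s[simplified])
  also have "\<dots> = XX (i, c) (i, d)"
  proof (cases "c = d + 1")
    case True
    show ?thesis
    proof (cases "d < 0")
      case neg: True
      have "?a < hook_rows \<mu> i" using True neg i by (simp add: hook_rows_eq[OF part])
      moreover have "(of_nat ?a :: complex) = of_int (d + 1) + of_nat (leg \<mu> i)"
        using assms(1) True by (simp add: valid_def of_nat_nat)
      ultimately show ?thesis using True neg assms by (simp add: XX_entry xc_def Lm_def)
    next
      case pos: False
      have "\<not> ?a < hook_rows \<mu> i" using True pos i by (simp add: hook_rows_eq[OF part])
      moreover have "int (hook_size \<mu> i - ?a) = int (arm \<mu> i) - d"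
        using ab(1) assms(1) True i by (simp add: hook_size_eq[OF part] valid_def)
      then have "(of_nat (hook_size \<mu> i - ?a) :: complex) = of_nat (arm \<mu> i) - of_int d"
        by (metis of_int_diff of_int_of_nat_eq)
      ultimately show ?thesis using True pos assms by (simp add: XX_entry xc_def Lp_def)
    qed
  qed (simp add: XX_entry)
  finally show ?thesis .
qed

lemma fixed_X_shape_cells:
  assumes "fixed_X_shape \<mu> X"
  shows "X \<in> carrier_mat n n" "i < num_hooks \<mu> \<Longrightarrow> of_mat X (i, c) (i, d) = XX (i, c) (i, d)"
    "i \<noteq> j \<Longrightarrow> of_mat X (i, c) (j, d) \<noteq> 0 \<Longrightarrow> c = d + 1"
proof -
  show "X \<in> carrier_mat n n" using assms size_eq by (simp add: fixed_X_shape_def)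
  show "of_mat X (i, c) (i, d) = XX (i, c) (i, d)" if i: "i < num_hooks \<mu>"
  proof (cases "valid i c \<and> valid i d")
    case True
    then show ?thesis using assms i hook_block_entry(1)[of i c i d X] hook_matrix_entry[of i c d]
      by (simp add: fixed_X_shape_def)
  next
    case False
    then show ?thesis by (auto simp: of_mat_def XX_entry)
  qed
  show "c = d + 1" if ij: "i \<noteq> j" and nz: "of_mat X (i, c) (j, d) \<noteq> 0"
  proof -
    have v: "valid i c" "valid j d" using nz by (auto simp: of_mat_def split: if_splits)
    then have D: "i < num_hooks \<mu>" "j < num_hooks \<mu>" by (auto simp: valid_def)
    have "int (nat (d + int (leg \<mu> j))) - int (nat (c + int (leg \<mu> i))) = int (hook_rows \<mu> j) - int (hook_rows \<mu> i) - 1"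
      using assms D ij nz hook_block_entry(2,3)[OF v] hook_block_entry(1)[OF v, of X] unfolding fixed_X_shape_def by metis
    then show ?thesis using v D by (simp add: hook_rows_eq[OF part] valid_def)
  qed
qed

lemma base_X_shape: "fixed_X_shape \<mu> base_X"
  unfolding fixed_X_shape_def
proof (intro conjI allI impI)
  show "base_X \<in> carrier_mat (sum_list \<mu>) (sum_list \<mu>)" using of_mat_base(3) size_eq by simp
  have cell: "valid i (int a - int (leg \<mu> i))" "nat (int a - int (leg \<mu> i) + int (leg \<mu> i)) = a"
    if "i < num_hooks \<mu>" "a < hook_size \<mu> i" for i a
    using that by (auto simp: valid_def hook_size_eq[OF part])
  fix i assume i: "i < num_hooks \<mu>"
  show "hook_block \<mu> base_X i i = hook_matrix (hook_size \<mu> i) (hook_rows \<mu> i)"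
  proof (rule eq_matI)
    fix a b assume "a < dim_row (hook_matrix (hook_size \<mu> i) (hook_rows \<mu> i))" "b < dim_col (hook_matrix (hook_size \<mu> i) (hook_rows \<mu> i))"
    then have ab: "a < hook_size \<mu> i" "b < hook_size \<mu> i" by (auto simp: hook_matrix_def)
    show "hook_block \<mu> base_X i i $$ (a, b) = hook_matrix (hook_size \<mu> i) (hook_rows \<mu> i) $$ (a, b)"
      using hook_block_entry(1)[OF cell(1)[OF i ab(1)] cell(1)[OF i ab(2)], of base_X]
        hook_matrix_entry[OF cell(1)[OF i ab(1)] cell(1)[OF i ab(2)]]
      unfolding cell(2)[OF i ab(1)] cell(2)[OF i ab(2)] of_mat_base by simp
  qed (simp_all add: hook_block_def hook_matrix_def)
  fix j a b assume j: "j < num_hooks \<mu>" "i \<noteq> j" and ab: "a < hook_size \<mu> i" "b < hook_size \<mu> j"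
    and nz: "hook_block \<mu> base_X i j $$ (a, b) \<noteq> 0"
  have "XX (i, int a - int (leg \<mu> i)) (j, int b - int (leg \<mu> j)) \<noteq> 0"
    using nz hook_block_entry(1)[OF cell(1)[OF i ab(1)] cell(1)[OF j(1) ab(2)], of base_X]
    unfolding cell(2)[OF i ab(1)] cell(2)[OF j(1) ab(2)] of_mat_base by simp
  then have "int a - int (leg \<mu> i) = int b - int (leg \<mu> j) + 1" by (auto simp: XX_entry split: if_splits)
  then show "int b - int a = int (hook_rows \<mu> j) - int (hook_rows \<mu> i) - 1"
    using i j by (simp add: hook_rows_eq[OF part])
qed

text \<open>
  Every matrix of the prescribed shape satisfying the rank condition is the base matrix for other
  factors \<open>v\<close>, \<open>w\<close>.
\<close>

lemma fixed_shape_in_class: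
  assumes "fixed_X_shape \<mu> X" "(X, fixed_Y \<mu>) \<in> cm_pairs n"
  shows "((X, fixed_Y \<mu>), (base_X, base_Y)) \<in> cm_conj n"
proof -
  note sh = fixed_X_shape_cells[OF assms(1)]
  obtain f g where fg: "\<forall>r\<in>cells. \<forall>s\<in>cells. commutator_plus_one (of_mat X) YY r s = f r * g s"
  proof -
    have "(X, fixed_Y \<mu>) \<in> cm_pairs (offset (num_hooks \<mu>))" using assms(2) by (simp only: size_eq(1))
    then show thesis using that unfolding cm_pairs_iff fixed_Y_cells(2) by blast
  qed
  obtain v' w' where vw': "frobenius (num_hooks \<mu>) (leg \<mu>) (arm \<mu>) v' w'"
    "of_mat X = frobenius.XX (num_hooks \<mu>) (leg \<mu>) (arm \<mu>) v' w'"
  proof -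
    have "\<exists>v' w'. frobenius (num_hooks \<mu>) (leg \<mu>) (arm \<mu>) v' w'
      \<and> of_mat X = frobenius.XX (num_hooks \<mu>) (leg \<mu>) (arm \<mu>) v' w'"
    proof (rule fixed_shape_unique[where f = f and g = g, OF D_pos supported_of_mat])
      show "of_mat X (i, c) (i, d) = XX (i, c) (i, d)" if "i < num_hooks \<mu>" for i c d
        by (rule sh(2)[OF that])
      show "c = d + 1" if "i \<noteq> j" "of_mat X (i, c) (j, d) \<noteq> 0" for i j c d
        by (rule sh(3)[OF that])
      show "(mul (of_mat X) YY - mul YY (of_mat X) + Ysh 0) r s = f r * g s" if "r \<in> cells" "s \<in> cells" for r s
        using fg that unfolding commutator_plus_one_def by blast
    qed
    then show thesis using that by blast
  qed
  have sc: "simultaneously_conjugate (of_mat X) (of_mat (fixed_Y \<mu>)) (of_mat base_X) (of_mat base_Y)"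
    unfolding vw'(2) fixed_Y_cells(2) of_mat_base by (rule fixed_shape_conjugate[OF vw'(1)])
  have m: "(X, fixed_Y \<mu>) \<in> cm_pairs (offset (num_hooks \<mu>))" using assms(2) by (simp only: size_eq(1))
  have "((X, fixed_Y \<mu>), (base_X, base_Y)) \<in> cm_conj (offset (num_hooks \<mu>))"
    unfolding cm_conj_iff by (intro conjI m sc base_cm_pair[OF D_pos])
  then show ?thesis by (simp only: size_eq(1))
qed

lemma fixed_point_eq: "fixed_point \<mu> = cm_conj n `` {(base_X, base_Y)}"
  unfolding fixed_point_def size_eq(2)
proof (rule the_equality)
  have base: "(base_X, base_Y) \<in> cm_pairs n" using base_cm_pair[OF D_pos] size_eq by simp
  have eq: "equiv (cm_pairs n) (cm_conj n)" using equiv_cm_conj size_eq by simp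
  show "cm_conj n `` {(base_X, base_Y)} \<in> cm_space n \<and>
    (\<exists>X. fixed_X_shape \<mu> X \<and> (X, fixed_Y \<mu>) \<in> cm_conj n `` {(base_X, base_Y)})"
    unfolding fixed_Y_base cm_space_def
    by (intro conjI exI[of _ base_X] quotientI[OF base] base_X_shape equiv_class_self[OF eq base])
  fix q assume q: "q \<in> cm_space n \<and> (\<exists>X. fixed_X_shape \<mu> X \<and> (X, fixed_Y \<mu>) \<in> q)"
  then obtain X where X: "fixed_X_shape \<mu> X" "(X, fixed_Y \<mu>) \<in> q" by blast
  have "q \<in> cm_pairs n // cm_conj n" using q by (simp add: cm_space_def)
  then obtain x where x: "q = cm_conj n `` {x}" by (rule quotientE)
  then have xX: "(x, (X, fixed_Y \<mu>)) \<in> cm_conj n" using X(2) by simp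
  then have m: "(X, fixed_Y \<mu>) \<in> cm_pairs n" by (auto simp: cm_conj_def)
  have "q = cm_conj n `` {(X, fixed_Y \<mu>)}" unfolding x by (rule equiv_class_eq[OF eq xX])
  also have "\<dots> = cm_conj n `` {(base_X, base_Y)}"
    by (rule equiv_class_eq[OF eq fixed_shape_in_class[OF X(1) m]])
  finally show "q = cm_conj n `` {(base_X, base_Y)}" .
qed

lemma admissible_iff_S_set: "admissible (Suc m) \<longleftrightarrow> Suc m \<in> S_set \<mu>"
  unfolding admissible_def by (rule S_set_iff[OF part, symmetric]) simp

text \<open>
  The action uses the inverse automorphism; passing to the inverse rescales the coefficients of
  \<open>q\<close> once \<open>h = 0\<close>, so the same monomials occur.
\<close>

lemma stab_B_eq: "stab_B \<mu> = {triangular a q 0 | a q. a \<noteq> 0 \<and> (\<forall>m. coeff q m \<noteq> 0 \<longrightarrow> Suc m \<in> S_set \<mu>)}"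
proof -
  have iff: "cm_action n (triangular a q h) (fixed_point \<mu>) = fixed_point \<mu>
    \<longleftrightarrow> h = 0 \<and> (\<forall>m. coeff q m \<noteq> 0 \<longrightarrow> Suc m \<in> S_set \<mu>)" if a: "a \<noteq> 0" for a q h
  proof -
    define r where "r = - Polynomial.smult (inverse a) (pcompose q [:- a * h, a:])"
    have ia: "inverse a \<noteq> 0" using a by simp
    have "cm_action n (triangular a q h) (fixed_point \<mu>) = fixed_point \<mu>
      \<longleftrightarrow> - a * h = 0 \<and> (\<forall>m. coeff r m \<noteq> 0 \<longrightarrow> admissible (Suc m))"
      using stabilizer_iff[OF D_pos ia inv_triangular[OF a, of q h]]
      unfolding size_eq(1) fixed_point_eq r_def .
    moreover have "coeff r m \<noteq> 0 \<longleftrightarrow> coeff q m \<noteq> 0" if "h = 0" for m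
      using a that by (simp add: r_def pcompose_scale_coeff)
    ultimately show ?thesis using a by (auto simp: admissible_iff_S_set)
  qed
  have "stab_B \<mu> = {\<sigma> \<in> subgroup_B. cm_action n \<sigma> (fixed_point \<mu>) = fixed_point \<mu>}"
    by (simp add: stab_B_def stabilizer_def size_eq(2))
  also have "\<dots> = {triangular a q 0 | a q. a \<noteq> 0 \<and> (\<forall>m. coeff q m \<noteq> 0 \<longrightarrow> Suc m \<in> S_set \<mu>)}"
  proof (intro equalityI subsetI)
    fix \<sigma> assume \<sigma>: "\<sigma> \<in> {\<sigma> \<in> subgroup_B. cm_action n \<sigma> (fixed_point \<mu>) = fixed_point \<mu>}"
    then obtain a q h where a: "\<sigma> = triangular a q h" "a \<noteq> 0" unfolding subgroup_B_eq by blast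
    then have "h = 0" "\<forall>m. coeff q m \<noteq> 0 \<longrightarrow> Suc m \<in> S_set \<mu>" using \<sigma> iff[OF a(2), of q h] by simp_all
    then show "\<sigma> \<in> {triangular a q 0 | a q. a \<noteq> 0 \<and> (\<forall>m. coeff q m \<noteq> 0 \<longrightarrow> Suc m \<in> S_set \<mu>)}" using a by blast
  next
    fix \<sigma> assume "\<sigma> \<in> {triangular a q 0 | a q. a \<noteq> 0 \<and> (\<forall>m. coeff q m \<noteq> 0 \<longrightarrow> Suc m \<in> S_set \<mu>)}"
    then obtain a q where a: "\<sigma> = triangular a q 0" "a \<noteq> 0" "\<forall>m. coeff q m \<noteq> 0 \<longrightarrow> Suc m \<in> S_set \<mu>" by blast
    then have "cm_action n \<sigma> (fixed_point \<mu>) = fixed_point \<mu>" using iff[OF a(2), of q 0] by simp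
    moreover have "\<sigma> \<in> subgroup_B" using a unfolding subgroup_B_eq by blast
    ultimately show "\<sigma> \<in> {\<sigma> \<in> subgroup_B. cm_action n \<sigma> (fixed_point \<mu>) = fixed_point \<mu>}" by blast
  qed
  finally show ?thesis .
qed

text \<open>
  Exponents in \<open>S\<^sub>\<mu>\<close> are positive, so the subtraction \<open>s - 1\<close>
  is exact.
\<close>

lemma G_mu_y_eq: "G_mu_y \<mu> = {triangular 1 q 0 | q. \<forall>m. coeff q m \<noteq> 0 \<longrightarrow> Suc m \<in> S_set \<mu>}"
proof -
  have "(\<exists>s\<in>S_set \<mu>. m = s - 1) \<longleftrightarrow> Suc m \<in> S_set \<mu>" for m
  proof
    assume "\<exists>s\<in>S_set \<mu>. m = s - 1"
    then obtain s where "s \<in> S_set \<mu>" "m = s - 1" by blast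
    moreover from this have "s \<ge> 1" by (simp add: S_set_def)
    ultimately show "Suc m \<in> S_set \<mu>" by simp
  qed (auto intro!: bexI[of _ "Suc m"])
  then show ?thesis unfolding G_mu_y_def generated_subgroup_eq by simp
qed

lemma stab_B_semidirect: "internal_semidirect cm_group (stab_B \<mu>) subgroup_T (G_mu_y \<mu>)"
  unfolding stab_B_eq G_mu_y_eq by (rule semidirect_triangular)

end

theorem corollary11:
  fixes \<mu> :: "nat list" and n :: nat
  assumes "n \<ge> 1" and "is_partition \<mu> n"
  shows "internal_semidirect cm_group (stab_B \<mu>) subgroup_T (G_mu_y \<mu>)"
  by (rule stab_B_semidirect[OF assms(2,1)])

end
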